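(* Let $X=\mathbb R^d$, let $\kappa\colon\mathbb R^d\to(0,\infty)$ be bounded and continuous with $\sup_{x\in\mathbb R^d}\sup_{|y|\le1}\frac{\kappa(x)}{\kappa(x-y)}<\infty$, and let $(S(t))_{t\ge0}$ be a convex monotone semigroup on $C_\kappa$ with $\Gamma$-generator $A_\Gamma$. Let $\eta\colon\mathbb R^d\to[0,\infty)$ be infinitely differentiable with support in the closed unit ball and $\int\eta\,dx=1$, and set $\eta_n(x):=n^d\eta(nx)$. Let $I\subset\mathbb N_0^d$ be a finite index set and let $H\colon\mathbb R^I\to\mathbb R$ be convex. Let $f\in\mathcal L_S^+$ be such that, for every $\varepsilon>0$, there exist $\delta,t_0>0$ with $$S(t)(\tau_xf)\le\tau_xS(t)f+\frac{\varepsilon t}{\kappa}\quad\text{for all }t\in[0,t_0]\text{ and }|x|\le\delta.$$ For every $n\in\mathbb N$ define $f_n:=f*\eta_n$ and assume that (i) the distributional derivative $D^\alpha f$ is a regular distribution for all $\alpha\in I$; (ii) $H((D^\alpha f)_{\alpha\in I})$ is locally integrable; (iii) $f_n\in D(A_\Gamma)$ and $A_\Gamma f_n=H((D^\alpha f_n)_{\alpha\in I})$ for all $n\in\mathbb N$. Define $$g(x):=H\big((D^\alpha f(x))_{\alpha\in I}\big)\ (x\in\mathbb R^d),\qquad \tilde g(x):=\lim_{r\downarrow0}\frac1{\lambda(B(x,r))}\int_{B(x,r)}g(y)\,dy\ (x\in X_g),$$ $$\overline g(x):=\limsup_{y\in X_g,\,y\to x}\tilde g(y)\ (x\in\mathbb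 R^d).$$ Then $f\in D(A_\Gamma)$ and $(A_\Gamma f)(x)=\overline g(x)$ for all $x\in\mathbb R^d$.
   Context: $\lambda$ is Lebesgue measure, $B(x,r)$ the closed ball. For a locally integrable $g\colon\mathbb R^d\to\mathbb R$, $X_g:=\{x\in\mathbb R^d:\lim_{r\downarrow0}\frac1{\lambda(B(x,r))}\int_{B(x,r)}g(y)\,dy\text{ exists in }\mathbb R\}$ (a dense set). In the definition of $g$, arbitrary representatives of the $D^\alpha f$ are chosen; $\tilde g,\overline g$ do not depend on this choice. Here $\limsup_{y\in X_g,y\to x}\tilde g(y)=\inf_{\delta>0}\sup_{y\in X_g\cap B(x,\delta)}\tilde g(y)$. $(f*\eta_n)(x):=\int f(x-y)\eta_n(y)\,dy$; $(\tau_xf)(y):=f(x+y)$. $\|f\|_\kappa:=\sup_{x}|f(x)|\kappa(x)$, $f^+=\max\{f,0\}$; functions are ordered pointwise. $C_\kappa$ is the space of continuous $f\colon\mathbb R^d\to\mathbb R$ with $\|f\|_\kappa<\infty$; $U_\kappa$ is the set of upper semicontinuous $f\colon\mathbb R^d\to[-\infty,\infty)$ with $\|f^+\|_\kappa<\infty$. A convex monotone semigroup on $C_\kappa$ is a family of operators $S(t)\colon C_\kappa\to C_\kappa$, $t\ge0$, such that: (S1) each $S(t)$ is convex and monotone, and $S(t)f_n\downarrow0$ pointwise whenever $(f_n)\subset C_\kappa$ decreases pointwise to $0$; (S2) $S(0)f=f$ and $S(s+t)f=S(s)S(t)f$; (S3) $\sup_{t\in[0,T]}\|S(t)\frac r\kappa\|_\kappa<\infty$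 for all $r,T\ge0$; (S4) for all $t\ge0$, $f\in C_\kappa$: $\limsup_n(S(s_n)f)(x_n)\le(S(t)f)(x)$ for all $x$ and all sequences $0\le s_n\to t$, $x_n\to x$. $\mathcal L_S^+$ is the set of $f\in C_\kappa$ with $\limsup_{h\downarrow0}\|\frac{(S(h)f-f)^+}{h}\|_\kappa<\infty$. For a sequence $(f_n)\subset U_\kappa$ with $\sup_n\|f_n^+\|_\kappa<\infty$, $f=\Gamma\text{-}\lim_nf_n$ with $f\in U_\kappa$ means: for every $x$, $f(x)\ge\limsup_nf_n(x_n)$ for every $x_n\to x$ and $f(x)=\lim_nf_n(x_n)$ for some $x_n\to x$; $f=\Gamma\text{-}\lim_{h\downarrow0}f_h$ means $f=\Gamma\text{-}\lim_nf_{h_n}$ for all sequences $h_n>0$, $h_n\to0$. The $\Gamma$-generator is $A_\Gamma f:=\Gamma\text{-}\lim_{h\downarrow0}\frac{S(h)f-f}{h}\in U_\kappa$, with domain $D(A_\Gamma)$ all $f\in\mathcal L_S^+$ for which this $\Gamma$-limit exists. *)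

theory Defs
  imports "HOL-Analysis.Analysis"
begin

section \<open>Weighted function spaces\<close>

definition wnorm :: "('a \<Rightarrow> real) \<Rightarrow> ('a \<Rightarrow> ereal) \<Rightarrow> ereal" where
  "wnorm \<kappa> u = (SUP x. \<bar>u x\<bar> * ereal (\<kappa> x))"

definition C_space :: "('a::topological_space \<Rightarrow> real) \<Rightarrow> ('a \<Rightarrow> real) set" where
  "C_space \<kappa> = {f. continuous_on UNIV f \<and> wnorm \<kappa> (\<lambda>x. ereal (f x)) < \<infinity>}"

definition usc :: "('a::topological_space \<Rightarrow> ereal) \<Rightarrow> bool" where
  "usc u \<longleftrightarrow> (\<forall>c. open {x. u x < c})"

definition U_space :: "('a::topological_space \<Rightarrow> real) \<Rightarrow> ('a \<Rightarrow> ereal) set" where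
  "U_space \<kappa> = {u. usc u \<and> (\<forall>x. u x < \<infinity>) \<and> wnorm \<kappa> (\<lambda>x. max (u x) 0) < \<infinity>}"


section \<open>Convex monotone semigroups and their generators\<close>

text \<open>The operators are total functions; only their values at times \<open>t \<ge> 0\<close> and on
  \<^term>\<open>C_space \<kappa>\<close> are constrained.\<close>

definition convex_monotone_semigroup ::
  "('a::topological_space \<Rightarrow> real) \<Rightarrow> (real \<Rightarrow> ('a \<Rightarrow> real) \<Rightarrow> 'a \<Rightarrow> real) \<Rightarrow> bool" where
  "convex_monotone_semigroup \<kappa> S \<longleftrightarrow>
     (\<forall>t\<ge>0. \<forall>f\<in>C_space \<kappa>. S t f \<in> C_space \<kappa>) \<and>
     (\<forall>t\<ge>0. \<forall>f\<in>C_space \<kappa>. \<forall>g\<in>C_space \<kappa>. \<forall>c\<in>{0..1}. \<forall>x.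
        S t (\<lambda>y. c * f y + (1 - c) * g y) x \<le> c * S t f x + (1 - c) * S t g x) \<and>
     (\<forall>t\<ge>0. \<forall>f\<in>C_space \<kappa>. \<forall>g\<in>C_space \<kappa>.
        (\<forall>x. f x \<le> g x) \<longrightarrow> (\<forall>x. S t f x \<le> S t g x)) \<and>
     (\<forall>t\<ge>0. \<forall>F :: nat \<Rightarrow> 'a \<Rightarrow> real.
        (\<forall>n. F n \<in> C_space \<kappa>) \<and> (\<forall>x. decseq (\<lambda>n. F n x) \<and> (\<lambda>n. F n x) \<longlonglongrightarrow> 0) \<longrightarrow>
        (\<forall>x. decseq (\<lambda>n. S t (F n) x) \<and> (\<lambda>n. S t (F n) x) \<longlonglongrightarrow> 0)) \<and>
     (\<forall>f\<in>C_space \<kappa>. S 0 f = f) \<and>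
     (\<forall>s\<ge>0. \<forall>t\<ge>0. \<forall>f\<in>C_space \<kappa>. S (s + t) f = S s (S t f)) \<and>
     (\<forall>r\<ge>0. \<forall>T\<ge>0. (SUP t\<in>{0..T}. wnorm \<kappa> (\<lambda>x. ereal (S t (\<lambda>y. r / \<kappa> y) x))) < \<infinity>) \<and>
     (\<forall>t\<ge>0. \<forall>f\<in>C_space \<kappa>. \<forall>x. \<forall>s xs.
        (\<forall>n. 0 \<le> s n) \<and> s \<longlonglongrightarrow> t \<and> xs \<longlonglongrightarrow> x \<longrightarrow>
        limsup (\<lambda>n. ereal (S (s n) f (xs n))) \<le> ereal (S t f x))"

definition L_plus ::
  "('a::topological_space \<Rightarrow> real) \<Rightarrow> (real \<Rightarrow> ('a \<Rightarrow> real) \<Rightarrow> 'a \<Rightarrow> real) \<Rightarrow> ('a \<Rightarrow> real) set" where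
  "L_plus \<kappa> S = {f \<in> C_space \<kappa>.
     Limsup (at_right 0) (\<lambda>h. wnorm \<kappa> (\<lambda>x. ereal (max (S h f x - f x) 0 / h))) < \<infinity>}"

definition Gamma_seq_lim ::
  "('a::topological_space \<Rightarrow> real) \<Rightarrow> (nat \<Rightarrow> 'a \<Rightarrow> ereal) \<Rightarrow> ('a \<Rightarrow> ereal) \<Rightarrow> bool" where
  "Gamma_seq_lim \<kappa> F u \<longleftrightarrow>
     (\<forall>n. F n \<in> U_space \<kappa>) \<and> (SUP n. wnorm \<kappa> (\<lambda>x. max (F n x) 0)) < \<infinity> \<and> u \<in> U_space \<kappa> \<and>
     (\<forall>x. (\<forall>xs. xs \<longlonglongrightarrow> x \<longrightarrow> limsup (\<lambda>n. F n (xs n)) \<le> u x) \<and>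
          (\<exists>xs. xs \<longlonglongrightarrow> x \<and> (\<lambda>n. F n (xs n)) \<longlonglongrightarrow> u x))"

definition Gamma_right_lim ::
  "('a::topological_space \<Rightarrow> real) \<Rightarrow> (real \<Rightarrow> 'a \<Rightarrow> ereal) \<Rightarrow> ('a \<Rightarrow> ereal) \<Rightarrow> bool" where
  "Gamma_right_lim \<kappa> F u \<longleftrightarrow>
     (\<forall>h :: nat \<Rightarrow> real. (\<forall>n. 0 < h n) \<and> h \<longlonglongrightarrow> 0 \<longrightarrow> Gamma_seq_lim \<kappa> (\<lambda>n. F (h n)) u)"

text \<open>Gamma-limits are unique, so that the definite description in the generator below is
  well defined.\<close>

lemma Gamma_seq_lim_unique:
  assumes "Gamma_seq_lim \<kappa> F u" "Gamma_seq_lim \<kappa> F v"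
  shows "u = v"
proof -
  have *: "u x \<le> v x" if "Gamma_seq_lim \<kappa> F u" "Gamma_seq_lim \<kappa> F v" for u v x
  proof -
    obtain xs where xs: "xs \<longlonglongrightarrow> x" "(\<lambda>n. F n (xs n)) \<longlonglongrightarrow> u x"
      using \<open>Gamma_seq_lim \<kappa> F u\<close> unfolding Gamma_seq_lim_def by blast
    then have "limsup (\<lambda>n. F n (xs n)) = u x"
      by (intro lim_imp_Limsup) auto
    then show ?thesis
      using xs(1) \<open>Gamma_seq_lim \<kappa> F v\<close> unfolding Gamma_seq_lim_def by metis
  qed
  show ?thesis using *[OF assms] *[OF assms(2,1)] by (intro ext antisym)
qed

lemma Gamma_right_lim_unique:
  assumes "Gamma_right_lim \<kappa> F u" "Gamma_right_lim \<kappa> F v"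
  shows "u = v"
proof -
  define h where "h = (\<lambda>n. inverse (real (Suc n)))"
  have h: "(\<forall>n. 0 < h n) \<and> h \<longlonglongrightarrow> 0"
    unfolding h_def using LIMSEQ_inverse_real_of_nat by simp
  have "Gamma_seq_lim \<kappa> (\<lambda>n. F (h n)) u" "Gamma_seq_lim \<kappa> (\<lambda>n. F (h n)) v"
    using assms h unfolding Gamma_right_lim_def by blast+
  then show ?thesis by (rule Gamma_seq_lim_unique)
qed

definition diff_quot ::
  "(real \<Rightarrow> ('a \<Rightarrow> real) \<Rightarrow> 'a \<Rightarrow> real) \<Rightarrow> ('a \<Rightarrow> real) \<Rightarrow> real \<Rightarrow> 'a \<Rightarrow> ereal" where
  "diff_quot S f h x = ereal ((S h f x - f x) / h)"

definition Gamma_dom ::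
  "('a::topological_space \<Rightarrow> real) \<Rightarrow> (real \<Rightarrow> ('a \<Rightarrow> real) \<Rightarrow> 'a \<Rightarrow> real) \<Rightarrow> ('a \<Rightarrow> real) set" where
  "Gamma_dom \<kappa> S = {f \<in> L_plus \<kappa> S. \<exists>u. Gamma_right_lim \<kappa> (diff_quot S f) u}"

definition Gamma_gen ::
  "('a::topological_space \<Rightarrow> real) \<Rightarrow> (real \<Rightarrow> ('a \<Rightarrow> real) \<Rightarrow> 'a \<Rightarrow> real) \<Rightarrow> ('a \<Rightarrow> real) \<Rightarrow> 'a \<Rightarrow> ereal" where
  "Gamma_gen \<kappa> S f = (THE u. Gamma_right_lim \<kappa> (diff_quot S f) u)"


section \<open>Smooth functions, convolution and distributional derivatives\<close>

definition partial :: "'d \<Rightarrow> (real^'d::finite \<Rightarrow> real) \<Rightarrow> real^'d \<Rightarrow> real" where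
  "partial i f x = deriv (\<lambda>t. f (x + t *\<^sub>R axis i 1)) 0"

text \<open>Infinitely differentiable: all iterated partial derivatives, in any order of the
  coordinates, are differentiable.\<close>

definition smooth :: "(real^'d::finite \<Rightarrow> real) \<Rightarrow> bool" where
  "smooth f \<longleftrightarrow> (\<forall>is. foldr partial is f differentiable_on UNIV)"

text \<open>Multi-indices are elements of \<^typ>\<open>nat^'d\<close>. Coordinates are indexed by an unordered
  finite type, so an enumeration of it is chosen; on smooth functions, to which \<open>mderiv\<close> is
  applied, partial derivatives commute and the choice is immaterial.\<close>

definition coords :: "'d::finite list" where
  "coords = (SOME is. distinct is \<and> set is = UNIV)"

definition mderiv :: "nat^'d \<Rightarrow> (real^'d::finite \<Rightarrow> real) \<Rightarrow> real^'d \<Rightarrow> real" where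
  "mderiv \<alpha> f = foldr (\<lambda>i. partial i ^^ (\<alpha> $ i)) coords f"

definition mdeg :: "nat^'d::finite \<Rightarrow> nat" where
  "mdeg \<alpha> = (\<Sum>i\<in>UNIV. \<alpha> $ i)"

definition supp :: "('a::topological_space \<Rightarrow> real) \<Rightarrow> 'a set" where
  "supp f = closure {x. f x \<noteq> 0}"

definition conv :: "(real^'d::finite \<Rightarrow> real) \<Rightarrow> (real^'d \<Rightarrow> real) \<Rightarrow> real^'d \<Rightarrow> real" where
  "conv f g x = (LINT y|lebesgue. f (x - y) * g y)"

definition rescale :: "(real^'d::finite \<Rightarrow> real) \<Rightarrow> nat \<Rightarrow> real^'d \<Rightarrow> real" where
  "rescale \<eta> n x = real n ^ CARD('d) * \<eta> (real n *\<^sub>R x)"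

definition translate :: "'a::plus \<Rightarrow> ('a \<Rightarrow> real) \<Rightarrow> 'a \<Rightarrow> real" where
  "translate x f y = f (x + y)"

definition loc_integrable :: "(real^'d::finite \<Rightarrow> real) \<Rightarrow> bool" where
  "loc_integrable g \<longleftrightarrow> (\<forall>K. compact K \<longrightarrow> set_integrable lebesgue K g)"

text \<open>Distributions are viewed as functionals; only their values on test functions matter.\<close>

definition test_functions :: "(real^'d::finite \<Rightarrow> real) set" where
  "test_functions = {\<phi>. smooth \<phi> \<and> compact (supp \<phi>)}"

definition regular_dist :: "(real^'d::finite \<Rightarrow> real) \<Rightarrow> (real^'d \<Rightarrow> real) \<Rightarrow> real" where
  "regular_dist f \<phi> = (LINT x|lebesgue. f x * \<phi> x)"

definition dist_deriv ::
  "nat^'d \<Rightarrow> ((real^'d::finite \<Rightarrow> real) \<Rightarrow> real) \<Rightarrow> (real^'d \<Rightarrow> real) \<Rightarrow> real" where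
  "dist_deriv \<alpha> T \<phi> = (-1) ^ mdeg \<alpha> * T (mderiv \<alpha> \<phi>)"

definition represents :: "(real^'d::finite \<Rightarrow> real) \<Rightarrow> ((real^'d \<Rightarrow> real) \<Rightarrow> real) \<Rightarrow> bool" where
  "represents h T \<longleftrightarrow> loc_integrable h \<and> (\<forall>\<phi>\<in>test_functions. T \<phi> = regular_dist h \<phi>)"

definition is_regular :: "((real^'d::finite \<Rightarrow> real) \<Rightarrow> real) \<Rightarrow> bool" where
  "is_regular T \<longleftrightarrow> (\<exists>h. represents h T)"


section \<open>Convex functions on \<open>\<real>\<^sup>I\<close>, and limits of averages\<close>

text \<open>\<open>\<real>\<^sup>I\<close> for a set \<open>I\<close> is \<open>I \<rightarrow>\<^sub>E UNIV\<close>; function types carry no vector space structure in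
  the library, so convexity is spelled out.\<close>

definition convex_on_power :: "'i set \<Rightarrow> (('i \<Rightarrow> real) \<Rightarrow> real) \<Rightarrow> bool" where
  "convex_on_power I H \<longleftrightarrow>
     (\<forall>u \<in> I \<rightarrow>\<^sub>E UNIV. \<forall>v \<in> I \<rightarrow>\<^sub>E UNIV. \<forall>c\<in>{0..1}.
        H (\<lambda>i\<in>I. c * u i + (1 - c) * v i) \<le> c * H u + (1 - c) * H v)"

definition ball_avg :: "(real^'d::finite \<Rightarrow> real) \<Rightarrow> real^'d \<Rightarrow> real \<Rightarrow> real" where
  "ball_avg g x r = (LINT y:cball x r|lebesgue. g y) / measure lebesgue (cball x r)"

definition X_avg :: "(real^'d::finite \<Rightarrow> real) \<Rightarrow> (real^'d) set" where
  "X_avg g = {x. \<exists>l. (ball_avg g x \<longlongrightarrow> l) (at_right 0)}"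

definition avg_lim :: "(real^'d::finite \<Rightarrow> real) \<Rightarrow> real^'d \<Rightarrow> real" where
  "avg_lim g x = Lim (at_right 0) (ball_avg g x)"

definition avg_usc :: "(real^'d::finite \<Rightarrow> real) \<Rightarrow> real^'d \<Rightarrow> ereal" where
  "avg_usc g x = (INF \<delta>\<in>{0<..}. SUP y\<in>X_avg g \<inter> cball x \<delta>. ereal (avg_lim g y))"

end

theory Submission
  imports Defs
begin

text \<open>Write \<open>f\<^sub>n = f * \<eta>\<^sub>n\<close>, let \<open>A\<close> be the generator and \<open>g'\<close> the upper semicontinuous
function \<open>avg_usc g\<close>. The difference quotients \<open>(S(h)f - f)/h\<close> are compared with those of the
mollifications, for which the generator is known, by two convexity inequalities:

 \<^item> Jensen's inequality for \<open>H\<close>: since mollification commutes with weak derivatives,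
   \<open>A f\<^sub>n = H((D\<^sup>\<alpha> f) * \<eta>\<^sub>n) \<le> g * \<eta>\<^sub>n\<close> (lemma \<open>Hn_le_conv\<close>);
 \<^item> Jensen's inequality for \<open>S(t)\<close>: since the semigroup almost commutes with small translations,
   \<open>S(t)f\<^sub>n - f\<^sub>n \<le> (S(t)f - f) * \<eta>\<^sub>n + \<epsilon> t / \<kappa>\<close> for large \<open>n\<close> and small \<open>t\<close>
   (lemma \<open>fn_increment_le_conv\<close>).

Lower bound (lemma \<open>avg_usc_le_of_increment\<close>): suppose that the quotients of \<open>f\<close> are at most \<open>c\<close>
on a ball along some null sequence of times. By the second inequality the quotients of \<open>f\<^sub>n\<close> are at
most \<open>c + \<epsilon>/\<kappa>\<close> on a smaller ball, hence so is \<open>A f\<^sub>n\<close>. At common Lebesgue points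
\<open>D\<^sup>\<alpha> f\<^sub>n \<rightarrow> D\<^sup>\<alpha> f\<close>, and \<open>H\<close> is lower semicontinuous, so \<open>g \<le> c\<close> almost everywhere near the centre
and \<open>g' \<le> c\<close> there. Applied to subsequences, this says that near every point the quotients
eventually exceed every number below \<open>g'\<close>, which yields the recovery sequences.

Upper bound (lemma \<open>increment_upper_bound\<close>): let \<open>K > g'(x)\<close>. By Lebesgue's differentiation theorem
there is \<open>c < K\<close> with \<open>g \<le> c\<close> almost everywhere near \<open>x\<close>, so \<open>A f\<^sub>n \<le> c\<close> near \<open>x\<close> for large \<open>n\<close> by the
first inequality, while the second one gives \<open>S(h)f\<^sub>n - f\<^sub>n \<le> h C/\<kappa>\<close> everywhere. Hence a single
\<open>v\<close> in \<open>C_space \<kappa>\<close> with \<open>v(x) < K\<close> satisfies \<open>S(h)f\<^sub>n \<le> f\<^sub>n + h v\<close> for large \<open>n\<close> and all \<open>h\<close> below a bound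
that may depend on \<open>n\<close>. Convexity of \<open>S(s)\<close> turns this into
\<open>S(s+h)f\<^sub>n - S(s)f\<^sub>n \<le> h (S(s)(f\<^sub>n + v) - S(s)f\<^sub>n)\<close>. By the semicontinuity of the semigroup at time
zero the bracket is at most \<open>K\<close> near \<open>x\<close> for small \<open>s\<close>, uniformly in \<open>n\<close>. Summing over small steps and
letting \<open>n\<close> tend to infinity gives \<open>S(t)f - f \<le> t K\<close> near \<open>x\<close> for small \<open>t\<close>.\<close>

section \<open>Lebesgue points of locally integrable functions\<close>

lemma tail_integral_small:
  fixes \<phi> :: "'a \<Rightarrow> real"
  assumes int: "integrable M \<phi>" and "0 < e"
  obtains N :: nat where "(LINT x|M. max (\<phi> x - real N) 0) < e"
proof -
  have "(\<lambda>N. LINT x|M. max (\<phi> x - real N) 0) \<longlonglongrightarrow> (LINT x|M. 0)"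
  proof (rule integral_dominated_convergence[where w="\<lambda>x. \<bar>\<phi> x\<bar>"])
    show "AE x in M. (\<lambda>i. max (\<phi> x - real i) 0) \<longlonglongrightarrow> 0"
    proof (rule AE_I2)
      fix x
      obtain N where "\<phi> x \<le> real N" using real_arch_simple by blast
      then have "\<forall>\<^sub>F i in sequentially. max (\<phi> x - real i) 0 = 0"
        by (intro eventually_sequentiallyI[of N]) auto
      then show "(\<lambda>i. max (\<phi> x - real i) 0) \<longlonglongrightarrow> 0" by (simp add: tendsto_eventually)
    qed
  qed (use int in \<open>auto intro!: AE_I2\<close>)
  then have "\<forall>\<^sub>F N in sequentially. (LINT x|M. max (\<phi> x - real N) 0) < e"
    using \<open>0 < e\<close> by (auto intro: order_tendstoD)
  then obtain N where "(LINT x|M. max (\<phi> x - real N) 0) < e"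
    using eventually_happens'[OF sequentially_bot] by blast
  then show ?thesis by (rule that)
qed

text \<open>Absolute continuity of the integral: up to an arbitrarily small tail the integrand is bounded.\<close>

lemma set_integral_small:
  fixes \<phi> :: "'a \<Rightarrow> real"
  assumes int: "integrable M \<phi>" and "0 < e"
  obtains \<delta> where "0 < \<delta>"
    "\<And>A. A \<in> fmeasurable M \<Longrightarrow> measure M A < \<delta> \<Longrightarrow> (LINT x:A|M. \<phi> x) < e"
proof -
  have e2: "0 < e/2" using \<open>0 < e\<close> by simp
  from tail_integral_small[OF int e2]
  obtain N :: nat where N: "(LINT x|M. max (\<phi> x - real N) 0) < e / 2" by blast
  show thesis
  proof (rule that[of "e / (2 * (real N + 1))"])
    show "0 < e / (2 * (real N + 1))" using \<open>0 < e\<close> by simp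
    fix A assume A: "A \<in> fmeasurable M" "measure M A < e / (2 * (real N + 1))"
    have [measurable]: "A \<in> sets M" using A by auto
    have tail: "integrable M (\<lambda>x. max (\<phi> x - real N) 0)"
    proof (rule Bochner_Integration.integrable_bound[OF integrable_abs[OF int]])
      show "(\<lambda>x. max (\<phi> x - real N) 0) \<in> borel_measurable M" using int by measurable
    qed (auto intro!: AE_I2)
    have "(LINT x:A|M. \<phi> x) \<le> (LINT x|M. indicat_real A x * real N + max (\<phi> x - real N) 0)"
      unfolding set_lebesgue_integral_def
    proof (rule integral_mono)
      show "integrable M (\<lambda>x. indicat_real A x *\<^sub>R \<phi> x)"
        using int by (intro integrable_mult_indicator) auto
      show "integrable M (\<lambda>x. indicat_real A x * real N + max (\<phi> x - real N) 0)"
        using A tail by (intro Bochner_Integration.integrable_add integrable_mult_left) (simp_all add: fmeasurable_def)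
    qed (auto simp: indicator_def)
    also have "\<dots> = measure M A * real N + (LINT x|M. max (\<phi> x - real N) 0)"
    proof (subst Bochner_Integration.integral_add)
      show "integrable M (\<lambda>x. indicat_real A x * real N)"
        using A by (intro integrable_mult_left) (simp_all add: fmeasurable_def)
      show "(LINT x|M. indicat_real A x * real N) + (LINT x|M. max (\<phi> x - real N) 0)
          = measure M A * real N + (LINT x|M. max (\<phi> x - real N) 0)"
        using A by (simp add: fmeasurable_def)
    qed (rule tail)
    also have "\<dots> < e / 2 + e / 2"
    proof -
      have "measure M A * (real N + 1) < e / 2" 
        using A(2) by (simp only: pos_less_divide_eq) (simp add: field_simps)
      moreover have "measure M A * real N \<le> measure M A * (real N + 1)"
        by (intro mult_left_mono) auto
      ultimately show ?thesis using N by linarith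
    qed
    finally show "(LINT x:A|M. \<phi> x) < e" by simp
  qed
qed

text \<open>The points of \<open>E\<close> at which arbitrarily small balls carry a large average of \<open>\<phi>\<close> can be
covered, up to a null set, by disjoint such balls inside an open \<open>U \<supseteq> E\<close>. The total measure of these
balls is at most \<open>1/\<epsilon>\<close> times the integral of \<open>\<phi>\<close> over \<open>U\<close>, and since \<open>\<phi>\<close> vanishes on \<open>E\<close> only
\<open>U - E\<close> contributes, which can be made small.\<close>

lemma negligible_large_averages:
  fixes \<phi> :: "'a::euclidean_space \<Rightarrow> real"
  assumes int: "integrable lebesgue \<phi>" and nonneg: "\<And>x. 0 \<le> \<phi> x"
    and E: "E \<in> lmeasurable" and zero: "\<And>x. x \<in> E \<Longrightarrow> \<phi> x = 0" and "0 < \<epsilon>"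
  shows "negligible {x \<in> E. \<forall>d>0. \<exists>r. 0 < r \<and> r < d \<and>
           \<epsilon> * measure lebesgue (cball x r) < (LINT y:cball x r|lebesgue. \<phi> y)}"
    (is "negligible ?B")
  unfolding negligible_outer_le
proof (intro allI impI)
  fix e :: real assume "0 < e"
  have setint: "set_integrable lebesgue A \<phi>" if "A \<in> sets lebesgue" for A
    unfolding set_integrable_def using int that by (intro integrable_mult_indicator) auto
  obtain \<delta> where "0 < \<delta>" and \<delta>:
    "\<And>A. A \<in> lmeasurable \<Longrightarrow> measure lebesgue A < \<delta> \<Longrightarrow> (LINT x:A|lebesgue. \<phi> x) < \<epsilon> * e"
    using set_integral_small[OF int, of "\<epsilon> * e"] \<open>0 < \<epsilon>\<close> \<open>0 < e\<close> by auto
  obtain U where U: "open U" "E \<subseteq> U" "U - E \<in> lmeasurable" "emeasure lebesgue (U - E) < \<delta>"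
    by (rule sets_lebesgue_outer_open[OF fmeasurableD[OF E] \<open>0 < \<delta>\<close>]) (rule that)
  have UE: "(LINT x:U - E|lebesgue. \<phi> x) < \<epsilon> * e"
  proof (rule \<delta>[OF U(3)])
    show "measure lebesgue (U - E) < \<delta>"
      by (rule iffD1[OF ennreal_less_iff[OF measure_nonneg]], unfold emeasure_eq_measure2[OF U(3), symmetric])
        (rule U(4))
  qed
  define K where "K = {(x, r). x \<in> ?B \<and> 0 < r \<and> cball x r \<subseteq> U \<and>
           \<epsilon> * measure lebesgue (cball x r) < (LINT y:cball x r|lebesgue. \<phi> y)}"
  obtain C where C: "countable C" "C \<subseteq> K"
     "pairwise (\<lambda>i j. disjnt (cball (fst i) (snd i)) (cball (fst j) (snd j))) C"
     "negligible (?B - (\<Union>i \<in> C. cball (fst i) (snd i)))"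
  proof (rule Vitali_covering_theorem_cballs[of K snd ?B fst])
    show "0 < snd i" if "i \<in> K" for i using that by (auto simp: K_def)
    fix x and d :: real assume x: "x \<in> ?B" and "0 < d"
    then have "x \<in> U" using U by auto
    then obtain d' where "0 < d'" "cball x d' \<subseteq> U" using \<open>open U\<close> open_contains_cball by blast
    have "0 < min d d'" using \<open>0 < d\<close> \<open>0 < d'\<close> by simp
    then obtain r where "0 < r" "r < min d d'"
      "\<epsilon> * measure lebesgue (cball x r) < (LINT y:cball x r|lebesgue. \<phi> y)" using x by blast
    moreover have "cball x r \<subseteq> U" using \<open>cball x d' \<subseteq> U\<close> \<open>r < min d d'\<close> by (auto simp: subset_iff)
    ultimately have "(x, r) \<in> K" using x by (auto simp: K_def)
    then show "\<exists>i. i \<in> K \<and> x \<in> cball (fst i) (snd i) \<and> snd i < d"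
      using \<open>0 < r\<close> \<open>r < min d d'\<close> by (intro exI[of _ "(x, r)"]) auto
  qed blast
  let ?T = "\<Union>i \<in> C. cball (fst i) (snd i)"
  have bound: "measure lebesgue (\<Union>i \<in> D. cball (fst i) (snd i)) \<le> e" if D: "D \<subseteq> C" "finite D" for D
  proof -
    let ?V = "\<Union>i \<in> D. cball (fst i) (snd i)"
    have V: "?V \<in> sets lebesgue" using D(2) by (intro sets.finite_UN) auto
    have disj: "disjoint_family_on (\<lambda>i. cball (fst i) (snd i)) D"
      unfolding disjoint_family_on_def using C(3) D(1)
      by (meson disjnt_def pairwiseD subsetD)
    have "\<epsilon> * measure lebesgue ?V = (\<Sum>i\<in>D. \<epsilon> * measure lebesgue (cball (fst i) (snd i)))"
      using D(2) disj fmeasurableD2[OF lmeasurable_cball]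
      by (subst measure_finite_Union) (simp_all add: sum_distrib_left image_subset_iff)
    also have "\<dots> \<le> (\<Sum>i\<in>D. LINT y:cball (fst i) (snd i)|lebesgue. \<phi> y)"
      using D(1) C(2) by (intro sum_mono) (auto simp: K_def intro: less_imp_le)
    also have "\<dots> = (LINT y:?V|lebesgue. \<phi> y)"
      using disj D by (subst set_integral_finite_Union) (simp_all add: setint)
    also have "\<dots> \<le> (LINT y:U - E|lebesgue. \<phi> y)"
      unfolding set_lebesgue_integral_def
    proof (rule integral_mono)
      show "integrable lebesgue (\<lambda>x. indicat_real ?V x *\<^sub>R \<phi> x)"
        using setint[OF V] unfolding set_integrable_def .
      show "integrable lebesgue (\<lambda>x. indicat_real (U - E) x *\<^sub>R \<phi> x)"
        using setint[of "U - E"] U(3) by (simp add: set_integrable_def fmeasurableD)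
      have "cball (fst i) (snd i) \<subseteq> U" if "i \<in> D" for i
        using that subsetD[OF D(1)] subsetD[OF C(2)] unfolding K_def by fastforce
      then have "?V \<subseteq> U" by blast
      moreover have "indicat_real V x *\<^sub>R \<phi> x \<le> indicat_real (U - E) x *\<^sub>R \<phi> x" if "V \<subseteq> U" for V x
        using zero nonneg that by (auto simp: indicator_def split: if_splits)
      ultimately show "indicat_real ?V x *\<^sub>R \<phi> x \<le> indicat_real (U - E) x *\<^sub>R \<phi> x" for x
        by blast
    qed
    also have "\<dots> < \<epsilon> * e" by (rule UE)
    finally show ?thesis using \<open>0 < \<epsilon>\<close> by simp
  qed
  have T: "?T \<in> lmeasurable" "measure lebesgue ?T \<le> e"
    using \<open>0 < e\<close> bound
    by (auto intro!: fmeasurable_UN_bound[OF C(1)] measure_UN_bound[OF C(1)])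
  show "\<exists>T. ?B \<subseteq> T \<and> T \<in> lmeasurable \<and> measure lebesgue T \<le> e"
  proof (intro exI conjI)
    show "?B \<subseteq> ?T \<union> (?B - ?T)" by auto
    show "?T \<union> (?B - ?T) \<in> lmeasurable"
      using T C(4) by (simp only: fmeasurable.Un negligible_imp_measurable)
    have "measure lebesgue (?T \<union> (?B - ?T)) = measure lebesgue ?T"
      by (rule measure_negligible_symdiff[OF T(1)]) (rule negligible_subset[OF C(4)], auto)
    then show "measure lebesgue (?T \<union> (?B - ?T)) \<le> e" using T by simp
  qed
qed

lemma loc_integrable_measurable:
  assumes "loc_integrable g"
  shows "g \<in> borel_measurable lebesgue"
proof (rule borel_measurable_LIMSEQ_real)
  show "(\<lambda>n. indicat_real (cball 0 (real n)) x * g x) \<longlonglongrightarrow> g x" for x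
  proof -
    obtain N where N: "norm x \<le> real N" using real_arch_simple by blast
    have "\<forall>\<^sub>F n in sequentially. indicat_real (cball 0 (real n)) x * g x = g x"
      using N by (intro eventually_sequentiallyI[of N]) (auto simp: indicator_def)
    then show ?thesis by (rule tendsto_eventually)
  qed
  show "(\<lambda>x. indicat_real (cball 0 (real n)) x * g x) \<in> borel_measurable lebesgue" for n
    using assms compact_cball[of 0 "real n"]
      borel_measurable_integrable[of lebesgue "\<lambda>x. indicat_real (cball 0 (real n)) x *\<^sub>R g x"]
    unfolding loc_integrable_def set_integrable_def by auto
qed

lemma loc_integrable_add:
  "loc_integrable f \<Longrightarrow> loc_integrable g \<Longrightarrow> loc_integrable (\<lambda>x. f x + g x)"
  unfolding loc_integrable_def by (auto intro: set_integral_add)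

lemma loc_integrable_const: "loc_integrable (\<lambda>x. c)"
  unfolding loc_integrable_def set_integrable_def
proof (intro allI impI)
  fix K :: "(real^'d) set" assume "compact K"
  then have "K \<in> lmeasurable" by (rule lmeasurable_compact)
  then show "integrable lebesgue (\<lambda>x. indicat_real K x *\<^sub>R c)"
    by (auto simp: fmeasurable_def)
qed

lemma loc_integrable_bound:
  fixes f g :: "real^'d::finite \<Rightarrow> real"
  assumes g: "loc_integrable g" and f: "f \<in> borel_measurable lebesgue" and "\<And>x. \<bar>f x\<bar> \<le> \<bar>g x\<bar>"
  shows "loc_integrable f"
  unfolding loc_integrable_def
proof (intro allI impI)
  fix K :: "(real^'d) set" assume K: "compact K"
  have [measurable]: "K \<in> sets lebesgue" using K by (simp add: lmeasurable_compact fmeasurableD)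
  show "set_integrable lebesgue K f"
  proof (rule set_integrable_bound[of lebesgue K g])
    show "set_integrable lebesgue K g" using g K by (simp add: loc_integrable_def)
    show "set_borel_measurable lebesgue K f"
      unfolding set_borel_measurable_def using f by measurable
  qed (use assms(3) in auto)
qed

lemma loc_integrable_abs: "loc_integrable g \<Longrightarrow> loc_integrable (\<lambda>x. \<bar>g x\<bar>)"
  by (rule loc_integrable_bound[of g]) (auto dest: loc_integrable_measurable)

lemma loc_integrable_uminus: "loc_integrable g \<Longrightarrow> loc_integrable (\<lambda>x. - g x)"
  by (rule loc_integrable_bound[of g]) (auto dest: loc_integrable_measurable)

lemma loc_integrable_continuous:
  "continuous_on UNIV f \<Longrightarrow> loc_integrable f"
  unfolding loc_integrable_def set_integrable_def
  using borel_integrable_compact 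
  by (metis (full_types) continuous_on_subset integrable_completion measurable_completion subset_UNIV borel_measurable_integrable)

lemma loc_integrable_pos_part:
  assumes "loc_integrable g" shows "loc_integrable (\<lambda>x. max (g x - a) 0)"
proof (rule loc_integrable_bound[of "\<lambda>x. \<bar>g x\<bar> + \<bar>a\<bar>"])
  have [measurable]: "g \<in> borel_measurable lebesgue" by (rule loc_integrable_measurable[OF assms])
  show "(\<lambda>x. max (g x - a) 0) \<in> borel_measurable lebesgue" by measurable
qed (auto intro!: loc_integrable_add loc_integrable_abs loc_integrable_const assms)

lemma loc_integrable_cball:
  "loc_integrable g \<Longrightarrow> set_integrable lebesgue (cball x r) g"
  by (simp add: loc_integrable_def)

lemma ball_avg_mono:
  assumes "loc_integrable f" "loc_integrable g" and le: "\<And>y. y \<in> cball x r \<Longrightarrow> f y \<le> g y"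
  shows "ball_avg f x r \<le> ball_avg g x r"
  unfolding ball_avg_def
  by (intro divide_right_mono set_integral_mono loc_integrable_cball assms) auto

lemma ball_avg_mono_AE:
  assumes "loc_integrable f" "loc_integrable g" 
    and le: "AE y in lebesgue. y \<in> cball x r \<longrightarrow> f y \<le> g y"
  shows "ball_avg f x r \<le> ball_avg g x r"
  unfolding ball_avg_def
  by (intro divide_right_mono set_integral_mono_AE loc_integrable_cball assms) 
    (use le in auto)

lemma ball_avg_add:
  assumes "loc_integrable f" "loc_integrable g"
  shows "ball_avg (\<lambda>y. f y + g y) x r = ball_avg f x r + ball_avg g x r"
  unfolding ball_avg_def
  using assms by (simp add: set_integral_add loc_integrable_cball add_divide_distrib)

lemma ball_avg_const: "0 < r \<Longrightarrow> ball_avg (\<lambda>y. c) x r = c"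
  unfolding ball_avg_def set_lebesgue_integral_def
  using content_cball_pos[of r x] by simp

lemma ball_avg_nonneg: "(\<And>y. 0 \<le> g y) \<Longrightarrow> 0 \<le> ball_avg g x r"
  unfolding ball_avg_def set_lebesgue_integral_def
  by (intro divide_nonneg_nonneg integral_nonneg_AE) auto

text \<open>Localisation of the previous lemma: on bounded sets \<open>max (g - a) 0\<close> may be cut off to an
integrable function, and it vanishes where \<open>g \<le> a\<close>.\<close>

lemma negligible_avg_pos_part:
  fixes g :: "real^'d::finite \<Rightarrow> real"
  assumes g: "loc_integrable g" and "0 < \<epsilon>"
  shows "negligible {x. g x \<le> a \<and> (\<forall>d>0. \<exists>r. 0 < r \<and> r < d \<and> \<epsilon> < ball_avg (\<lambda>y. max (g y - a) 0) x r)}"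
    (is "negligible ?B")
proof -
  have [measurable]: "g \<in> borel_measurable lebesgue" by (rule loc_integrable_measurable[OF g])
  define \<psi> where "\<psi> = (\<lambda>y. max (g y - a) 0)"
  have \<psi>: "loc_integrable \<psi>" unfolding \<psi>_def by (rule loc_integrable_pos_part[OF g])
  have "negligible (?B \<inter> cball 0 (real n))" for n
  proof -
    define \<phi> where "\<phi> = (\<lambda>y. indicat_real (cball 0 (real n + 1)) y * \<psi> y)"
    define E where "E = {y. g y \<le> a} \<inter> cball 0 (real n)"
    have "{y \<in> space lebesgue. g y \<le> a} \<in> sets lebesgue" by measurable
    then have E: "E \<in> lmeasurable"
      unfolding E_def by (simp add: Int_commute[of "{y. g y \<le> a}"] fmeasurable_Int_fmeasurable)
    have avg: "ball_avg \<psi> x r * measure lebesgue (cball x r) = (LINT y:cball x r|lebesgue. \<phi> y)"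
      if "x \<in> cball 0 (real n)" "0 < r" "r < 1" for x r
    proof -
      have "cball x r \<subseteq> cball 0 (real n + 1)"
        using that by (intro cball_subset_cball_iff[THEN iffD2]) (auto simp: dist_norm)
      then have "(LINT y:cball x r|lebesgue. \<phi> y) = (LINT y:cball x r|lebesgue. \<psi> y)"
        by (intro set_lebesgue_integral_cong) (auto simp: \<phi>_def indicator_def)
      then show ?thesis unfolding ball_avg_def using content_cball_pos[OF \<open>0 < r\<close>, of x] by simp
    qed
    have "negligible {x \<in> E. \<forall>d>0. \<exists>r. 0 < r \<and> r < d \<and>
           \<epsilon> * measure lebesgue (cball x r) < (LINT y:cball x r|lebesgue. \<phi> y)}"
    proof (rule negligible_large_averages[OF _ _ E _ \<open>0 < \<epsilon>\<close>])
      show "integrable lebesgue \<phi>"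
        using loc_integrable_cball[OF \<psi>, of 0 "real n + 1"] by (simp add: set_integrable_def \<phi>_def)
    qed (auto simp: \<phi>_def \<psi>_def E_def indicator_def)
    then show ?thesis
    proof (rule negligible_subset, intro subsetI)
      fix x assume x: "x \<in> ?B \<inter> cball 0 (real n)"
      show "x \<in> {x \<in> E. \<forall>d>0. \<exists>r. 0 < r \<and> r < d \<and>
           \<epsilon> * measure lebesgue (cball x r) < (LINT y:cball x r|lebesgue. \<phi> y)}"
      proof (intro CollectI conjI allI impI)
        show "x \<in> E" using x by (auto simp: E_def)
        fix d :: real assume "0 < d"
        then have "0 < min d 1" by simp
        then obtain r where r: "0 < r" "r < min d 1" "\<epsilon> < ball_avg \<psi> x r"
          using x unfolding \<psi>_def by blast
        then have lt: "\<epsilon> * measure lebesgue (cball x r) < ball_avg \<psi> x r * measure lebesgue (cball x r)"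
          using content_cball_pos[of r x] by simp
        then show "\<exists>r. 0 < r \<and> r < d \<and> \<epsilon> * measure lebesgue (cball x r) < (LINT y:cball x r|lebesgue. \<phi> y)"
          using lt r(1,2) avg[of x r] IntD2[OF x] by (intro exI[of _ r]) (simp only: min_less_iff_conj simp_thms)
      qed
    qed
  qed
  then have "negligible (\<Union>n. ?B \<inter> cball 0 (real n))" by (intro negligible_countable_Union) auto
  then show ?thesis
  proof (rule negligible_subset, intro subsetI)
    fix x assume "x \<in> ?B"
    moreover obtain n where "norm x \<le> real n" using real_arch_simple by blast
    ultimately show "x \<in> (\<Union>n. ?B \<inter> cball 0 (real n))" by auto
  qed
qed

lemma AE_avg_pos_part:
  fixes g :: "real^'d::finite \<Rightarrow> real"
  assumes g: "loc_integrable g"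
  shows "AE x in lebesgue. \<forall>a\<in>\<rat>. g x \<le> a \<longrightarrow> (ball_avg (\<lambda>y. max (g y - a) 0) x \<longlongrightarrow> 0) (at_right 0)"
proof -
  define B where "B = (\<lambda>a k. {x. g x \<le> a \<and> (\<forall>d>0. \<exists>r. 0 < r \<and> r < d \<and> 
     1 / real (Suc k) < ball_avg (\<lambda>y. max (g y - a) 0) x r)})"
  have "AE x in lebesgue. x \<notin> B a k" for a k
    using negligible_avg_pos_part[OF g, of "1 / real (Suc k)" a]
    unfolding B_def negligible_iff_null_sets by (intro AE_not_in) simp
  then have "AE x in lebesgue. \<forall>k. x \<notin> B a k" for a
    by (simp add: AE_all_countable)
  then have "AE x in lebesgue. \<forall>a\<in>\<rat>. \<forall>k. x \<notin> B a k"
    by (intro AE_ball_countable[THEN iffD2] countable_rat) auto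
  then show ?thesis
  proof (rule AE_mp, intro AE_I2 impI ballI)
    fix x a assume B: "\<forall>a\<in>\<rat>. \<forall>k. x \<notin> B a k" and a: "a \<in> \<rat>" "g x \<le> a"
    show "(ball_avg (\<lambda>y. max (g y - a) 0) x \<longlongrightarrow> 0) (at_right 0)"
    proof (rule tendstoI)
      fix e :: real assume "0 < e"
      then obtain k where k: "1 / real (Suc k) < e" using nat_approx_posE by blast
      obtain d where d: "0 < d" "\<And>r. 0 < r \<Longrightarrow> r < d \<Longrightarrow> ball_avg (\<lambda>y. max (g y - a) 0) x r \<le> 1 / real (Suc k)"
        using B a unfolding B_def by (simp add: not_less) (metis linorder_not_less)
      show "\<forall>\<^sub>F r in at_right 0. dist (ball_avg (\<lambda>y. max (g y - a) 0) x r) 0 < e"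
        unfolding eventually_at_right_field
      proof (intro exI[of _ d] conjI allI impI)
        fix r :: real assume "0 < r" "r < d"
        then show "dist (ball_avg (\<lambda>y. max (g y - a) 0) x r) 0 < e"
          using d(2)[of r] k ball_avg_nonneg[of "\<lambda>y. max (g y - a) 0" x r] by (simp add: dist_real_def)
      qed (use d in auto)
    qed
  qed
qed

text \<open>Lebesgue's differentiation theorem in its strong form. For rational \<open>a\<close> and \<open>b\<close> just
above \<open>g x\<close> and \<open>- g x\<close>, the deviation \<open>\<bar>g y - g x\<bar>\<close> is at most \<open>max (g y - a) 0 + max (- g y - b) 0\<close>
plus a small constant, and the averages of both positive parts tend to zero.\<close>

theorem AE_Lebesgue_point:
  fixes g :: "real^'d::finite \<Rightarrow> real"
  assumes g: "loc_integrable g"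
  shows "AE x in lebesgue. (ball_avg (\<lambda>y. \<bar>g y - g x\<bar>) x \<longlongrightarrow> 0) (at_right 0)"
  using AE_avg_pos_part[OF g] AE_avg_pos_part[OF loc_integrable_uminus[OF g]]
proof eventually_elim
  case (elim x)
  show ?case
  proof (rule tendstoI)
    fix e :: real assume "0 < e"
    obtain a where a: "a \<in> \<rat>" "g x < a" "a < g x + e/4" using Rats_dense_in_real[of "g x" "g x + e/4"] \<open>0 < e\<close> by auto
    obtain b where b: "b \<in> \<rat>" "- g x < b" "b < - g x + e/4" using Rats_dense_in_real[of "- g x" "- g x + e/4"] \<open>0 < e\<close> by auto
    define A where "A = (\<lambda>y. max (g y - a) 0)"
    define B where "B = (\<lambda>y. max (- g y - b) 0)"
    have A: "(ball_avg A x \<longlongrightarrow> 0) (at_right 0)" and B: "(ball_avg B x \<longlongrightarrow> 0) (at_right 0)"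
      using elim a b unfolding A_def B_def by auto
    have int: "loc_integrable A" "loc_integrable B"
      unfolding A_def B_def using loc_integrable_pos_part[OF g] loc_integrable_pos_part[OF loc_integrable_uminus[OF g]] by auto
    have "\<forall>\<^sub>F r in at_right 0. ball_avg A x r < e/4" "\<forall>\<^sub>F r in at_right 0. ball_avg B x r < e/4"
      using order_tendstoD(2)[OF A, of "e/4"] order_tendstoD(2)[OF B, of "e/4"] \<open>0 < e\<close> by simp_all
    moreover have "\<forall>\<^sub>F r in at_right 0. (0::real) < r" by (simp add: eventually_at_right_less)
    ultimately show "\<forall>\<^sub>F r in at_right 0. dist (ball_avg (\<lambda>y. \<bar>g y - g x\<bar>) x r) 0 < e"
    proof eventually_elim
      case (elim r)
      have "ball_avg (\<lambda>y. \<bar>g y - g x\<bar>) x r \<le> ball_avg (\<lambda>y. A y + (B y + e/2)) x r"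
      proof (rule ball_avg_mono)
        show "loc_integrable (\<lambda>y. \<bar>g y - g x\<bar>)"
          using loc_integrable_abs[OF loc_integrable_add[OF g loc_integrable_const[of "- g x"]]] by simp
        show "loc_integrable (\<lambda>y. A y + (B y + e/2))" by (intro loc_integrable_add int loc_integrable_const)
        show "\<bar>g y - g x\<bar> \<le> A y + (B y + e/2)" for y using a b \<open>0 < e\<close> by (auto simp: A_def B_def)
      qed
      also have "\<dots> = ball_avg A x r + (ball_avg B x r + e/2)"
        using elim by (simp add: ball_avg_add int loc_integrable_add loc_integrable_const ball_avg_const)
      finally show ?case using elim ball_avg_nonneg[of "\<lambda>y. \<bar>g y - g x\<bar>" x r] by simp
    qed
  qed
qed

section \<open>Weak derivatives of mollifications\<close>

lemma lebesgue_integral_affine: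
  fixes F :: "'a::euclidean_space \<Rightarrow> real"
  assumes c: "c \<noteq> 0" and F: "F \<in> borel_measurable lebesgue"
  shows "(LINT x|lebesgue. F x) = \<bar>c\<bar> ^ DIM('a) * (LINT x|lebesgue. F (t + c *\<^sub>R x))"
proof -
  have T: "(\<lambda>x. t + (\<Sum>j\<in>Basis. (c * (x \<bullet> j)) *\<^sub>R j)) = (\<lambda>x. t + c *\<^sub>R x)"
    unfolding scaleR_scaleR[symmetric] scaleR_sum_right[symmetric] euclidean_representation ..
  have meas: "(\<lambda>x::'a. t + c *\<^sub>R x) \<in> lebesgue \<rightarrow>\<^sub>M lebesgue"
    using lebesgue_affine_measurable[of "\<lambda>_. c" t] c unfolding T by simp
  have leb: "lebesgue = density (distr lebesgue lebesgue (\<lambda>x::'a. t + c *\<^sub>R x)) (\<lambda>_. ennreal (\<bar>c\<bar> ^ DIM('a)))"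
    using lebesgue_affine_euclidean[of "\<lambda>_. c" t] c unfolding T by (simp add: ennreal_power)
  have "(LINT x|lebesgue. F x) =
      (LINT x|density (distr lebesgue lebesgue (\<lambda>x::'a. t + c *\<^sub>R x)) (\<lambda>_. ennreal (\<bar>c\<bar> ^ DIM('a))). F x)"
    using leb by simp
  also have "\<dots> = \<bar>c\<bar> ^ DIM('a) * (LINT x|lebesgue. F (t + c *\<^sub>R x))"
    using F meas by (subst integral_density) (simp_all add: integral_distr)
  finally show ?thesis .
qed

text \<open>In this form the variable \<open>x\<close> sits in the smooth factor, where it can be differentiated, and
the other factor is integrated against a fixed weight.\<close>

lemma conv_swap:
  assumes "f \<in> borel_measurable lebesgue" "\<phi> \<in> borel_measurable lebesgue"
  shows "conv f \<phi> x = (LINT y|lebesgue. f y * \<phi> (x - y))"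
proof -
  have "(\<lambda>y. \<phi> (x + (-1) *\<^sub>R y)) \<in> borel_measurable lebesgue"
    by (rule borel_measurable_affine[OF assms(2)]) simp
  then have "(\<lambda>y. f y * \<phi> (x - y)) \<in> borel_measurable lebesgue"
    using assms(1) by (intro borel_measurable_times) simp_all
  from lebesgue_integral_affine[OF _ this, of "-1" x]
  show ?thesis unfolding conv_def by simp
qed

lemma differentiable_on_imp_borel_lebesgue:
  fixes \<phi> :: "'a::euclidean_space \<Rightarrow> real"
  shows "\<phi> differentiable_on UNIV \<Longrightarrow> \<phi> \<in> borel_measurable lebesgue"
  by (intro continuous_imp_measurable_on_sets_lebesgue[of UNIV, simplified lebesgue_on_UNIV_eq])
     (auto dest: differentiable_imp_continuous_on)

lemma smooth_differentiable: "smooth \<phi> \<Longrightarrow> \<phi> differentiable_on UNIV"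
  unfolding smooth_def by (metis foldr.simps(1) id_apply)

lemma smooth_continuous: "smooth \<phi> \<Longrightarrow> continuous_on UNIV \<phi>"
  by (intro differentiable_imp_continuous_on smooth_differentiable)

lemma smooth_foldr_partial: "smooth \<phi> \<Longrightarrow> smooth (foldr partial is \<phi>)"
  unfolding smooth_def by (metis foldr_append)

lemma smooth_partial: "smooth \<phi> \<Longrightarrow> smooth (partial i \<phi>)"
  using smooth_foldr_partial[of \<phi> "[i]"] by simp

text \<open>Partial derivatives are defined by \<open>deriv\<close>, which carries no information unless the function
is differentiable along the line; smoothness provides this.\<close>

lemma smooth_has_partial_derivative:
  fixes \<phi> :: "real^'d::finite \<Rightarrow> real"
  assumes "smooth \<phi>"
  shows "((\<lambda>t. \<phi> (x + t *\<^sub>R axis i 1)) has_real_derivative partial i \<phi> (x + s *\<^sub>R axis i 1)) (at s)"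
proof -
  have at_0: "((\<lambda>t. \<phi> (z + t *\<^sub>R axis i 1)) has_real_derivative partial i \<phi> z) (at 0)" for z
  proof -
    have "\<phi> differentiable at (z + 0 *\<^sub>R axis i 1)"
      using smooth_differentiable[OF assms] by (simp add: differentiable_on_def)
    moreover have "(\<lambda>t. z + t *\<^sub>R axis i (1::real)) differentiable at 0"
      by (intro derivative_intros differentiableI_vector) (auto intro!: derivative_eq_intros differentiableI)
    ultimately have "(\<phi> \<circ> (\<lambda>t. z + t *\<^sub>R axis i 1)) differentiable at 0"
      by (intro differentiable_chain_at) simp_all
    then have "(\<lambda>t. \<phi> (z + t *\<^sub>R axis i 1)) field_differentiable at 0"
      by (simp add: o_def real_differentiable_def field_differentiable_def)
    then show ?thesis unfolding partial_def by (simp add: DERIV_deriv_iff_field_differentiable)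
  qed
  have "((\<lambda>t. \<phi> (x + (t + s) *\<^sub>R axis i 1)) has_real_derivative partial i \<phi> (x + s *\<^sub>R axis i 1)) (at 0)"
    using at_0[of "x + s *\<^sub>R axis i 1"] by (simp add: algebra_simps)
  then show ?thesis using DERIV_shift[of "\<lambda>t. \<phi> (x + t *\<^sub>R axis i 1)" _ 0 s] by simp
qed

lemma partial_affine:
  fixes \<phi> :: "real^'d::finite \<Rightarrow> real"
  assumes "smooth \<phi>"
  shows "partial i (\<lambda>y. c * \<phi> (x + s *\<^sub>R y)) = (\<lambda>y. c * s * partial i \<phi> (x + s *\<^sub>R y))"
proof
  fix y
  have "((\<lambda>t. \<phi> ((x + s *\<^sub>R y) + t *\<^sub>R axis i 1)) has_real_derivative partial i \<phi> (x + s *\<^sub>R y)) (at (s * 0))"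
    using smooth_has_partial_derivative[OF assms, of "x + s *\<^sub>R y" i 0] by simp
  moreover have "((\<lambda>t. s * t) has_real_derivative s) (at 0)"
    by (auto intro!: derivative_eq_intros)
  ultimately have "((\<lambda>t. \<phi> ((x + s *\<^sub>R y) + (s * t) *\<^sub>R axis i 1)) has_real_derivative partial i \<phi> (x + s *\<^sub>R y) * s) (at 0)"
    by (rule DERIV_chain2)
  then have "((\<lambda>t. c * \<phi> ((x + s *\<^sub>R y) + (s * t) *\<^sub>R axis i 1)) has_real_derivative c * (partial i \<phi> (x + s *\<^sub>R y) * s)) (at 0)"
    by (rule DERIV_cmult)
  then have "((\<lambda>t. c * \<phi> (x + s *\<^sub>R (y + t *\<^sub>R axis i 1))) has_real_derivative c * s * partial i \<phi> (x + s *\<^sub>R y)) (at 0)"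
    by (simp add: algebra_simps)
  then show "partial i (\<lambda>y. c * \<phi> (x + s *\<^sub>R y)) y = c * s * partial i \<phi> (x + s *\<^sub>R y)"
    unfolding partial_def[of i "\<lambda>y. c * \<phi> (x + s *\<^sub>R y)"] by (rule DERIV_imp_deriv)
qed

lemma foldr_partial_affine:
  fixes \<phi> :: "real^'d::finite \<Rightarrow> real"
  assumes "smooth \<phi>"
  shows "foldr partial is (\<lambda>y. c * \<phi> (x + s *\<^sub>R y))
    = (\<lambda>y. c * s ^ length is * foldr partial is \<phi> (x + s *\<^sub>R y))"
proof (induction "is")
  case (Cons i "is")
  then show ?case
    using partial_affine[OF smooth_foldr_partial[OF assms], of i "c * s ^ length is" "is" x s]
    by (simp add: ac_simps)
qed simp

lemma smooth_affine:
  fixes \<phi> :: "real^'d::finite \<Rightarrow> real"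
  assumes "smooth \<phi>"
  shows "smooth (\<lambda>y. c * \<phi> (x + s *\<^sub>R y))"
  unfolding smooth_def foldr_partial_affine[OF assms]
proof
  fix "is" :: "'d list"
  have "foldr partial is \<phi> differentiable_on range (\<lambda>y. x + s *\<^sub>R y)"
    using smooth_differentiable[OF smooth_foldr_partial[OF assms]] by (rule differentiable_on_subset) simp
  moreover have "(\<lambda>y. x + s *\<^sub>R y) differentiable_on UNIV"
    by (simp add: differentiable_on_def)
  ultimately have "(\<lambda>y. foldr partial is \<phi> (x + s *\<^sub>R y)) differentiable_on UNIV"
    by (rule differentiable_on_compose[rotated])
  then show "(\<lambda>y. c * s ^ length is * foldr partial is \<phi> (x + s *\<^sub>R y)) differentiable_on UNIV"
    by (rule differentiable_on_mult[OF differentiable_on_const])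
qed

lemma foldr_partial_reflect:
  fixes \<phi> :: "real^'d::finite \<Rightarrow> real"
  assumes "smooth \<phi>"
  shows "foldr partial is (\<lambda>y. \<phi> (x - y)) = (\<lambda>y. (-1) ^ length is * foldr partial is \<phi> (x - y))"
  using foldr_partial_affine[OF assms, of "is" 1 x "-1"] by simp

lemma smooth_reflect:
  fixes \<phi> :: "real^'d::finite \<Rightarrow> real"
  assumes "smooth \<phi>"
  shows "smooth (\<lambda>y. \<phi> (x - y))"
  using smooth_affine[OF assms, of 1 x "-1"] by simp

text \<open>Reduces multi-indices to lists of coordinates, on which inductions are immediate.\<close>

lemma mderiv_foldr:
  fixes \<alpha> :: "nat^'d::finite"
  obtains "is" where "length is = mdeg \<alpha>" "\<And>f. mderiv \<alpha> f = foldr partial is f"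
proof
  let ?is = "concat (map (\<lambda>i. replicate (\<alpha> $ i) i) coords)"
  have coords: "distinct (coords :: 'd list) \<and> set (coords :: 'd list) = UNIV"
    unfolding coords_def by (rule someI_ex) (use finite_distinct_list[of "UNIV::'d set"] in auto)
  have "length ?is = (\<Sum>i\<leftarrow>coords. \<alpha> $ i)" by (simp add: length_concat o_def)
  also have "\<dots> = mdeg \<alpha>" unfolding mdeg_def using coords by (metis sum.distinct_set_conv_list)
  finally show "length ?is = mdeg \<alpha>" .
  have "foldr partial (replicate n i) h = (partial i ^^ n) h" for n i and h :: "real^'d \<Rightarrow> real"
    by (induction n) auto
  then have "foldr (\<lambda>i. partial i ^^ (\<alpha> $ i)) js f = foldr partial (concat (map (\<lambda>i. replicate (\<alpha> $ i) i) js)) f" for js f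
    by (induction js) auto
  then show "mderiv \<alpha> f = foldr partial ?is f" for f
    unfolding mderiv_def .
qed

lemma supp_partial:
  fixes \<phi> :: "real^'d::finite \<Rightarrow> real"
  shows "supp (partial i \<phi>) \<subseteq> supp \<phi>"
  unfolding supp_def[of "partial i \<phi>"]
proof (rule closure_minimal)
  show "closed (supp \<phi>)" by (simp add: supp_def)
  show "{x. partial i \<phi> x \<noteq> 0} \<subseteq> supp \<phi>"
  proof (rule subsetI, rule ccontr)
    fix x assume x: "x \<in> {x. partial i \<phi> x \<noteq> 0}" "x \<notin> supp \<phi>"
    have zero: "\<phi> z = 0" if "z \<in> - supp \<phi>" for z
      using that closure_subset[of "{x. \<phi> x \<noteq> 0}"] unfolding supp_def by auto
    have "open (- supp \<phi>)" by (simp add: supp_def open_Compl)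
    moreover have "((\<lambda>t. x + t *\<^sub>R axis i 1) \<longlongrightarrow> x + 0 *\<^sub>R axis i 1) (nhds 0)"
      by (intro tendsto_intros filterlim_ident)
    ultimately have "\<forall>\<^sub>F t in nhds 0. x + t *\<^sub>R axis i 1 \<in> - supp \<phi>"
      using x(2) by (auto dest: topological_tendstoD)
    then have "\<forall>\<^sub>F t in nhds 0. \<phi> (x + t *\<^sub>R axis i 1) = 0"
      by (rule eventually_mono) (rule zero)
    then have "partial i \<phi> x = deriv (\<lambda>t::real. 0) 0"
      unfolding partial_def by (intro deriv_cong_ev) simp_all
    then show False using x(1) by simp
  qed
qed

lemma supp_foldr_partial:
  fixes \<phi> :: "real^'d::finite \<Rightarrow> real"
  shows "supp (foldr partial is \<phi>) \<subseteq> supp \<phi>"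
  by (induction "is") (use supp_partial in \<open>auto dest: subsetD\<close>)

lemma zero_outside_supp: "x \<notin> supp \<phi> \<Longrightarrow> \<phi> x = 0"
  using closure_subset[of "{x. \<phi> x \<noteq> 0}"] unfolding supp_def by blast

text \<open>Replaces the Lebesgue integral over the whole space by an integral over a fixed box, to
which the Leibniz rule applies.\<close>

lemma conv_integral_box:
  fixes f \<phi> :: "real^'d::finite \<Rightarrow> real"
  assumes f: "continuous_on UNIV f" and \<phi>: "continuous_on UNIV \<phi>" and sub: "\<And>y. z - y \<in> supp \<phi> \<Longrightarrow> y \<in> cbox a b"
  shows "conv f \<phi> z = integral (cbox a b) (\<lambda>y. f y * \<phi> (z - y))"
proof -
  have meas: "h \<in> borel_measurable lebesgue" if "continuous_on UNIV h" for h :: "real^'d \<Rightarrow> real"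
    using loc_integrable_measurable[OF loc_integrable_continuous[OF that]] .
  have cont: "continuous_on UNIV (\<lambda>y. f y * \<phi> (z - y))"
    by (intro continuous_intros f continuous_on_compose2[OF \<phi>]) auto
  have "conv f \<phi> z = (LINT y|lebesgue. f y * \<phi> (z - y))"
    by (rule conv_swap) (intro meas f \<phi>)+
  also have "\<dots> = (LINT y:cbox a b|lebesgue. f y * \<phi> (z - y))"
    unfolding set_lebesgue_integral_def
    by (intro Bochner_Integration.integral_cong) (use zero_outside_supp[of _ \<phi>] sub in \<open>auto simp: indicator_def\<close>)
  also have "\<dots> = integral (cbox a b) (\<lambda>y. f y * \<phi> (z - y))"
    using loc_integrable_continuous[OF cont] 
    by (intro set_lebesgue_integral_eq_integral) (auto simp: loc_integrable_def)
  finally show ?thesis .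
qed

lemma partial_conv:
  fixes f \<phi> :: "real^'d::finite \<Rightarrow> real"
  assumes f: "continuous_on UNIV f" and \<phi>: "smooth \<phi>" and supp: "supp \<phi> \<subseteq> cball 0 R"
  shows "partial i (conv f \<phi>) = conv f (partial i \<phi>)"
proof
  fix x :: "real^'d"
  obtain a b where ab: "cball x (R + 1) \<subseteq> cbox a b"
    using bounded_subset_cbox_symmetric[OF bounded_cball] by metis
  let ?e = "axis i (1::real)"
  let ?U = "{-1..1::real}"
  have sub: "y \<in> cbox a b" if "t \<in> ?U" "x + t *\<^sub>R ?e - y \<in> cball 0 R" for t y
  proof (rule subsetD[OF ab])
    have "norm (t *\<^sub>R ?e) \<le> 1" using that by (auto simp: norm_axis_1)
    moreover have "norm (x - y) \<le> norm (x + t *\<^sub>R ?e - y) + norm (t *\<^sub>R ?e)"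
      using norm_triangle_ineq4[of "x + t *\<^sub>R ?e - y" "t *\<^sub>R ?e"] by (simp add: algebra_simps)
    ultimately show "y \<in> cball x (R + 1)" using that by (simp add: dist_norm norm_minus_commute)
  qed
  have cont: "continuous_on UNIV \<phi>" "continuous_on UNIV (partial i \<phi>)"
    using smooth_continuous \<phi> smooth_partial by blast+
  have eq: "conv f \<phi> (x + t *\<^sub>R ?e) = integral (cbox a b) (\<lambda>y. f y * \<phi> (x + t *\<^sub>R ?e - y))" if "t \<in> ?U" for t
    by (rule conv_integral_box[OF f cont(1)]) (use sub[OF that] supp in auto)
  have eq': "conv f (partial i \<phi>) x = integral (cbox a b) (\<lambda>y. f y * partial i \<phi> (x + 0 *\<^sub>R ?e - y))"
  proof -
    have "y \<in> cbox a b" if "x - y \<in> supp (partial i \<phi>)" for y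
      using subsetD[OF supp subsetD[OF supp_partial that]] sub[of 0 y] by simp
    then show ?thesis using conv_integral_box[OF f cont(2), of x a b] by simp
  qed
  have "((\<lambda>t. integral (cbox a b) (\<lambda>y. f y * \<phi> (x + t *\<^sub>R ?e - y))) has_real_derivative
      integral (cbox a b) (\<lambda>y. f y * partial i \<phi> (x + 0 *\<^sub>R ?e - y))) (at 0 within ?U)"
  proof (rule leibniz_rule_field_derivative)
    fix t y
    have "((\<lambda>t. \<phi> ((x - y) + t *\<^sub>R ?e)) has_real_derivative partial i \<phi> ((x - y) + t *\<^sub>R ?e)) (at t within ?U)"
      using smooth_has_partial_derivative[OF \<phi>] by (rule DERIV_subset) simp
    from DERIV_cmult[OF this, of "f y"]
    show "((\<lambda>t. f y * \<phi> (x + t *\<^sub>R ?e - y)) has_real_derivative f y * partial i \<phi> (x + t *\<^sub>R ?e - y)) (at t within ?U)"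
      by (simp add: algebra_simps)
  next
    fix t
    show "(\<lambda>y. f y * \<phi> (x + t *\<^sub>R ?e - y)) integrable_on cbox a b"
      by (intro integrable_continuous continuous_intros continuous_on_compose2[OF cont(1)] continuous_on_subset[OF f]) auto
  next
    show "continuous_on (?U \<times> cbox a b) (\<lambda>(t, y). f y * partial i \<phi> (x + t *\<^sub>R ?e - y))"
      unfolding case_prod_beta
      by (intro continuous_intros continuous_on_compose2[OF cont(2)] continuous_on_compose2[OF f]) auto
  qed auto
  then have "((\<lambda>t. integral (cbox a b) (\<lambda>y. f y * \<phi> (x + t *\<^sub>R ?e - y))) has_real_derivative conv f (partial i \<phi>) x) (at 0)"
    unfolding eq'[symmetric] by (subst (asm) at_within_interior) auto
  then have "((\<lambda>t. conv f \<phi> (x + t *\<^sub>R ?e)) has_real_derivative conv f (partial i \<phi>) x) (at 0)"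
  proof (rule has_field_derivative_transform_within_open[where S="{-1<..<1}"])
    fix t :: real assume "t \<in> {-1<..<1}"
    then show "integral (cbox a b) (\<lambda>y. f y * \<phi> (x + t *\<^sub>R ?e - y)) = conv f \<phi> (x + t *\<^sub>R ?e)"
      using eq[of t] by simp
  qed auto
  then show "partial i (conv f \<phi>) x = conv f (partial i \<phi>) x"
    unfolding partial_def[of i "conv f \<phi>"] by (rule DERIV_imp_deriv)
qed

lemma foldr_partial_conv:
  fixes f \<phi> :: "real^'d::finite \<Rightarrow> real"
  assumes f: "continuous_on UNIV f" and \<phi>: "smooth \<phi>" and supp: "supp \<phi> \<subseteq> cball 0 R"
  shows "foldr partial is (conv f \<phi>) = conv f (foldr partial is \<phi>)"
  by (induction "is") (simp_all add: partial_conv[OF f smooth_foldr_partial[OF \<phi>] order_trans[OF supp_foldr_partial supp]])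

text \<open>All derivatives of \<open>f * \<phi>\<close> fall on \<open>\<phi>\<close>. Reflecting \<open>\<phi>\<close> produces the sign \<open>(-1)\<^bsup>\<bar>\<alpha>\<bar>\<^esup>\<close>
of the distributional derivative, evaluated at the test function \<open>y \<mapsto> \<phi>(x - y)\<close>.\<close>

theorem mderiv_conv_weak_derivative:
  fixes f \<phi> u :: "real^'d::finite \<Rightarrow> real"
  assumes f: "continuous_on UNIV f" and \<phi>: "smooth \<phi>" and supp: "supp \<phi> \<subseteq> cball 0 R"
    and u: "represents u (dist_deriv \<alpha> (regular_dist f))"
  shows "mderiv \<alpha> (conv f \<phi>) x = conv u \<phi> x"
proof -
  obtain "is" where len: "length is = mdeg \<alpha>" and mderiv: "\<And>f::real^'d \<Rightarrow> real. mderiv \<alpha> f = foldr partial is f"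
    using mderiv_foldr by blast
  let ?\<psi> = "\<lambda>y. \<phi> (x - y)"
  have meas: "h \<in> borel_measurable lebesgue" if "smooth h" for h :: "real^'d \<Rightarrow> real"
    using differentiable_on_imp_borel_lebesgue[OF smooth_differentiable[OF that]] .
  have fm: "f \<in> borel_measurable lebesgue" by (rule loc_integrable_measurable[OF loc_integrable_continuous[OF f]])
  have um: "u \<in> borel_measurable lebesgue" using u by (intro loc_integrable_measurable) (simp add: represents_def)
  have test: "?\<psi> \<in> test_functions"
  proof -
    have "bounded {y. ?\<psi> y \<noteq> 0}"
    proof (rule bounded_subset[OF bounded_cball])
      show "{y. ?\<psi> y \<noteq> 0} \<subseteq> cball x R"
        using supp zero_outside_supp[of _ \<phi>] by (force simp: dist_norm)
    qed
    then show ?thesis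
      unfolding test_functions_def supp_def using smooth_reflect[OF \<phi>] by simp
  qed
  have "mderiv \<alpha> (conv f \<phi>) x = conv f (foldr partial is \<phi>) x"
    by (simp add: mderiv foldr_partial_conv[OF f \<phi> supp])
  also have "\<dots> = (LINT y|lebesgue. f y * foldr partial is \<phi> (x - y))"
    by (intro conv_swap fm meas smooth_foldr_partial \<phi>)
  also have "\<dots> = (-1) ^ mdeg \<alpha> * (LINT y|lebesgue. f y * foldr partial is ?\<psi> y)"
    unfolding foldr_partial_reflect[OF \<phi>] len by (cases "even (mdeg \<alpha>)") simp_all
  also have "\<dots> = dist_deriv \<alpha> (regular_dist f) ?\<psi>"
    by (simp add: dist_deriv_def regular_dist_def mderiv)
  also have "\<dots> = regular_dist u ?\<psi>" using u test by (simp add: represents_def)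
  also have "\<dots> = conv u \<phi> x"
    unfolding regular_dist_def by (intro conv_swap[symmetric] um meas \<phi>)
  finally show ?thesis .
qed

section \<open>Jensen's inequality on finite powers of the reals, and mollifiers\<close>

text \<open>A supporting hyperplane, built as in the proof of the Hahn-Banach theorem: an affine
minorant that is exact at \<open>p\<close> is extended by one coordinate at a time. The slope in the new direction
must lie between all difference quotients to the left and all those to the right, and convexity makes
the former smaller than the latter.\<close>

lemma convex_on_power_support:
  assumes fin: "finite I" and H: "convex_on_power I H" and p: "p \<in> I \<rightarrow>\<^sub>E UNIV"
  shows "\<exists>a. \<forall>q \<in> I \<rightarrow>\<^sub>E UNIV. H p + (\<Sum>i\<in>I. a i * (q i - p i)) \<le> H q"
proof -
  have "\<exists>a. \<forall>q \<in> I \<rightarrow>\<^sub>E UNIV. (\<forall>i\<in>I - J. q i = p i) \<longrightarrow> H p + (\<Sum>i\<in>J. a i * (q i - p i)) \<le> H q"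
    if "finite J" "J \<subseteq> I" for J
    using that
  proof (induction J)
    case empty
    have "q = p" if "q \<in> I \<rightarrow>\<^sub>E UNIV" "\<forall>i\<in>I. q i = p i" for q
      using that p by (auto simp: PiE_def extensional_def fun_eq_iff)
    then show ?case by auto
  next
    case (insert j J)
    then obtain a where a: "\<And>q. q \<in> I \<rightarrow>\<^sub>E UNIV \<Longrightarrow> (\<forall>i\<in>I - J. q i = p i) \<Longrightarrow> H p + (\<Sum>i\<in>J. a i * (q i - p i)) \<le> H q"
      by auto
    define V where "V = {q \<in> I \<rightarrow>\<^sub>E UNIV. \<forall>i\<in>I - J. q i = p i}"
    define \<phi> where "\<phi> = (\<lambda>q. H p + (\<Sum>i\<in>J. a i * (q i - p i)))"
    \<comment> \<open>the difference quotients to the left of \<open>p j\<close>; the new slope is their supremum\<close>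
    define L where "L = {(\<phi> q - H (q(j := p j - r))) / r | q r. q \<in> V \<and> 0 < r}"
    have j: "j \<in> I" "j \<notin> J" using insert by auto
    have slopes: "(\<phi> q' - H (q'(j := p j - r))) / r \<le> (H (q(j := p j + s)) - \<phi> q) / s"
      if q: "q \<in> V" "q' \<in> V" and rs: "0 < r" "0 < s" for q q' r s
    proof -
      \<comment> \<open>the weight for which the two opposite displacements cancel in coordinate \<open>j\<close>\<close>
      define c where "c = r / (r + s)"
      have c: "c \<in> {0..1}" "1 - c = s / (r + s)" using rs by (auto simp: c_def field_simps)
      define w where "w = (\<lambda>i\<in>I. c * q i + (1 - c) * q' i)"
      have w: "w \<in> V" using q unfolding w_def V_def by (auto simp: algebra_simps)
      have "(\<lambda>i\<in>I. c * (q(j := p j + s)) i + (1 - c) * (q'(j := p j - r)) i) = w"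
      proof
        fix i
        have "c * s = (1 - c) * r" unfolding c(2) by (simp add: c_def)
        then have "c * (p j + s) + (1 - c) * (p j - r) = p j" by (simp add: algebra_simps)
        moreover have "q j = p j" "q' j = p j" using q j by (auto simp: V_def)
        moreover have "c * p j + (1 - c) * p j = p j" by (simp add: algebra_simps)
        ultimately show "(\<lambda>i\<in>I. c * (q(j := p j + s)) i + (1 - c) * (q'(j := p j - r)) i) i = w i"
          by (auto simp: w_def)
      qed
      moreover have "q(j := p j + s) \<in> I \<rightarrow>\<^sub>E UNIV" "q'(j := p j - r) \<in> I \<rightarrow>\<^sub>E UNIV"
        using q j by (auto simp: V_def PiE_def extensional_def)
      ultimately have "H w \<le> c * H (q(j := p j + s)) + (1 - c) * H (q'(j := p j - r))"
        using H[unfolded convex_on_power_def, rule_format, of "q(j := p j + s)" "q'(j := p j - r)", OF _ _ c(1)]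
        by simp
      moreover have "\<phi> w \<le> H w" using a w unfolding \<phi>_def V_def by auto
      moreover have "\<phi> w = c * \<phi> q + (1 - c) * \<phi> q'"
      proof -
        have "(\<Sum>i\<in>J. a i * (w i - p i)) = (\<Sum>i\<in>J. c * (a i * (q i - p i)) + (1 - c) * (a i * (q' i - p i)))"
          using insert.prems by (intro sum.cong) (auto simp: w_def algebra_simps)
        also have "\<dots> = c * (\<Sum>i\<in>J. a i * (q i - p i)) + (1 - c) * (\<Sum>i\<in>J. a i * (q' i - p i))"
          by (simp add: sum.distrib sum_distrib_left)
        finally show ?thesis by (simp add: \<phi>_def algebra_simps)
      qed
      ultimately have "(1 - c) * (\<phi> q' - H (q'(j := p j - r))) \<le> c * (H (q(j := p j + s)) - \<phi> q)"
        by (simp add: algebra_simps)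
      then have "s * (\<phi> q' - H (q'(j := p j - r))) \<le> r * (H (q(j := p j + s)) - \<phi> q)"
        unfolding c(2) unfolding c_def using rs by (simp add: divide_right_mono divide_le_cancel)
      then show ?thesis using rs by (simp add: field_simps)
    qed
    have pV: "p \<in> V" using p by (simp add: V_def)
    define m where "m = Sup L"
    have bdd: "bdd_above L"
      unfolding L_def using slopes[OF pV, of _ _ 1] by (intro bdd_aboveI[of _ "(H (p(j := p j + 1)) - \<phi> p) / 1"]) auto
    have "(\<phi> p - H (p(j := p j - 1))) / 1 \<in> L"
      unfolding L_def by (intro CollectI exI[of _ p] exI[of _ "1::real"]) (simp add: pV)
    then have ne: "L \<noteq> {}" by blast
    have m_lower: "(\<phi> q - H (q(j := p j - r))) / r \<le> m" if "q \<in> V" "0 < r" for q r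
      unfolding m_def by (rule cSup_upper[OF _ bdd]) (use that in \<open>auto simp: L_def\<close>)
    have m_upper: "m \<le> (H (q(j := p j + s)) - \<phi> q) / s" if "q \<in> V" "0 < s" for q s
      unfolding m_def by (rule cSup_least[OF ne]) (use that slopes in \<open>auto simp: L_def\<close>)
    show ?case
    proof (intro exI[of _ "a(j := m)"] ballI impI)
      fix q assume q: "q \<in> I \<rightarrow>\<^sub>E UNIV" "\<forall>i\<in>I - insert j J. q i = p i"
      define q0 where "q0 = q(j := p j)"
      define s where "s = q j - p j"
      have q0: "q0 \<in> V" using q j by (auto simp: q0_def V_def PiE_def extensional_def)
      have eq: "q0(j := p j + s) = q" by (auto simp: q0_def s_def)
      have "(\<Sum>i\<in>insert j J. (a(j := m)) i * (q i - p i)) = m * s + (\<Sum>i\<in>J. (a(j := m)) i * (q i - p i))"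
        using insert by (simp add: s_def)
      also have "(\<Sum>i\<in>J. (a(j := m)) i * (q i - p i)) = (\<Sum>i\<in>J. a i * (q0 i - p i))"
        using j by (intro sum.cong) (auto simp: q0_def)
      finally have sum: "H p + (\<Sum>i\<in>insert j J. (a(j := m)) i * (q i - p i)) = \<phi> q0 + m * s"
        by (simp add: \<phi>_def)
      have "\<phi> q0 + m * s \<le> H q"
      proof (cases s "0::real" rule: linorder_cases)
        case less
        then show ?thesis using m_lower[OF q0, of "- s"] eq by (simp add: field_simps)
      next
        case equal
        then have "q0 = q" using eq by (auto simp: q0_def s_def)
        then show ?thesis using equal a q0 unfolding \<phi>_def V_def by auto
      next
        case greater
        then show ?thesis using m_upper[OF q0, of s] eq by (simp add: field_simps)
      qed
      then show "H p + (\<Sum>i\<in>insert j J. (a(j := m)) i * (q i - p i)) \<le> H q" using sum by simp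
    qed
  qed
  from this[OF fin order_refl] show ?thesis by simp
qed

text \<open>Integrate the supporting hyperplane at the mean; its linear part has mean zero.\<close>

lemma convex_on_power_Jensen:
  assumes fin: "finite I" and H: "convex_on_power I H"
    and w: "\<And>x. 0 \<le> w x" "integrable M w" "(LINT x|M. w x) = 1"
    and u: "\<And>i. i \<in> I \<Longrightarrow> integrable M (\<lambda>x. u i x * w x)"
    and Hu: "integrable M (\<lambda>x. H (\<lambda>i\<in>I. u i x) * w x)"
  shows "H (\<lambda>i\<in>I. LINT x|M. u i x * w x) \<le> (LINT x|M. H (\<lambda>i\<in>I. u i x) * w x)"
proof -
  define p where "p = (\<lambda>i\<in>I. LINT x|M. u i x * w x)"
  obtain a where a: "\<And>q. q \<in> I \<rightarrow>\<^sub>E UNIV \<Longrightarrow> H p + (\<Sum>i\<in>I. a i * (q i - p i)) \<le> H q"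
    using convex_on_power_support[OF fin H, of p] by (auto simp: p_def)
  have int: "integrable M (\<lambda>x. a i * (u i x * w x) - a i * p i * w x)" if "i \<in> I" for i
    using u[OF that] w(2) by simp
  have "(LINT x|M. a i * (u i x * w x) - a i * p i * w x) = 0" if "i \<in> I" for i
    using u[OF that] w(2,3) that by (simp add: p_def)
  then have "H p = (LINT x|M. H p * w x + (\<Sum>i\<in>I. a i * (u i x * w x) - a i * p i * w x))"
    using int w by simp
  also have "\<dots> \<le> (LINT x|M. H (\<lambda>i\<in>I. u i x) * w x)"
  proof (rule integral_mono)
    show "integrable M (\<lambda>x. H p * w x + (\<Sum>i\<in>I. a i * (u i x * w x) - a i * p i * w x))"
      using int w(2) by simp
    show "H p * w x + (\<Sum>i\<in>I. a i * (u i x * w x) - a i * p i * w x) \<le> H (\<lambda>i\<in>I. u i x) * w x" for x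
    proof -
      have "(\<Sum>i\<in>I. a i * (u i x * w x) - a i * p i * w x) = (\<Sum>i\<in>I. a i * (u i x - p i)) * w x"
        unfolding sum_distrib_right by (intro sum.cong) (auto simp: algebra_simps)
      then have "H p * w x + (\<Sum>i\<in>I. a i * (u i x * w x) - a i * p i * w x) = (H p + (\<Sum>i\<in>I. a i * ((\<lambda>i\<in>I. u i x) i - p i))) * w x"
        by (simp add: algebra_simps)
      also have "\<dots> \<le> H (\<lambda>i\<in>I. u i x) * w x"
        by (intro mult_right_mono a w) auto
      finally show ?thesis .
    qed
  qed (rule Hu)
  finally show ?thesis by (simp add: p_def)
qed

text \<open>The supporting hyperplane at the limit point is a continuous minorant, so \<open>H\<close> is lower
semicontinuous.\<close>

lemma convex_on_power_closed_sublevel: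
  assumes fin: "finite I" and H: "convex_on_power I H"
    and lim: "\<And>i. i \<in> I \<Longrightarrow> (\<lambda>n. q n i) \<longlonglongrightarrow> p i"
    and le: "\<forall>\<^sub>F n in sequentially. H (\<lambda>i\<in>I. q n i) \<le> c"
  shows "H (\<lambda>i\<in>I. p i) \<le> c"
proof -
  obtain a where a: "\<And>q. q \<in> I \<rightarrow>\<^sub>E UNIV \<Longrightarrow> H (\<lambda>i\<in>I. p i) + (\<Sum>i\<in>I. a i * (q i - (\<lambda>i\<in>I. p i) i)) \<le> H q"
    using convex_on_power_support[OF fin H, of "\<lambda>i\<in>I. p i"] by auto
  have "(\<lambda>n. H (\<lambda>i\<in>I. p i) + (\<Sum>i\<in>I. a i * (q n i - p i))) \<longlonglongrightarrow> H (\<lambda>i\<in>I. p i) + (\<Sum>i\<in>I. a i * (p i - p i))"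
    by (intro tendsto_intros lim)
  moreover have "\<forall>\<^sub>F n in sequentially. H (\<lambda>i\<in>I. p i) + (\<Sum>i\<in>I. a i * (q n i - p i)) \<le> c"
    using le
  proof eventually_elim
    case (elim n)
    then show ?case using a[of "\<lambda>i\<in>I. q n i"] by (simp cong: sum.cong)
  qed
  ultimately show ?thesis using tendsto_upperbound by fastforce
qed

lemma continuous_bounded_on_cball:
  fixes w :: "'a::euclidean_space \<Rightarrow> real"
  assumes "continuous_on UNIV w"
  obtains B where "0 \<le> B" "\<And>z. z \<in> cball x r \<Longrightarrow> \<bar>w z\<bar> \<le> B"
proof -
  have "bounded (w ` cball x r)"
    by (intro compact_imp_bounded compact_continuous_image continuous_on_subset[OF assms]) auto
  then obtain B where "0 < B" "\<And>v. v \<in> w ` cball x r \<Longrightarrow> norm v \<le> B"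
    unfolding bounded_pos by blast
  then show ?thesis by (intro that[of B]) auto
qed

lemma loc_integrable_mult_weight:
  fixes u w :: "real^'d::finite \<Rightarrow> real"
  assumes u: "loc_integrable u" and w: "continuous_on UNIV w" and supp: "\<And>z. z \<notin> cball x r \<Longrightarrow> w z = 0"
  shows "integrable lebesgue (\<lambda>z. u z * w z)"
proof -
  obtain B where B: "\<And>z. z \<in> cball x r \<Longrightarrow> \<bar>w z\<bar> \<le> B"
    using continuous_bounded_on_cball[OF w] by blast
  have um: "u \<in> borel_measurable lebesgue" "w \<in> borel_measurable lebesgue"
    using loc_integrable_measurable u loc_integrable_continuous[OF w] by auto
  show ?thesis
  proof (rule Bochner_Integration.integrable_bound)
    show "integrable lebesgue (\<lambda>z. B * (indicat_real (cball x r) z *\<^sub>R u z))"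
      using loc_integrable_cball[OF u, of x r] unfolding set_integrable_def by (rule integrable_mult_right)
    show "(\<lambda>z. u z * w z) \<in> borel_measurable lebesgue" using um by (rule borel_measurable_times)
    show "AE z in lebesgue. norm (u z * w z) \<le> norm (B * (indicat_real (cball x r) z *\<^sub>R u z))"
    proof (rule AE_I2)
      fix z
      have "\<bar>u z\<bar> * \<bar>w z\<bar> \<le> \<bar>u z\<bar> * \<bar>B\<bar>" if "z \<in> cball x r"
        using B[OF that] by (intro mult_left_mono) auto
      then show "norm (u z * w z) \<le> norm (B * (indicat_real (cball x r) z *\<^sub>R u z))"
        using supp[of z] by (cases "z \<in> cball x r") (auto simp: abs_mult ac_simps)
    qed
  qed
qed

locale mollifier =
  fixes \<eta> :: "real^'d::finite \<Rightarrow> real"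
  assumes nonneg: "\<And>x. 0 \<le> \<eta> x" and smooth: "smooth \<eta>"
    and supp: "supp \<eta> \<subseteq> cball 0 1" and integral_1: "(LINT x|lebesgue. \<eta> x) = 1"
begin

abbreviation moll :: "nat \<Rightarrow> real^'d \<Rightarrow> real" where
  "moll n \<equiv> rescale \<eta> n"

lemma moll_nonneg: "0 \<le> moll n x"
  unfolding rescale_def using nonneg by simp

lemma moll_smooth: "smooth (moll n)"
  using smooth_affine[OF smooth, of "real n ^ CARD('d)" 0 "real n"] unfolding rescale_def[abs_def] by simp

lemma moll_zero:
  assumes "1 \<le> n" "x \<notin> cball 0 (1 / real n)"
  shows "moll n x = 0"
proof -
  have "real n *\<^sub>R x \<notin> cball 0 1" using assms by (auto simp: field_simps)
  then have "\<eta> (real n *\<^sub>R x) = 0" using supp zero_outside_supp[of "real n *\<^sub>R x" \<eta>] by blast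
  then show ?thesis by (simp add: rescale_def)
qed

lemma moll_supp: "1 \<le> n \<Longrightarrow> supp (moll n) \<subseteq> cball 0 (1 / real n)"
  unfolding supp_def by (rule closure_minimal[OF _ closed_cball]) (use moll_zero[of n] in force)

lemma moll_weight_continuous: "continuous_on UNIV (\<lambda>z. moll n (x - z))"
  by (rule smooth_continuous[OF smooth_reflect[OF moll_smooth]])

lemma moll_weight_zero: "1 \<le> n \<Longrightarrow> z \<notin> cball x (1 / real n) \<Longrightarrow> moll n (x - z) = 0"
  by (rule moll_zero) (simp_all add: dist_norm norm_minus_commute)

lemma moll_weight_integral:
  assumes "1 \<le> n"
  shows "(LINT z|lebesgue. moll n (x - z)) = 1"
proof -
  have \<eta>: "\<eta> \<in> borel_measurable lebesgue" using differentiable_on_imp_borel_lebesgue smooth_differentiable smooth by blast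
  have "1 = real n ^ CARD('d) * (LINT z|lebesgue. \<eta> (real n *\<^sub>R x + (- real n) *\<^sub>R z))"
    using lebesgue_integral_affine[OF _ \<eta>, of "- real n" "real n *\<^sub>R x"] assms integral_1 by simp
  also have "\<dots> = (LINT z|lebesgue. moll n (x - z))"
    unfolding rescale_def by (simp add: algebra_simps)
  finally show ?thesis by simp
qed

lemma moll_weight_mult_integrable:
  assumes "1 \<le> n" and u: "loc_integrable u"
  shows "integrable lebesgue (\<lambda>z. u z * moll n (x - z))"
  using loc_integrable_mult_weight[OF u moll_weight_continuous[of n x]] moll_weight_zero[OF assms(1)] by blast

lemma moll_weight_integrable:
  assumes "1 \<le> n"
  shows "integrable lebesgue (\<lambda>z. moll n (x - z))"
  using moll_weight_mult_integrable[OF assms loc_integrable_const[of 1]] by simp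

lemma conv_moll:
  assumes "loc_integrable u"
  shows "conv u (moll n) x = (LINT z|lebesgue. u z * moll n (x - z))"
  by (intro conv_swap loc_integrable_measurable assms
      differentiable_on_imp_borel_lebesgue smooth_differentiable moll_smooth)

lemma conv_moll_le:
  assumes n: "1 \<le> n" and u: "loc_integrable u"
    and le: "AE z in lebesgue. z \<in> cball x (1 / real n) \<longrightarrow> u z \<le> c"
  shows "conv u (moll n) x \<le> c"
proof -
  have "conv u (moll n) x \<le> (LINT z|lebesgue. c * moll n (x - z))"
    unfolding conv_moll[OF u]
  proof (rule integral_mono_AE)
    show "AE z in lebesgue. u z * moll n (x - z) \<le> c * moll n (x - z)"
      using le
    proof eventually_elim
      case (elim z)
      then show ?case using moll_nonneg[of n "x - z"] moll_weight_zero[OF n, of z x]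
        by (cases "z \<in> cball x (1 / real n)") (simp_all add: mult_right_mono)
    qed
  qed (intro moll_weight_mult_integrable n u loc_integrable_const)+
  then show ?thesis using moll_weight_integral[OF n, of x] by simp
qed

lemma abs_conv_moll_diff_le:
  assumes n: "1 \<le> n" and u: "loc_integrable u"
    and le: "\<And>z. z \<in> cball x (1 / real n) \<Longrightarrow> \<bar>u z - a\<bar> \<le> c"
  shows "\<bar>conv u (moll n) x - a\<bar> \<le> c"
proof -
  have "conv u (moll n) x \<le> a + c" 
    by (rule conv_moll_le[OF n u]) (use le in \<open>fastforce simp: abs_le_iff\<close>)
  moreover have "conv (\<lambda>z. - u z) (moll n) x \<le> c - a" 
    by (rule conv_moll_le[OF n loc_integrable_uminus[OF u]]) (use le in \<open>fastforce simp: abs_le_iff\<close>)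
  moreover have "conv (\<lambda>z. - u z) (moll n) x = - conv u (moll n) x"
    by (simp add: conv_def)
  ultimately show ?thesis by linarith
qed

text \<open>The mollifier is bounded by a constant multiple of \<open>n\<^sup>d\<close>, which is comparable to the inverse
volume of the ball of radius \<open>1/n\<close>. Hence the error is bounded by an average of \<open>\<bar>u - u x\<bar>\<close>.\<close>

lemma conv_moll_tendsto_Lebesgue_point:
  assumes u: "loc_integrable u" and x: "(ball_avg (\<lambda>y. \<bar>u y - u x\<bar>) x \<longlongrightarrow> 0) (at_right 0)"
  shows "(\<lambda>n. conv u (moll n) x) \<longlonglongrightarrow> u x"
proof -
  have ux: "loc_integrable (\<lambda>y. \<bar>u y - u x\<bar>)"
    using loc_integrable_abs[OF loc_integrable_add[OF u loc_integrable_const[of "- u x"]]] by simp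
  obtain B where B: "\<And>z. z \<in> cball 0 1 \<Longrightarrow> \<bar>\<eta> z\<bar> \<le> B"
    using continuous_bounded_on_cball[OF smooth_continuous[OF smooth]] by blast
  define V where "V = measure lebesgue (ball (0::real^'d) 1)"
  have bound: "\<bar>conv u (moll n) x - u x\<bar> \<le> B * V * ball_avg (\<lambda>y. \<bar>u y - u x\<bar>) x (1 / real n)" if n: "1 \<le> n" for n
  proof -
    let ?r = "1 / real n" and ?w = "\<lambda>z. moll n (x - z)"
    have "conv u (moll n) x - u x = (LINT z|lebesgue. u z * ?w z) - (LINT z|lebesgue. u x * ?w z)"
      unfolding conv_moll[OF u] using moll_weight_integral[OF n, of x] by simp
    also have "\<dots> = (LINT z|lebesgue. u z * ?w z - u x * ?w z)"
      by (intro Bochner_Integration.integral_diff[symmetric] moll_weight_mult_integrable n u loc_integrable_const)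
    finally have "\<bar>conv u (moll n) x - u x\<bar> \<le> (LINT z|lebesgue. \<bar>u z * ?w z - u x * ?w z\<bar>)"
      by (simp add: integral_abs_bound)
    also have "\<dots> = (LINT z|lebesgue. \<bar>u z - u x\<bar> * ?w z)"
      by (simp add: left_diff_distrib[symmetric] abs_mult moll_nonneg)
    also have "\<dots> \<le> (LINT z|lebesgue. B * real n ^ CARD('d) * (indicat_real (cball x ?r) z *\<^sub>R \<bar>u z - u x\<bar>))"
    proof (rule integral_mono)
      show "integrable lebesgue (\<lambda>z. B * real n ^ CARD('d) * (indicat_real (cball x ?r) z *\<^sub>R \<bar>u z - u x\<bar>))"
        using loc_integrable_cball[OF ux, of x ?r] unfolding set_integrable_def by (rule integrable_mult_right)
      fix z
      show "\<bar>u z - u x\<bar> * ?w z \<le> B * real n ^ CARD('d) * (indicat_real (cball x ?r) z *\<^sub>R \<bar>u z - u x\<bar>)"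
      proof (cases "z \<in> cball x ?r")
        case True
        then have "real n *\<^sub>R (x - z) \<in> cball 0 1" using n by (simp add: dist_norm pos_le_divide_eq mult.commute)
        from B[OF this] have "?w z \<le> B * real n ^ CARD('d)"
          unfolding rescale_def using mult_right_mono[of "\<eta> (real n *\<^sub>R (x - z))" B "real n ^ CARD('d)"]
          by (simp add: ac_simps)
        then have "\<bar>u z - u x\<bar> * ?w z \<le> \<bar>u z - u x\<bar> * (B * real n ^ CARD('d))"
          by (intro mult_left_mono) auto
        then show ?thesis using True by (simp add: ac_simps)
      next
        case False
        then show ?thesis using moll_weight_zero[OF n, of z x] by simp
      qed
    qed (rule moll_weight_mult_integrable[OF n ux])
    also have "\<dots> = B * real n ^ CARD('d) * (LINT z:cball x ?r|lebesgue. \<bar>u z - u x\<bar>)"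
      unfolding set_lebesgue_integral_def by (rule integral_mult_right_zero)
    also have "\<dots> = B * V * ball_avg (\<lambda>y. \<bar>u y - u x\<bar>) x ?r"
    proof -
      have "measure lebesgue (cball x ?r) = ?r ^ CARD('d) * V"
        unfolding V_def using content_ball_conv_unit_ball[of ?r x] by (simp add: content_cball_conv_ball)
      moreover have "measure lebesgue (cball x ?r) > 0" using n by (simp add: content_cball_pos)
      ultimately show ?thesis using n unfolding ball_avg_def by (simp add: field_simps)
    qed
    finally show ?thesis .
  qed
  have "filterlim (\<lambda>n. 1 / real n) (at_right 0) sequentially"
    unfolding filterlim_at using lim_1_over_n
    by (auto intro!: eventually_sequentiallyI[of 1])
  then have "(\<lambda>n. ball_avg (\<lambda>y. \<bar>u y - u x\<bar>) x (1 / real n)) \<longlonglongrightarrow> 0"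
    using x by (rule filterlim_compose[rotated])
  then have "(\<lambda>n. B * V * ball_avg (\<lambda>y. \<bar>u y - u x\<bar>) x (1 / real n)) \<longlonglongrightarrow> 0"
    by (rule tendsto_mult_right_zero)
  then have "(\<lambda>n. conv u (moll n) x - u x) \<longlonglongrightarrow> 0"
    by (rule Lim_null_comparison[rotated]) (use bound in \<open>auto intro!: eventually_sequentiallyI[of 1]\<close>)
  then show ?thesis by (rule Lim_null[THEN iffD2])
qed

end

section \<open>Convex monotone semigroups\<close>

lemma wnorm_less_infinity_iff:
  "wnorm \<kappa> u < \<infinity> \<longleftrightarrow> (\<exists>C. \<forall>x. \<bar>u x\<bar> * ereal (\<kappa> x) \<le> ereal C)"
proof
  assume less: "wnorm \<kappa> u < \<infinity>"
  have "wnorm \<kappa> u \<le> ereal (real_of_ereal (max 0 (wnorm \<kappa> u)))"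
    using less by (cases "wnorm \<kappa> u") (auto simp: max_def)
  then show "\<exists>C. \<forall>x. \<bar>u x\<bar> * ereal (\<kappa> x) \<le> ereal C"
    unfolding wnorm_def SUP_le_iff by blast
next
  assume "\<exists>C. \<forall>x. \<bar>u x\<bar> * ereal (\<kappa> x) \<le> ereal C"
  then obtain C where "wnorm \<kappa> u \<le> ereal C" unfolding wnorm_def SUP_le_iff by blast
  then show "wnorm \<kappa> u < \<infinity>" by (rule le_less_trans) simp
qed

lemma C_space_iff:
  assumes "\<And>x. 0 < \<kappa> x"
  shows "f \<in> C_space \<kappa> \<longleftrightarrow> continuous_on UNIV f \<and> (\<exists>C. \<forall>x. \<bar>f x\<bar> \<le> C / \<kappa> x)"
  unfolding C_space_def wnorm_less_infinity_iff using assms by (simp add: pos_le_divide_eq)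

locale semigroup_setting =
  fixes \<kappa> :: "real^'d::finite \<Rightarrow> real" and S :: "real \<Rightarrow> (real^'d \<Rightarrow> real) \<Rightarrow> real^'d \<Rightarrow> real"
  assumes \<kappa>_pos: "\<And>x. 0 < \<kappa> x" and \<kappa>_bounded: "bounded (range \<kappa>)" and \<kappa>_cont: "continuous_on UNIV \<kappa>"
    and \<kappa>_quot: "bdd_above {\<kappa> x / \<kappa> (x - y) | x y. norm y \<le> 1}"
    and semigroup: "convex_monotone_semigroup \<kappa> S"
begin

lemmas C_iff = C_space_iff[OF \<kappa>_pos]

lemma C_continuous: "f \<in> C_space \<kappa> \<Longrightarrow> continuous_on UNIV f"
  by (simp add: C_iff)

lemma C_bound:
  assumes "f \<in> C_space \<kappa>"
  obtains C where "0 \<le> C" "\<And>x. \<bar>f x\<bar> \<le> C / \<kappa> x"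
proof -
  obtain C where C: "\<And>x. \<bar>f x\<bar> \<le> C / \<kappa> x" using assms by (auto simp: C_iff)
  have "\<bar>f x\<bar> \<le> \<bar>C\<bar> / \<kappa> x" for x
    using C[of x] divide_right_mono[of C "\<bar>C\<bar>" "\<kappa> x"] \<kappa>_pos[of x] by linarith
  then show ?thesis using that[of "\<bar>C\<bar>"] by simp
qed

lemma C_I: "continuous_on UNIV f \<Longrightarrow> (\<And>x. \<bar>f x\<bar> \<le> C / \<kappa> x) \<Longrightarrow> f \<in> C_space \<kappa>"
  by (auto simp: C_iff)

lemma C_add:
  assumes "f \<in> C_space \<kappa>" "g \<in> C_space \<kappa>"
  shows "(\<lambda>x. f x + g x) \<in> C_space \<kappa>"
proof -
  obtain A B where A: "\<And>x. \<bar>f x\<bar> \<le> A / \<kappa> x" and B: "\<And>x. \<bar>g x\<bar> \<le> B / \<kappa> x"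
    using assms by (auto simp: C_iff)
  have "\<bar>f x + g x\<bar> \<le> (A + B) / \<kappa> x" for x
    using A[of x] B[of x] by (simp add: add_divide_distrib)
  then show ?thesis
    by (rule C_I[rotated]) (intro continuous_intros C_continuous assms)
qed

lemma C_cmult:
  assumes "f \<in> C_space \<kappa>"
  shows "(\<lambda>x. c * f x) \<in> C_space \<kappa>"
proof -
  obtain A where A: "\<And>x. \<bar>f x\<bar> \<le> A / \<kappa> x"
    using assms by (auto simp: C_iff)
  have "\<bar>c * f x\<bar> \<le> (\<bar>c\<bar> * A) / \<kappa> x" for x
    using mult_left_mono[OF A[of x], of "\<bar>c\<bar>"] by (simp add: abs_mult)
  then show ?thesis
    by (rule C_I[rotated]) (intro continuous_intros C_continuous assms)
qed

lemma C_uminus: "f \<in> C_space \<kappa> \<Longrightarrow> (\<lambda>x. - f x) \<in> C_space \<kappa>"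
  using C_cmult[of f "-1"] by simp

lemma C_const: "(\<lambda>x. c) \<in> C_space \<kappa>"
proof -
  obtain B where B: "\<And>x. \<bar>\<kappa> x\<bar> \<le> B" using \<kappa>_bounded by (auto simp: bounded_iff)
  show ?thesis
  proof (rule C_I)
    show "\<bar>c\<bar> \<le> (\<bar>c\<bar> * B) / \<kappa> x" for x
      using mult_left_mono[OF B[of x], of "\<bar>c\<bar>"] \<kappa>_pos[of x] by (simp add: pos_le_divide_eq)
  qed simp
qed

lemma C_mult_bounded:
  assumes "f \<in> C_space \<kappa>" "continuous_on UNIV h" "\<And>x. \<bar>h x\<bar> \<le> 1"
  shows "(\<lambda>x. f x * h x) \<in> C_space \<kappa>"
proof -
  obtain A where A: "\<And>x. \<bar>f x\<bar> \<le> A / \<kappa> x"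
    using assms by (auto simp: C_iff)
  have "\<bar>f x * h x\<bar> \<le> A / \<kappa> x" for x
    using mult_mono[OF A[of x] assms(3)[of x]] A[of x] by (simp add: abs_mult)
  then show ?thesis
    by (rule C_I[rotated]) (intro continuous_intros C_continuous assms)
qed

lemma C_inverse: "(\<lambda>x. C / \<kappa> x) \<in> C_space \<kappa>"
proof (rule C_I[where C="\<bar>C\<bar>"])
  show "continuous_on UNIV (\<lambda>x. C / \<kappa> x)"
    using \<kappa>_pos by (intro continuous_intros \<kappa>_cont) (metis less_irrefl)
qed (use \<kappa>_pos in \<open>simp add: less_imp_le\<close>)

lemma C_sum: "(\<And>i. i \<in> A \<Longrightarrow> F i \<in> C_space \<kappa>) \<Longrightarrow> (\<lambda>x. \<Sum>i\<in>A. F i x) \<in> C_space \<kappa>"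
  by (induction A rule: infinite_finite_induct) (auto intro: C_const C_add)

lemmas C_intros = C_add C_cmult C_uminus C_const C_inverse C_sum

lemma S_C: "0 \<le> t \<Longrightarrow> f \<in> C_space \<kappa> \<Longrightarrow> S t f \<in> C_space \<kappa>"
  using semigroup unfolding convex_monotone_semigroup_def by (elim conjE) simp

lemma S_convex:
  "0 \<le> t \<Longrightarrow> f \<in> C_space \<kappa> \<Longrightarrow> g \<in> C_space \<kappa> \<Longrightarrow> 0 \<le> c \<Longrightarrow> c \<le> 1 \<Longrightarrow>
    S t (\<lambda>y. c * f y + (1 - c) * g y) x \<le> c * S t f x + (1 - c) * S t g x"
  using semigroup unfolding convex_monotone_semigroup_def by (meson atLeastAtMost_iff)

lemma S_mono:
  assumes "0 \<le> t" "f \<in> C_space \<kappa>" "g \<in> C_space \<kappa>" "\<And>x. f x \<le> g x"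
  shows "S t f x \<le> S t g x"
proof -
  have "\<forall>t\<ge>0. \<forall>f\<in>C_space \<kappa>. \<forall>g\<in>C_space \<kappa>. (\<forall>x. f x \<le> g x) \<longrightarrow> (\<forall>x. S t f x \<le> S t g x)"
    using semigroup unfolding convex_monotone_semigroup_def by (elim conjE)
  then show ?thesis using assms by simp
qed

lemma S_tendsto_0:
  assumes "0 \<le> t" "\<And>n. F n \<in> C_space \<kappa>" "\<And>x. decseq (\<lambda>n. F n x)" "\<And>x. (\<lambda>n. F n x) \<longlonglongrightarrow> 0"
  shows "(\<lambda>n. S t (F n) x) \<longlonglongrightarrow> 0"
proof -
  have "\<forall>t\<ge>0. \<forall>F :: nat \<Rightarrow> real^'d \<Rightarrow> real.
        (\<forall>n. F n \<in> C_space \<kappa>) \<and> (\<forall>x. decseq (\<lambda>n. F n x) \<and> (\<lambda>n. F n x) \<longlonglongrightarrow> 0) \<longrightarrow>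
        (\<forall>x. decseq (\<lambda>n. S t (F n) x) \<and> (\<lambda>n. S t (F n) x) \<longlonglongrightarrow> 0)"
    using semigroup unfolding convex_monotone_semigroup_def by (elim conjE)
  then show ?thesis using assms by simp
qed

lemma S_0: "f \<in> C_space \<kappa> \<Longrightarrow> S 0 f = f"
  using semigroup unfolding convex_monotone_semigroup_def by (elim conjE) simp

lemma S_add: "0 \<le> s \<Longrightarrow> 0 \<le> t \<Longrightarrow> f \<in> C_space \<kappa> \<Longrightarrow> S (s + t) f = S s (S t f)"
  using semigroup unfolding convex_monotone_semigroup_def by (elim conjE) simp

lemma S_limsup:
  assumes "0 \<le> t" "f \<in> C_space \<kappa>" "\<And>n. 0 \<le> s n" "s \<longlonglongrightarrow> t" "xs \<longlonglongrightarrow> x"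
  shows "limsup (\<lambda>n. ereal (S (s n) f (xs n))) \<le> ereal (S t f x)"
proof -
  have "\<forall>t\<ge>0. \<forall>f\<in>C_space \<kappa>. \<forall>x. \<forall>s xs.
        (\<forall>n. 0 \<le> s n) \<and> s \<longlonglongrightarrow> t \<and> xs \<longlonglongrightarrow> x \<longrightarrow>
        limsup (\<lambda>n. ereal (S (s n) f (xs n))) \<le> ereal (S t f x)"
    using semigroup unfolding convex_monotone_semigroup_def by (elim conjE)
  then show ?thesis using assms by blast
qed

text \<open>The constant sequence zero decreases to zero, so continuity from above forces this. Together
with convexity it lets \<open>S t\<close> be bounded from below by \<open>S_lower\<close>, so that upper semicontinuity alone
controls the semigroup from both sides near time zero.\<close>

lemma S_zero:
  assumes "0 \<le> t"
  shows "S t (\<lambda>y. 0) x = 0"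
  using S_tendsto_0[OF assms, of "\<lambda>n y. 0"] by (simp add: C_const LIMSEQ_const_iff decseq_def)

lemma S_lower:
  assumes "0 \<le> t" "f \<in> C_space \<kappa>"
  shows "- S t (\<lambda>y. - f y) x \<le> S t f x"
  using S_convex[OF assms C_uminus[OF assms(2)], of "1/2" x] S_zero[OF assms(1), of x] by simp

text \<open>Turns the sequential condition at time zero into a bound on a neighbourhood, so that several
such bounds can be combined.\<close>

lemma S_upper_near_0:
  assumes f: "f \<in> C_space \<kappa>" and "0 < e"
  shows "\<exists>d>0. \<forall>s y. 0 \<le> s \<and> s \<le> d \<and> dist y x \<le> d \<longrightarrow> S s f y \<le> f x + e"
proof (rule ccontr)
  assume "\<not> ?thesis"
  then have "\<forall>n. \<exists>s y. 0 \<le> s \<and> s \<le> 1 / real (Suc n) \<and> dist y x \<le> 1 / real (Suc n) \<and> f x + e < S s f y"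
    by (metis not_less of_nat_0_less_iff zero_less_Suc zero_less_divide_1_iff)
  then obtain s y where sy: "\<And>n. 0 \<le> s n" "\<And>n. s n \<le> 1 / real (Suc n)"
    "\<And>n. dist (y n) x \<le> 1 / real (Suc n)" "\<And>n. f x + e < S (s n) f (y n)" by metis
  have lim: "(\<lambda>n. 1 / real (Suc n)) \<longlonglongrightarrow> 0"
    using LIMSEQ_inverse_real_of_nat by (simp add: inverse_eq_divide)
  have "s \<longlonglongrightarrow> 0" by (rule tendsto_sandwich[OF _ _ tendsto_const lim]) (use sy in auto)
  moreover have "(\<lambda>n. dist (y n) x) \<longlonglongrightarrow> 0" by (rule tendsto_sandwich[OF _ _ tendsto_const lim]) (use sy in auto)
  then have "y \<longlonglongrightarrow> x" by (rule tendsto_dist_iff[THEN iffD2])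
  ultimately have "limsup (\<lambda>n. ereal (S (s n) f (y n))) \<le> ereal (f x)"
    using S_limsup[of 0 f s y x] S_0[OF f] f sy(1) by simp
  moreover have "ereal (f x + e) \<le> limsup (\<lambda>n. ereal (S (s n) f (y n)))"
    by (rule le_Limsup) (use sy(4) in \<open>auto intro!: always_eventually simp: less_imp_le\<close>)
  ultimately have "ereal (f x + e) \<le> ereal (f x)" by (rule order_trans[rotated])
  then show False using \<open>0 < e\<close> by simp
qed

lemma S_sum_le:
  assumes t: "0 \<le> t" and "finite A" and "\<And>i. i \<in> A \<Longrightarrow> F i \<in> C_space \<kappa>"
    and "\<And>i. i \<in> A \<Longrightarrow> 0 \<le> c i" and "sum c A = 1"
  shows "S t (\<lambda>y. \<Sum>i\<in>A. c i * F i y) x \<le> (\<Sum>i\<in>A. c i * S t (F i) x)"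
  using assms(2-)
proof (induction A arbitrary: c rule: finite_induct)
  case (insert a A)
  have ca: "sum c A = 1 - c a" "0 \<le> c a" using insert by auto
  have nn: "0 \<le> sum c A" by (rule sum_nonneg) (use insert in auto)
  show ?case
  proof (cases "c a = 1")
    case True
    then have "c i = 0" if "i \<in> A" for i
      using sum_nonneg_eq_0_iff[OF insert.hyps(1), of c] ca insert.prems that by simp
    then show ?thesis using True insert.hyps by simp
  next
    case False
    then have pos: "0 < 1 - c a" using ca nn by linarith
    define c' where "c' = (\<lambda>i. c i / (1 - c a))"
    have "S t (\<lambda>y. \<Sum>i\<in>A. c' i * F i y) x \<le> (\<Sum>i\<in>A. c' i * S t (F i) x)"
    proof (rule insert.IH)
      show "sum c' A = 1" unfolding c'_def using ca pos by (simp add: sum_divide_distrib[symmetric])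
      show "0 \<le> c' i" if "i \<in> A" for i using insert.prems that pos by (simp add: c'_def)
    qed (use insert.prems in auto)
    then have "(1 - c a) * S t (\<lambda>y. \<Sum>i\<in>A. c' i * F i y) x \<le> (1 - c a) * (\<Sum>i\<in>A. c' i * S t (F i) x)"
      using pos by (intro mult_left_mono) auto
    moreover have "(1 - c a) * (\<Sum>i\<in>A. c' i * v i) = (\<Sum>i\<in>A. c i * v i)" for v :: "_ \<Rightarrow> real"
      unfolding sum_distrib_left c'_def using pos by (intro sum.cong) auto
    moreover have "S t (\<lambda>y. c a * F a y + (1 - c a) * (\<Sum>i\<in>A. c' i * F i y)) x
        \<le> c a * S t (F a) x + (1 - c a) * S t (\<lambda>y. \<Sum>i\<in>A. c' i * F i y) x"
      by (rule S_convex[OF t]) (use insert.prems ca pos in \<open>auto intro!: C_intros\<close>)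
    ultimately show ?thesis using insert.hyps by simp
  qed
qed simp

text \<open>Decreases to zero pointwise as \<open>m\<close> grows, so that continuity from above applies to its
products with nonnegative elements of \<open>C_space \<kappa>\<close>.\<close>

definition cutoff :: "nat \<Rightarrow> real^'d \<Rightarrow> real" where
  "cutoff m z = min 1 (max 0 (norm z - real m))"

text \<open>Lower semicontinuity of \<open>S t\<close> along bounded, locally uniformly convergent sequences. The error
\<open>G - F n\<close> is eventually below \<open>E m\<close>, a sequence in \<open>C_space \<kappa>\<close> decreasing to zero. Writing
\<open>F n + E m\<close> as the convex combination of \<open>F n\<close> and \<open>F n + E m / \<mu>\<close> with weights \<open>1 - \<mu>\<close> and \<open>\<mu>\<close>, the
second part costs \<open>\<mu>\<close> times a bounded quantity plus \<open>S t\<close> of a multiple of \<open>E m\<close>, which tends to zero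
with \<open>m\<close>. Finally \<open>\<mu>\<close> tends to zero.\<close>

lemma S_lower_semicontinuous:
  assumes t: "0 \<le> t" and F: "\<And>n. F n \<in> C_space \<kappa>" and G: "G \<in> C_space \<kappa>"
    and F_bound: "\<And>n y. \<bar>F n y\<bar> \<le> C / \<kappa> y"
    and unif: "\<And>R e. 0 < e \<Longrightarrow> \<forall>\<^sub>F n in sequentially. \<forall>y\<in>cball 0 R. \<bar>F n y - G y\<bar> \<le> e"
    and le: "\<forall>\<^sub>F n in sequentially. S t (F n) x \<le> b n" and b: "b \<longlonglongrightarrow> B"
  shows "S t G x \<le> B"
proof -
  have G_bound: "\<bar>G y\<bar> \<le> C / \<kappa> y" for y
  proof (rule field_le_epsilon)
    fix e :: real assume "0 < e"
    then obtain n where "\<forall>z\<in>cball 0 (norm y). \<bar>F n z - G z\<bar> \<le> e"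
      using eventually_happens'[OF sequentially_bot unif[of e "norm y"]] by blast
    then have "\<bar>F n y - G y\<bar> \<le> e" by simp
    then show "\<bar>G y\<bar> \<le> C / \<kappa> y + e" using F_bound[of n y] by linarith
  qed
  have C: "0 \<le> C / \<kappa> y" for y using F_bound[of 0 y] by simp
  define E where "E = (\<lambda>m z. 1 / real (Suc m) + 2 * C / \<kappa> z * cutoff m z)"
  have cutoff: "continuous_on UNIV (cutoff m)" "0 \<le> cutoff m z" "cutoff m z \<le> 1" for m z
    unfolding cutoff_def by (intro continuous_intros) auto
  have E_C: "E m \<in> C_space \<kappa>" for m
    unfolding E_def using cutoff by (intro C_add C_const C_mult_bounded C_inverse) auto
  have E_dec: "decseq (\<lambda>m. E m z)" for z
  proof (rule decseq_SucI)
    fix m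
    have "cutoff (Suc m) z \<le> cutoff m z" by (auto simp: cutoff_def)
    then have "2 * (C / \<kappa> z) * cutoff (Suc m) z \<le> 2 * (C / \<kappa> z) * cutoff m z"
      using C[of z] by (intro mult_left_mono) auto
    moreover have "1 / real (Suc (Suc m)) \<le> 1 / real (Suc m)" by (simp add: field_simps)
    ultimately show "E (Suc m) z \<le> E m z" unfolding E_def by simp
  qed
  have E_lim: "(\<lambda>m. E m z) \<longlonglongrightarrow> 0" for z
  proof -
    obtain N where N: "norm z \<le> real N" using real_arch_simple by blast
    have "(\<lambda>m. 1 / real (Suc m)) \<longlonglongrightarrow> 0"
      using LIMSEQ_inverse_real_of_nat by (simp add: inverse_eq_divide)
    moreover have "\<forall>\<^sub>F m in sequentially. 1 / real (Suc m) = E m z"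
      using N by (intro eventually_sequentiallyI[of N]) (simp add: E_def cutoff_def)
    ultimately show ?thesis by (rule Lim_transform_eventually)
  qed
  have G_le: "\<forall>\<^sub>F n in sequentially. \<forall>z. G z \<le> F n z + E m z" for m
  proof -
    have "\<forall>\<^sub>F n in sequentially. \<forall>y\<in>cball 0 (real (Suc m)). \<bar>F n y - G y\<bar> \<le> 1 / real (Suc m)"
      by (rule unif) simp
    then show ?thesis
    proof (rule eventually_mono, intro allI)
      fix n z assume n: "\<forall>y\<in>cball 0 (real (Suc m)). \<bar>F n y - G y\<bar> \<le> 1 / real (Suc m)"
      show "G z \<le> F n z + E m z"
      proof (cases "norm z \<le> real (Suc m)")
        case True
        then have "\<bar>F n z - G z\<bar> \<le> 1 / real (Suc m)" using n by (simp only: mem_cball_0)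
        then have "G z \<le> F n z + 1 / real (Suc m)" by linarith
        moreover have "0 \<le> 2 * (C / \<kappa> z) * cutoff m z" 
          using C[of z] cutoff(2)[of m z] by (intro mult_nonneg_nonneg) (simp_all only: zero_le_numeral)
        ultimately show ?thesis unfolding E_def by simp
      next
        case False
        then have "cutoff m z = 1" by (simp add: cutoff_def)
        then have "E m z = 1 / real (Suc m) + 2 * (C / \<kappa> z)" by (simp add: E_def)
        moreover have "0 \<le> 1 / real (Suc m)" by simp
        ultimately show ?thesis using G_bound[of z] F_bound[of n z] by linarith
      qed
    qed
  qed
  define K where "K = S t (\<lambda>z. 2 * C / \<kappa> z) x"
  have step: "S t G x \<le> (1 - \<mu>) * B + \<mu> * (1/2 * K + 1/2 * S t (\<lambda>z. 2 / \<mu> * E m z) x)"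
    if \<mu>: "0 < \<mu>" "\<mu> < 1" for \<mu> m
  proof (rule tendsto_lowerbound)
    show "(\<lambda>n. (1 - \<mu>) * b n + \<mu> * (1/2 * K + 1/2 * S t (\<lambda>z. 2 / \<mu> * E m z) x))
        \<longlonglongrightarrow> (1 - \<mu>) * B + \<mu> * (1/2 * K + 1/2 * S t (\<lambda>z. 2 / \<mu> * E m z) x)"
      by (intro tendsto_intros b)
    show "\<forall>\<^sub>F n in sequentially. S t G x \<le> (1 - \<mu>) * b n + \<mu> * (1/2 * K + 1/2 * S t (\<lambda>z. 2 / \<mu> * E m z) x)"
      using G_le[of m] le
    proof eventually_elim
      case (elim n)
      let ?A = "\<lambda>z. F n z + 1 / \<mu> * E m z"
      let ?D = "\<lambda>z. 1/2 * (2 * C / \<kappa> z) + (1 - 1/2) * (2 / \<mu> * E m z)"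
      have A: "?A \<in> C_space \<kappa>" by (intro C_intros F E_C)
      have D: "?D \<in> C_space \<kappa>" by (intro C_intros E_C)
      have "S t G x \<le> S t (\<lambda>z. \<mu> * ?A z + (1 - \<mu>) * F n z) x"
      proof (rule S_mono[OF t G])
        show "(\<lambda>z. \<mu> * ?A z + (1 - \<mu>) * F n z) \<in> C_space \<kappa>" by (intro C_add[OF C_cmult[OF A] C_cmult[OF F]])
        show "G z \<le> \<mu> * ?A z + (1 - \<mu>) * F n z" for z
          using elim(1) \<mu> by (simp add: algebra_simps)
      qed
      also have "\<dots> \<le> \<mu> * S t ?A x + (1 - \<mu>) * S t (F n) x"
        by (rule S_convex[OF t A F]) (use \<mu> in auto)
      finally have G_le_comb: "S t G x \<le> \<mu> * S t ?A x + (1 - \<mu>) * S t (F n) x" .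
      have "S t ?A x \<le> S t ?D x"
      proof (rule S_mono[OF t A D])
        show "?A z \<le> ?D z" for z using F_bound[of n z] by (simp add: abs_le_iff field_simps)
      qed
      also have "S t ?D x \<le> 1/2 * K + (1 - 1/2) * S t (\<lambda>z. 2 / \<mu> * E m z) x"
        unfolding K_def by (rule S_convex[OF t C_inverse C_cmult[OF E_C]]) simp_all
      finally have "\<mu> * S t ?A x \<le> \<mu> * (1/2 * K + (1 - 1/2) * S t (\<lambda>z. 2 / \<mu> * E m z) x)"
        using \<mu> by (intro mult_left_mono) auto
      moreover have "(1 - \<mu>) * S t (F n) x \<le> (1 - \<mu>) * b n"
        using \<mu> elim(2) by (intro mult_left_mono) auto
      ultimately show ?case using G_le_comb by simp
    qed
  qed simp
  have step2: "S t G x \<le> (1 - \<mu>) * B + \<mu> * (1/2 * K)" if \<mu>: "0 < \<mu>" "\<mu> < 1" for \<mu>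
  proof (rule tendsto_lowerbound)
    have "(\<lambda>m. S t (\<lambda>z. 2 / \<mu> * E m z) x) \<longlonglongrightarrow> 0"
    proof (rule S_tendsto_0[OF t])
      show "decseq (\<lambda>m. 2 / \<mu> * E m z)" for z
        unfolding decseq_def by (intro allI impI mult_left_mono decseqD[OF E_dec]) (use \<mu> in simp_all)
      show "(\<lambda>m. 2 / \<mu> * E m z) \<longlonglongrightarrow> 0" for z
        by (rule tendsto_mult_right_zero[OF E_lim])
    qed (intro C_cmult E_C)
    then have "(\<lambda>m. (1 - \<mu>) * B + \<mu> * (1/2 * K + 1/2 * S t (\<lambda>z. 2 / \<mu> * E m z) x))
       \<longlonglongrightarrow> (1 - \<mu>) * B + \<mu> * (1/2 * K + 1/2 * 0)"
      by (intro tendsto_intros)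
    then show "(\<lambda>m. (1 - \<mu>) * B + \<mu> * (1/2 * K + 1/2 * S t (\<lambda>z. 2 / \<mu> * E m z) x))
       \<longlonglongrightarrow> (1 - \<mu>) * B + \<mu> * (1/2 * K)" by simp
  qed (use step[OF \<mu>] in auto)
  show ?thesis
  proof (rule tendsto_lowerbound)
    have "((\<lambda>\<mu>. (1 - \<mu>) * B + \<mu> * (1/2 * K)) \<longlongrightarrow> (1 - 0) * B + 0 * (1/2 * K)) (at_right 0)"
      by (intro tendsto_intros)
    then show "((\<lambda>\<mu>. (1 - \<mu>) * B + \<mu> * (1/2 * K)) \<longlongrightarrow> B) (at_right 0)" by simp
    show "\<forall>\<^sub>F \<mu> in at_right 0. S t G x \<le> (1 - \<mu>) * B + \<mu> * (1/2 * K)"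
      unfolding eventually_at_right_field using step2 by (intro exI[of _ 1]) auto
  qed simp
qed

text \<open>Makes bounds by multiples of \<open>1/\<kappa>\<close> stable under mollification.\<close>

lemma \<kappa>_shift:
  obtains M where "1 \<le> M" "\<And>x y C. 0 \<le> C \<Longrightarrow> norm y \<le> 1 \<Longrightarrow> C / \<kappa> (x - y) \<le> C * M / \<kappa> x"
proof -
  obtain M where M: "\<And>x y. norm y \<le> 1 \<Longrightarrow> \<kappa> x / \<kappa> (x - y) \<le> M"
    using \<kappa>_quot unfolding bdd_above_def by blast
  have "1 \<le> M" using M[of 0 0] \<kappa>_pos[of 0] by simp
  moreover have "C / \<kappa> (x - y) \<le> C * M / \<kappa> x" if "0 \<le> C" "norm y \<le> 1" for x y C
  proof -
    have "C * (\<kappa> x / \<kappa> (x - y)) \<le> C * M" using M[OF that(2)] that(1) by (rule mult_left_mono)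
    then show ?thesis using \<kappa>_pos[of x] \<kappa>_pos[of "x - y"] by (simp add: field_simps)
  qed
  ultimately show ?thesis using that by blast
qed

end

section \<open>Jensen's inequality for the semigroup\<close>

context mollifier begin

lemma moll_integral:
  assumes "1 \<le> n"
  shows "(LINT z|lebesgue. moll n z) = 1"
proof -
  have "\<eta> \<in> borel_measurable lebesgue" using differentiable_on_imp_borel_lebesgue smooth_differentiable smooth by blast
  then show ?thesis
    using lebesgue_integral_affine[of "real n" \<eta> 0] assms integral_1 by (simp add: rescale_def)
qed

lemma moll_mult_integrable:
  assumes "1 \<le> n" and u: "loc_integrable u"
  shows "integrable lebesgue (\<lambda>z. u z * moll n z)"
  using loc_integrable_mult_weight[OF u smooth_continuous[OF moll_smooth[of n]]] moll_zero[OF assms(1)] by blast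

text \<open>A partition of the support of the mollifier into pieces of radius \<open>\<rho>\<close> turns the convolution
into a finite convex combination of translates. The nodes and weights depend neither on \<open>f\<close> nor on
\<open>y\<close>, so the same combination can be used before and after applying \<open>S t\<close>.\<close>

lemma moll_quadrature:
  assumes n: "1 \<le> n" and \<rho>: "0 < \<rho>"
  shows "\<exists>(N::nat) c z. (\<forall>i. 0 \<le> c i) \<and> sum c {..<N} = 1 \<and> (\<forall>i<N. norm (z i) \<le> 1 / real n) \<and>
    (\<forall>f y e. continuous_on UNIV f \<longrightarrow>
      (\<forall>u\<in>cball 0 (1 / real n). \<forall>v\<in>cball 0 (1 / real n). dist u v < \<rho> \<longrightarrow> \<bar>f (y - u) - f (y - v)\<bar> \<le> e) \<longrightarrow>
      \<bar>conv f (moll n) y - (\<Sum>i<N. c i * f (y - z i))\<bar> \<le> e)"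
proof -
  let ?B = "cball (0::real^'d) (1 / real n)"
  obtain Z where Z: "Z \<subseteq> ?B" "finite Z" "?B \<subseteq> (\<Union>z\<in>Z. ball z \<rho>)"
  proof (rule compactE_image)
    show "compact ?B" by (rule compact_cball)
    show "open (ball z \<rho>)" if "z \<in> ?B" for z by (rule open_ball)
    show "?B \<subseteq> (\<Union>z\<in>?B. ball z \<rho>)"
    proof
      fix z assume "z \<in> ?B"
      then show "z \<in> (\<Union>z\<in>?B. ball z \<rho>)" by (rule UN_I) (use \<rho> in simp)
    qed
  qed (rule that)
  obtain h where h: "bij_betw h {0..<card Z} Z" using ex_bij_betw_nat_finite[OF Z(2)] by blast
  define N where "N = card Z"
  have hZ: "h i \<in> Z" if "i < N" for i using bij_betwE[OF h] that by (simp add: N_def)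
  \<comment> \<open>empty beyond \<open>N\<close>, so that the infinite sequence \<open>disjointed A\<close> partitions the ball\<close>
  define A where "A = (\<lambda>i. if i < N then ball (h i) \<rho> \<inter> ?B else {})"
  define P where "P = disjointed A"
  have P_A: "P i \<subseteq> A i" for i unfolding P_def by (rule disjointed_subset)
  have disj: "disjoint_family_on P {..<N}"
    using disjoint_family_disjointed[of A] unfolding P_def by (rule disjoint_family_on_mono[rotated]) simp
  have union: "(\<Union>i<N. P i) = ?B"
  proof -
    have "(\<Union>i<N. P i) = (\<Union>i<N. A i)"
      using UN_disjointed_eq[of A] finite_UN_disjointed_eq[of A N] unfolding P_def by (simp add: lessThan_atLeast0)
    also have "\<dots> = (\<Union>i<N. ball (h i) \<rho>) \<inter> ?B" by (auto simp: A_def)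
    also have "(\<Union>i<N. ball (h i) \<rho>) = (\<Union>z\<in>h ` {0..<N}. ball z \<rho>)" by (auto simp: lessThan_atLeast0)
    also have "h ` {0..<N} = Z" using h by (simp add: bij_betw_def N_def)
    finally show ?thesis using Z(3) by (simp add: Int_absorb1)
  qed
  have P_sets: "P i \<in> sets lebesgue" for i
  proof -
    have "range A \<subseteq> sets lebesgue" by (auto simp: A_def)
    then show ?thesis unfolding P_def using sets.range_disjointed_sets[of A lebesgue] by blast
  qed
  have ind: "(\<Sum>i<N. indicat_real (P i) x) = 1" if "x \<in> ?B" for x
    using indicator_UN_disjoint[OF _ disj, of x] union that by simp
  define c where "c = (\<lambda>i. LINT x|lebesgue. indicat_real (P i) x * moll n x)"
  have moll_int: "integrable lebesgue (moll n)"
    using moll_mult_integrable[OF n loc_integrable_const[of 1]] by simp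
  have int: "integrable lebesgue (\<lambda>x. indicat_real (P i) x * moll n x)" for i
    using integrable_mult_indicator[OF P_sets moll_int, of i] by simp
  have c: "0 \<le> c i" for i unfolding c_def by (intro integral_nonneg_AE AE_I2) (simp add: moll_nonneg)
  have swap: "(\<Sum>i<N. a i * (indicat_real (P i) x * moll n x)) = (\<Sum>i<N. indicat_real (P i) x * a i) * moll n x" for a x
    unfolding sum_distrib_right by (intro sum.cong refl) (simp only: ac_simps)
  have weighted: "(\<Sum>i<N. c i * a i) = (LINT x|lebesgue. (\<Sum>i<N. indicat_real (P i) x * a i) * moll n x)" for a
  proof -
    have "(\<Sum>i<N. c i * a i) = (\<Sum>i<N. LINT x|lebesgue. a i * (indicat_real (P i) x * moll n x))"
      by (simp add: c_def mult.commute)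
    also have "\<dots> = (LINT x|lebesgue. (\<Sum>i<N. a i * (indicat_real (P i) x * moll n x)))"
      by (rule Bochner_Integration.integral_sum[symmetric]) (intro integrable_mult_right int)
    finally show ?thesis unfolding swap .
  qed
  have weighted_int: "integrable lebesgue (\<lambda>x. (\<Sum>i<N. indicat_real (P i) x * a i) * moll n x)" for a
  proof -
    have "integrable lebesgue (\<lambda>x. \<Sum>i<N. a i * (indicat_real (P i) x * moll n x))"
      by (intro Bochner_Integration.integrable_sum integrable_mult_right int)
    then show ?thesis unfolding swap .
  qed
  have sum_c: "sum c {..<N} = 1"
  proof -
    have "sum c {..<N} = (LINT x|lebesgue. (\<Sum>i<N. indicat_real (P i) x) * moll n x)"
      using weighted[of "\<lambda>_. 1"] by simp
    also have "\<dots> = (LINT x|lebesgue. moll n x)"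
      by (intro Bochner_Integration.integral_cong refl) (metis ind moll_zero[OF n] mult.left_neutral mult_zero_right)
    finally show ?thesis using moll_integral[OF n] by simp
  qed
  have quad: "\<bar>conv f (moll n) y - (\<Sum>i<N. c i * f (y - h i))\<bar> \<le> e"
    if f: "continuous_on UNIV f"
      and osc: "\<forall>u\<in>?B. \<forall>v\<in>?B. dist u v < \<rho> \<longrightarrow> \<bar>f (y - u) - f (y - v)\<bar> \<le> e" for f y e
  proof -
    let ?s = "\<lambda>x. \<Sum>i<N. indicat_real (P i) x * f (y - h i)"
    have "continuous_on UNIV (\<lambda>x. f (y - x))"
      by (intro continuous_on_compose2[OF f] continuous_intros) auto
    then have fint: "integrable lebesgue (\<lambda>x. f (y - x) * moll n x)"
      by (intro moll_mult_integrable n loc_integrable_continuous)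
    have pw: "\<bar>f (y - x) * moll n x - ?s x * moll n x\<bar> \<le> e * moll n x" for x
    proof (cases "x \<in> ?B")
      case True
      have "f (y - x) - ?s x = (\<Sum>i<N. indicat_real (P i) x * (f (y - x) - f (y - h i)))"
        using ind[OF True] by (simp add: right_diff_distrib sum_subtractf sum_distrib_right[symmetric])
      also have "\<bar>\<dots>\<bar> \<le> (\<Sum>i<N. indicat_real (P i) x * e)"
      proof (rule sum_abs[THEN order_trans], rule sum_mono)
        fix i assume "i \<in> {..<N}"
        then have i: "h i \<in> ?B" by (intro subsetD[OF Z(1)] hZ) simp
        show "\<bar>indicat_real (P i) x * (f (y - x) - f (y - h i))\<bar> \<le> indicat_real (P i) x * e"
        proof (cases "x \<in> P i")
          case True
          then have "dist x (h i) < \<rho>" using P_A[of i] by (auto simp: A_def dist_commute split: if_splits)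
          then show ?thesis using osc True \<open>x \<in> ?B\<close> i by simp
        qed simp
      qed
      also have "\<dots> = e" using ind[OF True] by (simp add: sum_distrib_right[symmetric])
      finally have "\<bar>f (y - x) - ?s x\<bar> * moll n x \<le> e * moll n x"
        by (intro mult_right_mono moll_nonneg)
      then show ?thesis by (simp add: left_diff_distrib[symmetric] abs_mult moll_nonneg)
    next
      case False
      then show ?thesis using moll_zero[OF n False] by simp
    qed
    have "conv f (moll n) y - (\<Sum>i<N. c i * f (y - h i)) = (LINT x|lebesgue. f (y - x) * moll n x - ?s x * moll n x)"
      unfolding conv_def weighted by (rule Bochner_Integration.integral_diff[symmetric, OF fint weighted_int])
    also have "\<bar>\<dots>\<bar> \<le> (LINT x|lebesgue. \<bar>f (y - x) * moll n x - ?s x * moll n x\<bar>)"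
      by (rule integral_abs_bound)
    also have "\<dots> \<le> (LINT x|lebesgue. e * moll n x)"
      by (intro integral_mono integrable_abs Bochner_Integration.integrable_diff fint weighted_int
          integrable_mult_right moll_int pw)
    also have "\<dots> = e" using moll_integral[OF n] by simp
    finally show ?thesis .
  qed
  have hB: "norm (h i) \<le> 1 / real n" if "i < N" for i
    using subsetD[OF Z(1) hZ[OF that]] by simp
  show ?thesis
    by (rule exI[of _ N], rule exI[of _ c], rule exI[of _ h]) (use c sum_c quad hB in auto)
qed

lemma uniform_continuity_near_cball:
  fixes f :: "real^'d \<Rightarrow> real"
  assumes f: "continuous_on UNIV f" and "0 < e"
  obtains \<delta> where "0 < \<delta>"
    "\<And>y u v. y \<in> cball 0 R \<Longrightarrow> u \<in> cball 0 1 \<Longrightarrow> v \<in> cball 0 1 \<Longrightarrow> dist u v < \<delta> \<Longrightarrow> \<bar>f (y - u) - f (y - v)\<bar> \<le> e"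
proof -
  have "uniformly_continuous_on (cball 0 (R + 1)) f"
    by (intro compact_uniformly_continuous continuous_on_subset[OF f]) auto
  then obtain \<delta> where \<delta>: "0 < \<delta>"
    "\<And>x x'. x \<in> cball 0 (R + 1) \<Longrightarrow> x' \<in> cball 0 (R + 1) \<Longrightarrow> dist x' x < \<delta> \<Longrightarrow> dist (f x') (f x) < e"
    using \<open>0 < e\<close> unfolding uniformly_continuous_on_def by meson
  show ?thesis
  proof (rule that[OF \<delta>(1)])
    fix y u v :: "real^'d" assume *: "y \<in> cball 0 R" "u \<in> cball 0 1" "v \<in> cball 0 1" "dist u v < \<delta>"
    have "y - u \<in> cball 0 (R + 1)" "y - v \<in> cball 0 (R + 1)"
      using * norm_triangle_ineq4[of y u] norm_triangle_ineq4[of y v] by auto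
    moreover have "dist (y - u) (y - v) < \<delta>" using *(4) by (simp add: dist_norm norm_minus_commute)
    ultimately show "\<bar>f (y - u) - f (y - v)\<bar> \<le> e" using \<delta>(2)[of "y - v" "y - u"] by (simp add: dist_real_def)
  qed
qed

lemma moll_quadrature_sequence:
  assumes n: "1 \<le> n"
  obtains N :: "nat \<Rightarrow> nat" and c :: "nat \<Rightarrow> nat \<Rightarrow> real" and z where
    "\<And>k i. 0 \<le> c k i" "\<And>k. sum (c k) {..<N k} = 1" "\<And>k i. i < N k \<Longrightarrow> norm (z k i) \<le> 1 / real n"
    "\<And>f R e. continuous_on UNIV f \<Longrightarrow> 0 < e \<Longrightarrow>
      \<forall>\<^sub>F k in sequentially. \<forall>y\<in>cball 0 R. \<bar>conv f (moll n) y - (\<Sum>i<N k. c k i * f (y - z k i))\<bar> \<le> e"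
proof -
  define Q where "Q = (\<lambda>k (N::nat) c z. (\<forall>i. 0 \<le> c i) \<and> sum c {..<N} = 1 \<and> (\<forall>i<N. norm (z i) \<le> 1 / real n) \<and>
    (\<forall>f y e. continuous_on UNIV f \<longrightarrow>
      (\<forall>u\<in>cball 0 (1 / real n). \<forall>v\<in>cball 0 (1 / real n). dist u v < 1 / real (Suc k) \<longrightarrow> \<bar>f (y - u) - f (y - v)\<bar> \<le> e) \<longrightarrow>
      \<bar>conv f (moll n) y - (\<Sum>i<N. c i * f (y - z i))\<bar> \<le> e))"
  have "\<forall>k. \<exists>N c z. Q k N c z"
    unfolding Q_def by (intro allI moll_quadrature n) simp
  then obtain N c z where "\<And>k. Q k (N k) (c k) (z k)" by metis
  note Ncz = this[unfolded Q_def]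
  show ?thesis
  proof (rule that[of c N z])
    fix f :: "real^'d \<Rightarrow> real" and R e :: real assume f: "continuous_on UNIV f" and "0 < e"
    obtain \<delta> where \<delta>: "0 < \<delta>"
      "\<And>y u v. y \<in> cball 0 R \<Longrightarrow> u \<in> cball 0 1 \<Longrightarrow> v \<in> cball 0 1 \<Longrightarrow> dist u v < \<delta> \<Longrightarrow> \<bar>f (y - u) - f (y - v)\<bar> \<le> e"
      using uniform_continuity_near_cball[OF f \<open>0 < e\<close>] by blast
    obtain k0 where k0: "1 / real (Suc k0) < \<delta>" using nat_approx_posE[OF \<delta>(1)] by blast
    have sub: "u \<in> cball 0 1" if "u \<in> cball 0 (1 / real n)" for u :: "real^'d"
    proof -
      have "1 / real n \<le> 1" using n by simp
      then show ?thesis using that by simp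
    qed
    show "\<forall>\<^sub>F k in sequentially. \<forall>y\<in>cball 0 R. \<bar>conv f (moll n) y - (\<Sum>i<N k. c k i * f (y - z k i))\<bar> \<le> e"
    proof (rule eventually_sequentiallyI[of k0], rule ballI)
      fix k and y :: "real^'d" assume "k0 \<le> k" and y: "y \<in> cball 0 R"
      then have "1 / real (Suc k) \<le> 1 / real (Suc k0)" by (simp add: field_simps)
      then have "\<forall>u\<in>cball 0 (1 / real n). \<forall>v\<in>cball 0 (1 / real n). dist u v < 1 / real (Suc k) \<longrightarrow> \<bar>f (y - u) - f (y - v)\<bar> \<le> e"
        using \<delta>(2)[OF y] k0 sub by (meson less_le_trans less_trans)
      then show "\<bar>conv f (moll n) y - (\<Sum>i<N k. c k i * f (y - z k i))\<bar> \<le> e"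
        using Ncz[of k] f by blast
    qed
  qed (use Ncz in auto)
qed

lemma conv_moll_uniform_limit:
  assumes f: "continuous_on UNIV f" and "0 < e"
  shows "\<forall>\<^sub>F n in sequentially. \<forall>y\<in>cball 0 R. \<bar>conv f (moll n) y - f y\<bar> \<le> e"
proof -
  obtain \<delta> where \<delta>: "0 < \<delta>"
      "\<And>y u v. y \<in> cball 0 R \<Longrightarrow> u \<in> cball 0 1 \<Longrightarrow> v \<in> cball 0 1 \<Longrightarrow> dist u v < \<delta> \<Longrightarrow> \<bar>f (y - u) - f (y - v)\<bar> \<le> e"
    using uniform_continuity_near_cball[OF f \<open>0 < e\<close>] by blast
  obtain k0 where k0: "1 / real (Suc k0) < \<delta>" using nat_approx_posE[OF \<delta>(1)] by blast
  show ?thesis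
  proof (rule eventually_sequentiallyI[of "Suc k0"], rule ballI)
    fix n and y :: "real^'d" assume n: "Suc k0 \<le> n" and y: "y \<in> cball 0 R"
    show "\<bar>conv f (moll n) y - f y\<bar> \<le> e"
    proof (rule abs_conv_moll_diff_le)
      fix z assume z: "z \<in> cball y (1 / real n)"
      have "1 / real n \<le> 1 / real (Suc k0)" using n by (intro divide_left_mono) auto
      then have "1 / real n < \<delta>" using k0 by simp
      moreover have "1 / real n \<le> 1" using n by simp
      ultimately have "y - z \<in> cball 0 1" "dist (y - z) 0 < \<delta>" using z by (auto simp: dist_norm norm_minus_commute)
      then show "\<bar>f z - f y\<bar> \<le> e" using \<delta>(2)[OF y, of "y - z" 0] by simp
    qed (use n loc_integrable_continuous[OF f] in auto)
  qed
qed

end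

locale semigroup_mollifier = semigroup_setting \<kappa> S + mollifier \<eta>
  for \<kappa> :: "real^'d::finite \<Rightarrow> real" and S and \<eta> :: "real^'d \<Rightarrow> real"
begin

lemma translate_C:
  assumes f: "f \<in> C_space \<kappa>" and C: "0 \<le> C" "\<And>y. \<bar>f y\<bar> \<le> C / \<kappa> y"
    and M: "\<And>x y C. 0 \<le> C \<Longrightarrow> norm y \<le> 1 \<Longrightarrow> C / \<kappa> (x - y) \<le> C * M / \<kappa> x"
    and z: "norm z \<le> 1"
  shows "translate z f \<in> C_space \<kappa>" "\<bar>translate z f y\<bar> \<le> C * M / \<kappa> y"
proof -
  show bound: "\<bar>translate z f y\<bar> \<le> C * M / \<kappa> y" for y
    using C(2)[of "y - (- z)"] M[OF C(1), of "- z" y] z by (simp add: translate_def add.commute)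
  have "continuous_on UNIV (translate z f)"
    unfolding translate_def[abs_def]
    by (intro continuous_on_compose2[OF C_continuous[OF f]] continuous_intros) auto
  then show "translate z f \<in> C_space \<kappa>" by (rule C_I) (rule bound)
qed

text \<open>Jensen's inequality for \<open>S t\<close> and the average of translates \<open>f * \<eta>\<^sub>n\<close>. The inequality holds
for the finite convex combinations of the quadrature, and passes to the limit by lower
semicontinuity; finite sums avoid integrating \<open>S t (translate z f) y\<close> over \<open>z\<close>.\<close>

lemma S_conv_le:
  assumes t: "0 \<le> t" and f: "f \<in> C_space \<kappa>" and n: "1 \<le> n" and conv_C: "conv f (moll n) \<in> C_space \<kappa>"
    and trans: "\<And>z y. norm z \<le> 1 / real n \<Longrightarrow> S t (translate z f) y \<le> translate z (S t f) y + c / \<kappa> y"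
  shows "S t (conv f (moll n)) y \<le> conv (S t f) (moll n) y + c / \<kappa> y"
proof -
  obtain C where C: "0 \<le> C" "\<And>y. \<bar>f y\<bar> \<le> C / \<kappa> y" using C_bound[OF f] by blast
  obtain M where M: "1 \<le> M" "\<And>x y C. 0 \<le> C \<Longrightarrow> norm y \<le> 1 \<Longrightarrow> C / \<kappa> (x - y) \<le> C * M / \<kappa> x" using \<kappa>_shift by blast
  obtain N :: "nat \<Rightarrow> nat" and w z where w: "\<And>k i. 0 \<le> w k i" "\<And>k. sum (w k) {..<N k} = 1"
    and z: "\<And>k i. i < N k \<Longrightarrow> norm (z k i) \<le> 1 / real n"
    and quad: "\<And>f R e. continuous_on UNIV f \<Longrightarrow> 0 < e \<Longrightarrow>
      \<forall>\<^sub>F k in sequentially. \<forall>y\<in>cball 0 R. \<bar>conv f (moll n) y - (\<Sum>i<N k. w k i * f (y - z k i))\<bar> \<le> e"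
    by (rule moll_quadrature_sequence[OF n]) (rule that; simp)
  have n1: "1 / real n \<le> 1" using n by simp
  have z1: "norm (z k i) \<le> 1" if "i < N k" for k i using z[OF that] n1 by linarith
  define T where "T = (\<lambda>k i. translate (- z k i) f)"
  have T: "T k i \<in> C_space \<kappa>" "\<bar>T k i x\<bar> \<le> C * M / \<kappa> x" if "i < N k" for k i x
    unfolding T_def using translate_C[OF f C M(2)] z1[OF that] by auto
  have T_eq: "T k i x = f (x - z k i)" for k i x by (simp add: T_def translate_def)
  define F where "F = (\<lambda>k x. \<Sum>i<N k. w k i * T k i x)"
  show ?thesis
  proof (rule S_lower_semicontinuous[OF t, where F=F and C="C * M"])
    show "F k \<in> C_space \<kappa>" for k unfolding F_def using T by (intro C_sum C_cmult) auto
    show "conv f (moll n) \<in> C_space \<kappa>" by (rule conv_C)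
    show "\<bar>F k x\<bar> \<le> C * M / \<kappa> x" for k x
    proof -
      have "\<bar>F k x\<bar> \<le> (\<Sum>i<N k. \<bar>w k i * T k i x\<bar>)" unfolding F_def by (rule sum_abs)
      also have "\<dots> \<le> (\<Sum>i<N k. w k i * (C * M / \<kappa> x))"
        unfolding abs_mult abs_of_nonneg[OF w(1)] by (intro sum_mono mult_left_mono w T(2)[OF lessThan_iff[THEN iffD1]])
      also have "\<dots> = C * M / \<kappa> x" by (simp only: sum_distrib_right[symmetric] w(2) mult_1)
      finally show ?thesis .
    qed
    show "\<forall>\<^sub>F k in sequentially. \<forall>y\<in>cball 0 R. \<bar>F k y - conv f (moll n) y\<bar> \<le> e" if "0 < e" for R e
      using quad[OF C_continuous[OF f] that, of R] by (simp add: F_def T_eq abs_minus_commute)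
    let ?b = "\<lambda>k. (\<Sum>i<N k. w k i * S t f (y - z k i)) + c / \<kappa> y"
    show "\<forall>\<^sub>F k in sequentially. S t (F k) y \<le> ?b k"
    proof (rule always_eventually, rule allI)
      fix k
      have "S t (F k) y \<le> (\<Sum>i<N k. w k i * S t (T k i) y)"
        unfolding F_def by (rule S_sum_le[OF t]) (use T w in auto)
      also have "\<dots> \<le> (\<Sum>i<N k. w k i * (S t f (y - z k i) + c / \<kappa> y))"
      proof (intro sum_mono mult_left_mono w)
        fix i assume "i \<in> {..<N k}"
        then show "S t (T k i) y \<le> S t f (y - z k i) + c / \<kappa> y"
          using trans[of "- z k i" y] z[of i k] by (simp add: T_def translate_def)
      qed
      also have "\<dots> = ?b k"
        by (simp only: distrib_left sum.distrib sum_distrib_right[symmetric] w(2) mult_1)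
      finally show "S t (F k) y \<le> ?b k" .
    qed
    have "(\<lambda>k. \<Sum>i<N k. w k i * S t f (y - z k i)) \<longlonglongrightarrow> conv (S t f) (moll n) y"
    proof (rule metric_LIMSEQ_I)
      fix e :: real assume "0 < e"
      then have "\<forall>\<^sub>F k in sequentially. \<forall>x\<in>cball 0 (norm y). \<bar>conv (S t f) (moll n) x - (\<Sum>i<N k. w k i * S t f (x - z k i))\<bar> \<le> e / 2"
        by (intro quad C_continuous S_C t f) simp
      then obtain k0 where "\<And>k. k0 \<le> k \<Longrightarrow> \<bar>conv (S t f) (moll n) y - (\<Sum>i<N k. w k i * S t f (y - z k i))\<bar> \<le> e / 2"
        unfolding eventually_sequentially by fastforce
      then show "\<exists>k0. \<forall>k\<ge>k0. dist (\<Sum>i<N k. w k i * S t f (y - z k i)) (conv (S t f) (moll n) y) < e"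
        using \<open>0 < e\<close> by (intro exI[of _ k0]) (fastforce simp: dist_real_def abs_minus_commute)
    qed
    then show "?b \<longlonglongrightarrow> conv (S t f) (moll n) y + c / \<kappa> y" by (intro tendsto_intros)
  qed
qed

end

section \<open>The generator on mollifications\<close>

text \<open>In particular every ball contains points at which the averages converge, and bounds on
\<open>avg_lim g\<close> are bounds on \<open>g\<close> almost everywhere.\<close>

lemma AE_in_X_avg:
  fixes g :: "real^'d::finite \<Rightarrow> real"
  assumes g: "loc_integrable g"
  shows "AE x in lebesgue. x \<in> X_avg g \<and> avg_lim g x = g x"
  using AE_Lebesgue_point[OF g]
proof eventually_elim
  case (elim x)
  have "\<bar>ball_avg g x r - g x\<bar> \<le> ball_avg (\<lambda>y. \<bar>g y - g x\<bar>) x r" if "0 < r" for r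
  proof -
    have gx: "loc_integrable (\<lambda>y. \<bar>g y - g x\<bar>)"
      using loc_integrable_abs[OF loc_integrable_add[OF g loc_integrable_const[of "- g x"]]] by simp
    have "ball_avg g x r \<le> ball_avg (\<lambda>y. \<bar>g y - g x\<bar> + g x) x r"
      by (rule ball_avg_mono) (auto intro!: g gx loc_integrable_add loc_integrable_const)
    moreover have "ball_avg (\<lambda>y. g x) x r \<le> ball_avg (\<lambda>y. \<bar>g y - g x\<bar> + g y) x r"
      by (rule ball_avg_mono) (auto intro!: g gx loc_integrable_add loc_integrable_const)
    ultimately show ?thesis
      using that by (simp add: ball_avg_add g gx loc_integrable_const ball_avg_const abs_le_iff)
  qed
  then have "((\<lambda>r. ball_avg g x r - g x) \<longlongrightarrow> 0) (at_right 0)"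
    by (intro Lim_null_comparison[OF _ elim]) (simp add: eventually_at_right_field, blast intro: zero_less_one)
  then have lim: "(ball_avg g x \<longlongrightarrow> g x) (at_right 0)" by (rule Lim_null[THEN iffD2])
  then show ?case unfolding X_avg_def avg_lim_def using tendsto_Lim[OF _ lim] by auto
qed

lemma avg_lim_le:
  fixes g :: "real^'d::finite \<Rightarrow> real"
  assumes g: "loc_integrable g" and y: "y \<in> X_avg g" and "0 < r"
    and le: "AE z in lebesgue. z \<in> cball y r \<longrightarrow> g z \<le> c"
  shows "avg_lim g y \<le> c"
proof -
  obtain l where l: "(ball_avg g y \<longlongrightarrow> l) (at_right 0)" using y by (auto simp: X_avg_def)
  then have "avg_lim g y = l" unfolding avg_lim_def by (intro tendsto_Lim) auto
  moreover have "l \<le> c"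
  proof (rule tendsto_upperbound[OF l])
    show "\<forall>\<^sub>F s in at_right 0. ball_avg g y s \<le> c"
      unfolding eventually_at_right_field
    proof (intro exI[of _ r] conjI allI impI)
      fix s assume s: "0 < s" "s < r"
      have "ball_avg g y s \<le> ball_avg (\<lambda>_. c) y s"
      proof (rule ball_avg_mono_AE[OF g loc_integrable_const])
        show "AE z in lebesgue. z \<in> cball y s \<longrightarrow> g z \<le> c"
          using le by eventually_elim (use s in auto)
      qed
      then show "ball_avg g y s \<le> c" using s by (simp add: ball_avg_const)
    qed (rule \<open>0 < r\<close>)
  qed simp
  ultimately show ?thesis by simp
qed

lemma avg_usc_le:
  fixes g :: "real^'d::finite \<Rightarrow> real"
  assumes g: "loc_integrable g" and "0 < r"
    and le: "AE z in lebesgue. z \<in> cball x r \<longrightarrow> g z \<le> c"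
  shows "avg_usc g x \<le> ereal c"
  unfolding avg_usc_def
proof (rule INF_lower2)
  show "r / 2 \<in> {0<..}" using \<open>0 < r\<close> by simp
  show "(SUP y\<in>X_avg g \<inter> cball x (r / 2). ereal (avg_lim g y)) \<le> ereal c"
  proof (rule SUP_least)
    fix y assume y: "y \<in> X_avg g \<inter> cball x (r / 2)"
    have "avg_lim g y \<le> c"
    proof (rule avg_lim_le[OF g])
      show "0 < r / 2" using \<open>0 < r\<close> by simp
      have "cball y (r / 2) \<subseteq> cball x r" using y by (intro cball_subset_cball_iff[THEN iffD2]) (auto simp: dist_commute)
      then show "AE z in lebesgue. z \<in> cball y (r / 2) \<longrightarrow> g z \<le> c"
        using le by (auto elim!: eventually_mono)
    qed (use y in auto)
    then show "ereal (avg_lim g y) \<le> ereal c" by simp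
  qed
qed

lemma usc_avg_usc: "usc (avg_usc g)"
  unfolding usc_def
proof
  fix c
  show "open {x. avg_usc g x < c}"
    unfolding open_contains_ball
  proof
    fix x assume "x \<in> {x. avg_usc g x < c}"
    then obtain \<delta> where \<delta>: "0 < \<delta>" "(SUP y\<in>X_avg g \<inter> cball x \<delta>. ereal (avg_lim g y)) < c"
      unfolding avg_usc_def by (auto simp: INF_less_iff)
    have "avg_usc g z < c" if "z \<in> ball x (\<delta> / 2)" for z
    proof -
      have sub: "cball z (\<delta> / 2) \<subseteq> cball x \<delta>" using that by (intro cball_subset_cball_iff[THEN iffD2]) (auto simp: dist_commute)
      have "avg_usc g z \<le> (SUP y\<in>X_avg g \<inter> cball z (\<delta> / 2). ereal (avg_lim g y))"
        unfolding avg_usc_def by (rule INF_lower) (use \<delta> in simp)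
      also have "\<dots> \<le> (SUP y\<in>X_avg g \<inter> cball x \<delta>. ereal (avg_lim g y))"
        by (rule SUP_subset_mono) (use sub in auto)
      finally show ?thesis using \<delta>(2) by simp
    qed
    then show "\<exists>e>0. ball x e \<subseteq> {x. avg_usc g x < c}" using \<delta>(1) by (intro exI[of _ "\<delta> / 2"]) auto
  qed
qed

lemma AE_le_of_avg_usc_less:
  fixes g :: "real^'d::finite \<Rightarrow> real"
  assumes g: "loc_integrable g" and less: "avg_usc g x < ereal K"
  obtains \<delta> c where "0 < \<delta>" "c < K" "AE z in lebesgue. z \<in> cball x \<delta> \<longrightarrow> g z \<le> c"
proof -
  obtain \<delta> where \<delta>: "0 < \<delta>" "(SUP y\<in>X_avg g \<inter> cball x \<delta>. ereal (avg_lim g y)) < ereal K"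
    using less unfolding avg_usc_def by (auto simp: INF_less_iff)
  obtain c where c: "(SUP y\<in>X_avg g \<inter> cball x \<delta>. ereal (avg_lim g y)) < ereal c" "ereal c < ereal K"
    using ereal_dense2[OF \<delta>(2)] by blast
  have "AE z in lebesgue. z \<in> cball x \<delta> \<longrightarrow> g z \<le> c"
    using AE_in_X_avg[OF g]
  proof eventually_elim
    case (elim z)
    show ?case
    proof
      assume "z \<in> cball x \<delta>"
      then have "ereal (avg_lim g z) \<le> (SUP y\<in>X_avg g \<inter> cball x \<delta>. ereal (avg_lim g y))"
        by (intro SUP_upper) (use elim in auto)
      then have "ereal (avg_lim g z) \<le> ereal c" using less_imp_le[OF c(1)] by (rule order_trans)
      then show "g z \<le> c" using elim by simp
    qed
  qed
  then show ?thesis using that \<delta>(1) c(2) by simp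
qed

text \<open>Choose \<open>ys n\<close> so that \<open>Q n (ys n) e\<close> holds for some \<open>e\<close> that exceeds the infimum of all
possible accuracies by less than \<open>1/(n+1)\<close>.\<close>

lemma eventually_diagonal_choice:
  fixes Q :: "nat \<Rightarrow> 'a \<Rightarrow> real \<Rightarrow> bool"
  assumes ex: "\<And>e. 0 < e \<Longrightarrow> \<forall>\<^sub>F n in sequentially. \<exists>y. Q n y e"
    and mono: "\<And>n y e e'. Q n y e \<Longrightarrow> e \<le> e' \<Longrightarrow> Q n y e'"
  obtains ys where "\<And>e. 0 < e \<Longrightarrow> \<forall>\<^sub>F n in sequentially. Q n (ys n) e"
proof -
  define A where "A = (\<lambda>n. {e. 0 < e \<and> (\<exists>y. Q n y e)})"
  define ys where "ys = (\<lambda>n. SOME y. \<exists>e < Inf (A n) + 1 / real (Suc n). Q n y e)"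
  have bdd: "bdd_below (A n)" for n unfolding A_def by (intro bdd_belowI[of _ 0]) auto
  have ys: "\<exists>e < Inf (A n) + 1 / real (Suc n). Q n (ys n) e" if ne: "A n \<noteq> {}" for n
  proof -
    have "Inf (A n) < Inf (A n) + 1 / real (Suc n)" by simp
    then obtain e where "e \<in> A n" "e < Inf (A n) + 1 / real (Suc n)"
      using cInf_less_iff[OF ne bdd] by blast
    then have "\<exists>y. \<exists>e < Inf (A n) + 1 / real (Suc n). Q n y e" by (auto simp: A_def)
    then show ?thesis unfolding ys_def by (rule someI_ex)
  qed
  show ?thesis
  proof (rule that[of ys])
    fix e :: real assume "0 < e"
    then have "0 < e / 2" by simp
    then obtain k where k: "1 / real (Suc k) < e / 2" using nat_approx_posE by blast
    have "\<forall>\<^sub>F n in sequentially. k \<le> n" by (rule eventually_ge_at_top)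
    with ex[OF \<open>0 < e / 2\<close>] show "\<forall>\<^sub>F n in sequentially. Q n (ys n) e"
    proof eventually_elim
      case (elim n)
      then have e2: "e / 2 \<in> A n" using \<open>0 < e\<close> by (simp add: A_def)
      then obtain e' where e': "e' < Inf (A n) + 1 / real (Suc n)" "Q n (ys n) e'" using ys by blast
      have "Inf (A n) \<le> e / 2" by (rule cInf_lower[OF e2 bdd])
      moreover have "1 / real (Suc n) \<le> 1 / real (Suc k)" using elim(2) by (simp add: field_simps)
      ultimately have "e' \<le> e" using e'(1) k by linarith
      then show ?case by (rule mono[OF e'(2)])
    qed
  qed
qed

text \<open>A function, its mollifications, and what is known about the generator on the latter.\<close>

locale mollified_generator = semigroup_mollifier \<kappa> S \<eta>
  for \<kappa> :: "real^'d::finite \<Rightarrow> real" and S and \<eta> :: "real^'d \<Rightarrow> real" +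
  fixes f g :: "real^'d \<Rightarrow> real" and I :: "(nat^'d) set" and H :: "(nat^'d \<Rightarrow> real) \<Rightarrow> real"
    and Df :: "nat^'d \<Rightarrow> real^'d \<Rightarrow> real"
  assumes fin: "finite I" and H: "convex_on_power I H"
    and f_L: "f \<in> L_plus \<kappa> S"
    and trans: "\<And>\<epsilon>. 0 < \<epsilon> \<Longrightarrow> \<exists>\<delta>>0. \<exists>t0>0. \<forall>t\<in>{0..t0}. \<forall>x. norm x \<le> \<delta> \<longrightarrow>
           (\<forall>y. S t (translate x f) y \<le> translate x (S t f) y + \<epsilon> * t / \<kappa> y)"
    and Df: "\<And>\<alpha>. \<alpha> \<in> I \<Longrightarrow> represents (Df \<alpha>) (dist_deriv \<alpha> (regular_dist f))"
    and g_eq: "\<And>x. g x = H (\<lambda>\<alpha>\<in>I. Df \<alpha> x)"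
    and g_loc: "loc_integrable g"
    and gen: "\<And>n. 1 \<le> n \<Longrightarrow> conv f (rescale \<eta> n) \<in> Gamma_dom \<kappa> S \<and>
           Gamma_gen \<kappa> S (conv f (rescale \<eta> n)) =
             (\<lambda>x. ereal (H (\<lambda>\<alpha>\<in>I. mderiv \<alpha> (conv f (rescale \<eta> n)) x)))"
begin

definition fn :: "nat \<Rightarrow> real^'d \<Rightarrow> real" where "fn n = conv f (moll n)"

text \<open>The value of the generator at \<open>fn n\<close>, see \<open>fn_generator\<close>, with the derivatives already moved
onto \<open>f\<close>.\<close>

definition Hn :: "nat \<Rightarrow> real^'d \<Rightarrow> real" where "Hn n x = H (\<lambda>\<alpha>\<in>I. conv (Df \<alpha>) (moll n) x)"

lemma f_C: "f \<in> C_space \<kappa>"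
  using f_L by (simp add: L_plus_def)

lemma f_loc: "loc_integrable f"
  by (rule loc_integrable_continuous[OF C_continuous[OF f_C]])

lemma Df_loc: "\<alpha> \<in> I \<Longrightarrow> loc_integrable (Df \<alpha>)"
  using Df by (simp add: represents_def)

lemma fn_C: "1 \<le> n \<Longrightarrow> fn n \<in> C_space \<kappa>"
  using gen unfolding fn_def by (simp add: Gamma_dom_def L_plus_def)

lemma fn_generator:
  assumes n: "1 \<le> n"
  shows "Gamma_right_lim \<kappa> (diff_quot S (fn n)) (\<lambda>x. ereal (Hn n x))"
proof -
  have "mderiv \<alpha> (conv f (moll n)) x = conv (Df \<alpha>) (moll n) x" if "\<alpha> \<in> I" for \<alpha> x
    by (rule mderiv_conv_weak_derivative[OF C_continuous[OF f_C] moll_smooth moll_supp[OF n] Df[OF that]])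
  then have "(\<lambda>x. ereal (Hn n x)) = Gamma_gen \<kappa> S (fn n)"
    using gen[OF n] unfolding Hn_def fn_def by (simp cong: restrict_cong)
  moreover obtain u where u: "Gamma_right_lim \<kappa> (diff_quot S (fn n)) u"
    using gen[OF n] unfolding fn_def Gamma_dom_def by auto
  moreover have "Gamma_gen \<kappa> S (fn n) = u"
    unfolding Gamma_gen_def using u Gamma_right_lim_unique by (intro the_equality) blast+
  ultimately show ?thesis by simp
qed

lemma fn_limsup:
  assumes "1 \<le> n" "\<And>k. 0 < h k" "h \<longlonglongrightarrow> 0" "xs \<longlonglongrightarrow> x"
  shows "limsup (\<lambda>k. ereal ((S (h k) (fn n) (xs k) - fn n (xs k)) / h k)) \<le> ereal (Hn n x)"
proof -
  have "Gamma_seq_lim \<kappa> (\<lambda>k. diff_quot S (fn n) (h k)) (\<lambda>x. ereal (Hn n x))"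
    using fn_generator[OF assms(1)] assms(2,3) unfolding Gamma_right_lim_def by blast
  then show ?thesis using assms(4) unfolding Gamma_seq_lim_def diff_quot_def by blast
qed

lemma fn_recovery:
  assumes "1 \<le> n" "\<And>k. 0 < h k" "h \<longlonglongrightarrow> 0"
  obtains xs where "xs \<longlonglongrightarrow> x" "(\<lambda>k. (S (h k) (fn n) (xs k) - fn n (xs k)) / h k) \<longlonglongrightarrow> Hn n x"
proof -
  have "Gamma_seq_lim \<kappa> (\<lambda>k. diff_quot S (fn n) (h k)) (\<lambda>x. ereal (Hn n x))"
    using fn_generator[OF assms(1)] assms(2,3) unfolding Gamma_right_lim_def by blast
  then have "\<exists>xs. xs \<longlonglongrightarrow> x \<and> (\<lambda>k. ereal ((S (h k) (fn n) (xs k) - fn n (xs k)) / h k)) \<longlonglongrightarrow> ereal (Hn n x)"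
    unfolding Gamma_seq_lim_def diff_quot_def by blast
  then show ?thesis using that unfolding lim_ereal by blast
qed

lemma Hn_le_conv:
  assumes n: "1 \<le> n"
  shows "Hn n x \<le> conv g (moll n) x"
proof -
  have g_eq': "g = (\<lambda>z. H (\<lambda>\<alpha>\<in>I. Df \<alpha> z))" using g_eq by (rule ext)
  have "H (\<lambda>\<alpha>\<in>I. LINT z|lebesgue. Df \<alpha> z * moll n (x - z)) \<le> (LINT z|lebesgue. H (\<lambda>\<alpha>\<in>I. Df \<alpha> z) * moll n (x - z))"
    by (intro convex_on_power_Jensen fin H moll_nonneg moll_weight_integrable moll_weight_integral
        moll_weight_mult_integrable Df_loc n g_loc[unfolded g_eq'])
  moreover have "Hn n x = H (\<lambda>\<alpha>\<in>I. LINT z|lebesgue. Df \<alpha> z * moll n (x - z))"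
    unfolding Hn_def by (intro arg_cong[where f=H] restrict_ext conv_moll Df_loc)
  ultimately show ?thesis unfolding conv_moll[OF g_loc] unfolding g_eq' by simp
qed

text \<open>The exceptional null set is the same for all \<open>c\<close>: it consists of the points that fail to be a
Lebesgue point of some \<open>Df \<alpha>\<close>.\<close>

lemma AE_g_le:
  "AE x in lebesgue. \<forall>c. (\<forall>\<^sub>F n in sequentially. Hn n x \<le> c) \<longrightarrow> g x \<le> c"
proof -
  have "AE x in lebesgue. \<forall>\<alpha>\<in>I. (ball_avg (\<lambda>y. \<bar>Df \<alpha> y - Df \<alpha> x\<bar>) x \<longlongrightarrow> 0) (at_right 0)"
    by (intro AE_finite_allI fin AE_Lebesgue_point Df_loc)
  then show ?thesis
  proof eventually_elim
    case (elim x)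
    show ?case
    proof (intro allI impI)
      fix c assume c: "\<forall>\<^sub>F n in sequentially. Hn n x \<le> c"
      show "g x \<le> c"
        unfolding g_eq
      proof (rule convex_on_power_closed_sublevel[OF fin H])
        show "(\<lambda>n. conv (Df \<alpha>) (moll n) x) \<longlonglongrightarrow> Df \<alpha> x" if "\<alpha> \<in> I" for \<alpha>
          using that elim by (intro conv_moll_tendsto_Lebesgue_point Df_loc) auto
        show "\<forall>\<^sub>F n in sequentially. H (\<lambda>\<alpha>\<in>I. conv (Df \<alpha>) (moll n) x) \<le> c"
          using c unfolding Hn_def .
      qed
    qed
  qed
qed

lemma f_increment:
  obtains C t0 where "0 \<le> C" "0 < t0" "\<And>h x. 0 < h \<Longrightarrow> h \<le> t0 \<Longrightarrow> S h f x - f x \<le> h * C / \<kappa> x"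
proof -
  have "Limsup (at_right 0) (\<lambda>h. wnorm \<kappa> (\<lambda>x. ereal (max (S h f x - f x) 0 / h))) < \<infinity>"
    using f_L by (simp add: L_plus_def)
  then obtain C where "Limsup (at_right 0) (\<lambda>h. wnorm \<kappa> (\<lambda>x. ereal (max (S h f x - f x) 0 / h))) < ereal C"
    using ereal_dense2 by blast
  then have "\<forall>\<^sub>F h in at_right 0. wnorm \<kappa> (\<lambda>x. ereal (max (S h f x - f x) 0 / h)) < ereal C"
    by (rule Limsup_lessD)
  then obtain b where b: "0 < b"
    "\<And>h. 0 < h \<Longrightarrow> h < b \<Longrightarrow> wnorm \<kappa> (\<lambda>x. ereal (max (S h f x - f x) 0 / h)) < ereal C"
    unfolding eventually_at_right_field by blast
  have bound: "S h f x - f x \<le> h * C / \<kappa> x" and nn: "0 \<le> C" if h: "0 < h" "h \<le> b / 2" for h x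
  proof -
    have "\<bar>ereal (max (S h f x - f x) 0 / h)\<bar> * ereal (\<kappa> x) \<le> ereal C"
      using b(2)[of h] h b(1) unfolding wnorm_def
      by (intro order_trans[OF SUP_upper less_imp_le]) auto
    then have *: "max (S h f x - f x) 0 / h * \<kappa> x \<le> C" using h by simp
    moreover have "0 \<le> max (S h f x - f x) 0 / h * \<kappa> x" using h \<kappa>_pos[of x] by simp
    ultimately show "0 \<le> C" by linarith
    have "m \<le> h * C / \<kappa> x" if "m / h * \<kappa> x \<le> C" for m
      using that h \<kappa>_pos[of x] by (simp add: field_simps)
    from this[OF *] show "S h f x - f x \<le> h * C / \<kappa> x" by simp
  qed
  show ?thesis by (rule that[of C "b / 2"]) (use bound nn[of "b / 2"] b(1) in auto)
qed

lemma fn_increment_le_conv: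
  assumes "0 < \<epsilon>"
  obtains N t0 where "1 \<le> N" "0 < t0"
    "\<And>n t y. N \<le> n \<Longrightarrow> 0 \<le> t \<Longrightarrow> t \<le> t0 \<Longrightarrow>
       S t (fn n) y - fn n y \<le> conv (\<lambda>z. S t f z - f z) (moll n) y + \<epsilon> * t / \<kappa> y"
proof -
  obtain \<delta> t0 where \<delta>: "0 < \<delta>" "0 < t0" "\<And>t x y. 0 \<le> t \<Longrightarrow> t \<le> t0 \<Longrightarrow> norm x \<le> \<delta> \<Longrightarrow>
      S t (translate x f) y \<le> translate x (S t f) y + \<epsilon> * t / \<kappa> y"
    using trans[OF assms] by (metis atLeastAtMost_iff)
  obtain k where k: "1 / real (Suc k) < \<delta>" using nat_approx_posE[OF \<delta>(1)] by blast
  show ?thesis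
  proof (rule that[of "Suc k" t0])
    fix n t y assume n: "Suc k \<le> n" and t: "0 \<le> t" "t \<le> t0"
    have "1 / real n \<le> 1 / real (Suc k)" using n by (intro divide_left_mono) auto
    then have n\<delta>: "1 / real n \<le> \<delta>" using k by simp
    have n1: "1 \<le> n" using n by simp
    have Stf: "loc_integrable (S t f)" by (rule loc_integrable_continuous[OF C_continuous[OF S_C[OF t(1) f_C]]])
    have "S t (fn n) y \<le> conv (S t f) (moll n) y + \<epsilon> * t / \<kappa> y"
      unfolding fn_def
      by (rule S_conv_le[OF t(1) f_C n1 fn_C[OF n1, unfolded fn_def]]) (use \<delta>(3)[OF t] n\<delta> in auto)
    moreover have "conv (\<lambda>z. S t f z - f z) (moll n) y = conv (S t f) (moll n) y - fn n y"
    proof -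
      have "loc_integrable (\<lambda>z. S t f z - f z)"
        using loc_integrable_add[OF Stf loc_integrable_uminus[OF f_loc]] by simp
      then show ?thesis
        using moll_weight_mult_integrable[OF n1 Stf, of y] moll_weight_mult_integrable[OF n1 f_loc, of y]
        unfolding fn_def by (simp add: conv_moll Stf f_loc left_diff_distrib)
    qed
    ultimately show "S t (fn n) y - fn n y \<le> conv (\<lambda>z. S t f z - f z) (moll n) y + \<epsilon> * t / \<kappa> y" by simp
  qed (use \<delta> in auto)
qed

lemma increment_loc: "0 \<le> t \<Longrightarrow> loc_integrable (\<lambda>z. S t f z - f z)"
  by (intro loc_integrable_continuous continuous_intros C_continuous S_C f_C)

text \<open>The constants are uniform in \<open>n\<close>. This is what allows a single comparison function for all
large \<open>n\<close> in the upper bound.\<close>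

lemma fn_increment:
  obtains C N t0 where "0 \<le> C" "1 \<le> N" "0 < t0"
    "\<And>n h y. N \<le> n \<Longrightarrow> 0 < h \<Longrightarrow> h \<le> t0 \<Longrightarrow> S h (fn n) y - fn n y \<le> h * C / \<kappa> y"
proof -
  obtain C t0 where C: "0 \<le> C" "0 < t0" "\<And>h x. 0 < h \<Longrightarrow> h \<le> t0 \<Longrightarrow> S h f x - f x \<le> h * C / \<kappa> x"
    using f_increment by metis
  obtain N t1 where N: "1 \<le> N" "0 < t1"
    "\<And>n t y. N \<le> n \<Longrightarrow> 0 \<le> t \<Longrightarrow> t \<le> t1 \<Longrightarrow>
       S t (fn n) y - fn n y \<le> conv (\<lambda>z. S t f z - f z) (moll n) y + 1 * t / \<kappa> y"
    by (rule fn_increment_le_conv[OF zero_less_one]) (rule that; simp)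
  obtain M where M: "1 \<le> M" "\<And>x y C. 0 \<le> C \<Longrightarrow> norm y \<le> 1 \<Longrightarrow> C / \<kappa> (x - y) \<le> C * M / \<kappa> x" using \<kappa>_shift by metis
  show ?thesis
  proof (rule that[of "C * M + 1" N "min t0 t1"])
    fix n h y assume n: "N \<le> n" and h: "0 < h" "h \<le> min t0 t1"
    have n1: "1 \<le> n" using n N by simp
    have "conv (\<lambda>z. S h f z - f z) (moll n) y \<le> h * (C * M) / \<kappa> y"
    proof (rule conv_moll_le[OF n1 increment_loc], goal_cases)
      case 2
      show ?case
      proof (rule AE_I2, rule impI)
        fix z assume z: "z \<in> cball y (1 / real n)"
        have "1 / real n \<le> 1" using n1 by simp
        then have "norm (y - z) \<le> 1" using z by (simp add: dist_norm)
        from M(2)[OF _ this, of "h * C" y] h C(1) C(3)[of h z]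
        show "S h f z - f z \<le> h * (C * M) / \<kappa> y" by (simp add: mult.assoc)
      qed
    qed (use h in simp)
    then show "S h (fn n) y - fn n y \<le> h * (C * M + 1) / \<kappa> y"
      using N(3)[OF n, of h y] h by (simp add: distrib_left add_divide_distrib)
  qed (use C M N in auto)
qed

lemma fn_bound:
  obtains C where "0 \<le> C" "\<And>n y. 1 \<le> n \<Longrightarrow> \<bar>fn n y\<bar> \<le> C / \<kappa> y" "\<And>y. \<bar>f y\<bar> \<le> C / \<kappa> y"
proof -
  obtain C where C: "0 \<le> C" "\<And>y. \<bar>f y\<bar> \<le> C / \<kappa> y" using C_bound[OF f_C] by metis
  obtain M where M: "1 \<le> M" "\<And>x y C. 0 \<le> C \<Longrightarrow> norm y \<le> 1 \<Longrightarrow> C / \<kappa> (x - y) \<le> C * M / \<kappa> x" using \<kappa>_shift by metis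
  show ?thesis
  proof (rule that[of "C * M"])
    show "0 \<le> C * M" using C M by simp
    show "\<bar>f y\<bar> \<le> C * M / \<kappa> y" for y using C(2)[of y] M(2)[OF C(1), of 0 y] by simp
    fix n y assume n: "1 \<le> (n::nat)"
    have "\<bar>fn n y - 0\<bar> \<le> C * M / \<kappa> y"
      unfolding fn_def
    proof (rule abs_conv_moll_diff_le[OF n f_loc])
      fix z assume z: "z \<in> cball y (1 / real n)"
      have "1 / real n \<le> 1" using n by simp
      then have "norm (y - z) \<le> 1" using z by (simp add: dist_norm)
      from M(2)[OF C(1) this, of y] C(2)[of z] show "\<bar>f z - 0\<bar> \<le> C * M / \<kappa> y" by simp
    qed
    then show "\<bar>fn n y\<bar> \<le> C * M / \<kappa> y" by simp
  qed
qed

lemma fn_uniform: "0 < e \<Longrightarrow> \<forall>\<^sub>F n in sequentially. \<forall>y\<in>cball 0 R. \<bar>fn n y - f y\<bar> \<le> e"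
  unfolding fn_def by (rule conv_moll_uniform_limit[OF C_continuous[OF f_C]])

end

section \<open>The Gamma-limit of the difference quotients\<close>

context mollified_generator begin

text \<open>Upgrades the pointwise strict bound \<open>Hn n < v\<close> on a ball to a bound on the difference quotients
that is uniform in space. Otherwise points violating the bound at times tending to zero would
accumulate in the compact ball and contradict the upper half of the Gamma-limit.\<close>

lemma fn_quotient_bound:
  assumes n: "1 \<le> n" and v: "continuous_on UNIV v" and "0 < t0" and "0 < r"
    and far: "\<And>h z. 0 < h \<Longrightarrow> h \<le> t0 \<Longrightarrow> z \<notin> cball x r \<Longrightarrow> S h (fn n) z - fn n z \<le> h * v z"
    and near: "\<And>z. z \<in> cball x r \<Longrightarrow> Hn n z < v z"
  obtains h0 where "0 < h0" "\<And>h z. 0 < h \<Longrightarrow> h \<le> h0 \<Longrightarrow> S h (fn n) z - fn n z \<le> h * v z"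
proof -
  have "\<exists>h0>0. \<forall>h z. 0 < h \<and> h \<le> h0 \<longrightarrow> S h (fn n) z - fn n z \<le> h * v z"
  proof (rule ccontr)
    assume contra: "\<not> ?thesis"
    have "\<exists>h z. 0 < h \<and> h \<le> min t0 (1 / real (Suc k)) \<and> h * v z < S h (fn n) z - fn n z" for k
    proof -
      have "0 < min t0 (1 / real (Suc k))" using \<open>0 < t0\<close> by simp
      then show ?thesis using contra unfolding not_le[symmetric] by blast
    qed
    then obtain h z where hz: "\<And>k. 0 < h k" "\<And>k. h k \<le> min t0 (1 / real (Suc k))"
      "\<And>k. h k * v (z k) < S (h k) (fn n) (z k) - fn n (z k)" by metis
    have "z k \<in> cball x r" for k
      using far[of "h k" "z k"] hz[of k] by (meson min.boundedE not_less)
    then obtain z0 \<sigma> where z0: "z0 \<in> cball x r" "strict_mono \<sigma>" "(z \<circ> \<sigma>) \<longlonglongrightarrow> z0"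
      using compact_cball[of x r] unfolding compact_def by meson
    have lim1: "(\<lambda>k. 1 / real (Suc k)) \<longlonglongrightarrow> 0"
      using LIMSEQ_inverse_real_of_nat by (simp add: inverse_eq_divide)
    have "h \<longlonglongrightarrow> 0"
      by (rule tendsto_sandwich[OF _ _ tendsto_const lim1]) (use hz(1,2) in \<open>auto simp: less_imp_le\<close>)
    then have "(h \<circ> \<sigma>) \<longlonglongrightarrow> 0" using z0(2) by (rule LIMSEQ_subseq_LIMSEQ)
    have "limsup (\<lambda>k. ereal ((S ((h \<circ> \<sigma>) k) (fn n) ((z \<circ> \<sigma>) k) - fn n ((z \<circ> \<sigma>) k)) / (h \<circ> \<sigma>) k)) \<le> ereal (Hn n z0)"
      by (rule fn_limsup[OF n]) (use hz(1) \<open>(h \<circ> \<sigma>) \<longlonglongrightarrow> 0\<close> z0(3) in \<open>simp_all add: o_def\<close>)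
    moreover have "ereal (v z0) \<le> limsup (\<lambda>k. ereal ((S ((h \<circ> \<sigma>) k) (fn n) ((z \<circ> \<sigma>) k) - fn n ((z \<circ> \<sigma>) k)) / (h \<circ> \<sigma>) k))"
    proof -
      have "isCont v z0" using v by (simp add: continuous_on_eq_continuous_at)
      then have "(\<lambda>k. v ((z \<circ> \<sigma>) k)) \<longlonglongrightarrow> v z0" using z0(3) by (rule isCont_tendsto_compose)
      then have "limsup (\<lambda>k. ereal (v ((z \<circ> \<sigma>) k))) = ereal (v z0)"
        by (intro lim_imp_Limsup) auto
      moreover have "limsup (\<lambda>k. ereal (v ((z \<circ> \<sigma>) k))) \<le> limsup (\<lambda>k. ereal ((S ((h \<circ> \<sigma>) k) (fn n) ((z \<circ> \<sigma>) k) - fn n ((z \<circ> \<sigma>) k)) / (h \<circ> \<sigma>) k))"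
      proof (rule Limsup_mono, rule always_eventually, rule allI)
        fix k
        show "ereal (v ((z \<circ> \<sigma>) k)) \<le> ereal ((S ((h \<circ> \<sigma>) k) (fn n) ((z \<circ> \<sigma>) k) - fn n ((z \<circ> \<sigma>) k)) / (h \<circ> \<sigma>) k)"
          using hz(1)[of "\<sigma> k"] hz(3)[of "\<sigma> k"] by (simp add: pos_le_divide_eq mult.commute)
      qed
      ultimately show ?thesis by simp
    qed
    ultimately have "ereal (v z0) \<le> ereal (Hn n z0)" by (rule order_trans[rotated])
    then show False using near[OF z0(1)] by simp
  qed
  then show ?thesis using that by blast
qed

text \<open>Summation over steps of length \<open>t / m\<close>. In each step \<open>S h (fn n)\<close> lies below the convex
combination of \<open>fn n + v\<close> and \<open>fn n\<close> with weights \<open>h\<close> and \<open>1 - h\<close>, so convexity of \<open>S s\<close> bounds the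
increment by \<open>h\<close> times the slope.\<close>

lemma fn_growth:
  assumes n: "1 \<le> n" and v: "v \<in> C_space \<kappa>" and "0 < h0"
    and quot: "\<And>h z. 0 < h \<Longrightarrow> h \<le> h0 \<Longrightarrow> S h (fn n) z - fn n z \<le> h * v z"
    and t: "0 \<le> t"
    and slope: "\<And>s. 0 \<le> s \<Longrightarrow> s \<le> t \<Longrightarrow> S s (\<lambda>z. fn n z + v z) y - S s (fn n) y \<le> K"
  shows "S t (fn n) y \<le> fn n y + t * K"
proof -
  have step: "S (s + h) (fn n) y \<le> S s (fn n) y + h * K"
    if s: "0 \<le> s" "s \<le> t" and h: "0 < h" "h \<le> h0" "h \<le> 1" for s h
  proof -
    let ?w = "\<lambda>z. fn n z + v z"
    have w: "?w \<in> C_space \<kappa>" by (rule C_add[OF fn_C[OF n] v])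
    have "S (s + h) (fn n) y = S s (S h (fn n)) y" using s h by (simp add: S_add fn_C[OF n])
    also have "\<dots> \<le> S s (\<lambda>z. h * ?w z + (1 - h) * fn n z) y"
    proof (rule S_mono[OF s(1)])
      show "S h (fn n) \<in> C_space \<kappa>" using h by (intro S_C fn_C n) simp
      show "(\<lambda>z. h * ?w z + (1 - h) * fn n z) \<in> C_space \<kappa>" by (intro C_add[OF C_cmult[OF w] C_cmult[OF fn_C[OF n]]])
      show "S h (fn n) z \<le> h * ?w z + (1 - h) * fn n z" for z
        using quot[OF h(1,2), of z] by (simp add: algebra_simps)
    qed
    also have "\<dots> \<le> h * S s ?w y + (1 - h) * S s (fn n) y"
      by (rule S_convex[OF s(1) w fn_C[OF n]]) (use h in auto)
    also have "\<dots> = S s (fn n) y + h * (S s ?w y - S s (fn n) y)" by (simp add: algebra_simps)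
    also have "\<dots> \<le> S s (fn n) y + h * K"
      using slope[OF s] h by (intro add_left_mono mult_left_mono) auto
    finally show ?thesis .
  qed
  show ?thesis
  proof (cases "t = 0")
    case True
    then show ?thesis by (simp add: S_0 fn_C[OF n])
  next
    case False
    then have "0 < t" using t by simp
    obtain m :: nat where m: "t / min h0 1 < real m" using reals_Archimedean2 by blast
    have "0 < min h0 1" using \<open>0 < h0\<close> by simp
    then have "0 < t / min h0 1" using \<open>0 < t\<close> by simp
    then have "0 < real m" using m by linarith
    define h where "h = t / real m"
    have h: "0 < h" "h \<le> min h0 1"
    proof -
      show "0 < h" unfolding h_def using \<open>0 < t\<close> \<open>0 < real m\<close> by (rule divide_pos_pos)
      have "t < real m * min h0 1" using m \<open>0 < min h0 1\<close> by (simp only: pos_divide_less_eq)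
      then have "t / real m < min h0 1" using \<open>0 < real m\<close> by (simp only: pos_divide_less_eq mult.commute)
      then show "h \<le> min h0 1" unfolding h_def by (rule less_imp_le)
    qed
    have "S (real j * h) (fn n) y \<le> fn n y + real j * h * K" if "j \<le> m" for j
      using that
    proof (induction j)
      case 0
      then show ?case by (simp add: S_0 fn_C[OF n])
    next
      case (Suc j)
      have "real j * h \<le> real m * h" using Suc.prems h by (intro mult_right_mono) auto
      then have "real j * h \<le> t" using \<open>0 < real m\<close> by (simp add: h_def)
      then have "S (real j * h + h) (fn n) y \<le> S (real j * h) (fn n) y + h * K"
        using h by (intro step) auto
      then show ?case using Suc by (simp add: algebra_simps)
    qed
    from this[of m] show ?thesis using \<open>0 < real m\<close> by (simp add: h_def)
  qed
qed

text \<open>The upper half of the Gamma-limit. The comparison function \<open>v\<close> is just above \<open>c\<close> at \<open>x\<close> and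
dominates \<open>C / \<kappa>\<close> away from \<open>x\<close>. The function \<open>E\<close>, small at \<open>x\<close> and large away from it, dominates
\<open>\<bar>fn n - f\<bar>\<close> for all large \<open>n\<close>, so semicontinuity at time zero is needed only for two fixed
functions.\<close>

lemma increment_upper_bound:
  assumes less: "avg_usc g x < ereal K"
  obtains d where "0 < d" "\<And>t y. 0 \<le> t \<Longrightarrow> t \<le> d \<Longrightarrow> dist y x \<le> d \<Longrightarrow> S t f y \<le> f y + t * K"
proof -
  obtain \<delta> c where \<delta>: "0 < \<delta>" "c < K" "AE z in lebesgue. z \<in> cball x \<delta> \<longrightarrow> g z \<le> c"
    using AE_le_of_avg_usc_less[OF g_loc less] by metis
  obtain C N t0 where C: "0 \<le> C" "1 \<le> N" "0 < t0"
    "\<And>n h y. N \<le> n \<Longrightarrow> 0 < h \<Longrightarrow> h \<le> t0 \<Longrightarrow> S h (fn n) y - fn n y \<le> h * C / \<kappa> y"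
    using fn_increment by metis
  obtain B where B: "0 \<le> B" "\<And>n y. 1 \<le> n \<Longrightarrow> \<bar>fn n y\<bar> \<le> B / \<kappa> y" "\<And>y. \<bar>f y\<bar> \<le> B / \<kappa> y"
    using fn_bound by metis
  define r where "r = \<delta> / 2"
  define c' where "c' = (c + K) / 2"
  \<comment> \<open>a quarter, because \<open>E x\<close> and the semicontinuity error each enter twice in the slope\<close>
  define e where "e = (K - c') / 4"
  have r: "0 < r" and c': "c < c'" "c' < K" and e: "0 < e"
    using \<delta> by (auto simp: r_def c'_def e_def)
  define v where "v = (\<lambda>z. c' + (C / \<kappa> z + \<bar>c'\<bar>) * min 1 (dist x z / r))"
  have dist_bounded: "continuous_on UNIV (\<lambda>z. min 1 (dist x z / r))" "\<bar>min 1 (dist x z / r)\<bar> \<le> 1" if "0 < r" for z r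
  proof -
    show "continuous_on UNIV (\<lambda>z. min 1 (dist x z / r))" using that by (intro continuous_intros) auto
    have "0 \<le> dist x z / r" using that by simp
    then show "\<bar>min 1 (dist x z / r)\<bar> \<le> 1" by linarith
  qed
  have v: "v \<in> C_space \<kappa>"
    unfolding v_def using dist_bounded r by (intro C_add C_const C_mult_bounded C_inverse) auto
  have v_ge: "c' \<le> v z" for z
    unfolding v_def using C(1) \<kappa>_pos[of z] r by (simp add: less_imp_le)
  have v_far: "C / \<kappa> z \<le> v z" if "z \<notin> cball x r" for z
  proof -
    have "min 1 (dist x z / r) = 1" using that r by simp
    then show ?thesis unfolding v_def by simp
  qed
  define E where "E = (\<lambda>z. e + 2 * B / \<kappa> z * min 1 (dist x z / 1))"
  have E: "E \<in> C_space \<kappa>"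
    unfolding E_def using dist_bounded[of 1] by (intro C_add C_const C_mult_bounded C_inverse) auto
  have close: "\<forall>\<^sub>F n in sequentially. \<forall>z. \<bar>fn n z - f z\<bar> \<le> E z"
  proof -
    have "\<forall>\<^sub>F n in sequentially. \<forall>z\<in>cball 0 (norm x + 1). \<bar>fn n z - f z\<bar> \<le> e" by (rule fn_uniform[OF e])
    moreover have "\<forall>\<^sub>F n in sequentially. 1 \<le> n" by (rule eventually_ge_at_top)
    ultimately show ?thesis
    proof eventually_elim
      case (elim n)
      show ?case
      proof
        fix z
        have Bz: "0 \<le> B / \<kappa> z" using B(1) \<kappa>_pos[of z] by simp
        show "\<bar>fn n z - f z\<bar> \<le> E z"
        proof (cases "dist x z \<le> 1")
          case True
          then have "z \<in> cball 0 (norm x + 1)"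
            using norm_triangle_ineq2[of z x] by (simp add: dist_norm norm_minus_commute)
          then have "\<bar>fn n z - f z\<bar> \<le> e" using elim(1) by blast
          moreover have "0 \<le> 2 * (B / \<kappa> z) * min 1 (dist x z / 1)" using Bz by (intro mult_nonneg_nonneg) auto
          ultimately show ?thesis unfolding E_def by simp
        next
          case False
          then have "E z = e + 2 * (B / \<kappa> z)" by (simp add: E_def)
          then show ?thesis using B(2)[OF elim(2), of z] B(3)[of z] e by linarith
        qed
      qed
    qed
  qed
  have F1: "(\<lambda>z. f z + E z + v z) \<in> C_space \<kappa>" and F2: "(\<lambda>z. - f z + E z) \<in> C_space \<kappa>"
    by (intro C_add C_uminus f_C E v)+
  have at_x: "E x = e" "v x = c'" by (auto simp: E_def v_def)
  obtain d1 where d1: "0 < d1" "\<And>s y. 0 \<le> s \<Longrightarrow> s \<le> d1 \<Longrightarrow> dist y x \<le> d1 \<Longrightarrow>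
      S s (\<lambda>z. f z + E z + v z) y \<le> f x + e + c' + e"
    using S_upper_near_0[OF F1 e, of x] unfolding at_x by blast
  obtain d2 where d2: "0 < d2" "\<And>s y. 0 \<le> s \<Longrightarrow> s \<le> d2 \<Longrightarrow> dist y x \<le> d2 \<Longrightarrow>
      S s (\<lambda>z. - f z + E z) y \<le> - f x + e + e"
    using S_upper_near_0[OF F2 e, of x] unfolding at_x by blast
  obtain k where k: "1 / real (Suc k) < r" using nat_approx_posE[OF r] by blast
  have large: "\<forall>\<^sub>F n in sequentially. max N (Suc k) \<le> n" by (rule eventually_ge_at_top)
  define d where "d = min d1 d2"
  have growth: "\<forall>\<^sub>F n in sequentially. S t (fn n) y \<le> fn n y + t * K"
    if t: "0 \<le> t" "t \<le> d" and y: "dist y x \<le> d" for t y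
    using large close
  proof eventually_elim
    case (elim n)
    have n: "1 \<le> n" "N \<le> n" "Suc k \<le> n" using elim(1) C(2) by auto
    have "1 / real n \<le> 1 / real (Suc k)" using n by (intro divide_left_mono) auto
    then have nr: "1 / real n \<le> r" using k by simp
    have Hn_le: "Hn n z \<le> c" if z: "z \<in> cball x r" for z
    proof (rule order_trans[OF Hn_le_conv[OF n(1)]], rule conv_moll_le[OF n(1) g_loc])
      have "cball z (1 / real n) \<subseteq> cball x \<delta>"
        using z nr by (intro cball_subset_cball_iff[THEN iffD2]) (auto simp: r_def dist_commute)
      then show "AE u in lebesgue. u \<in> cball z (1 / real n) \<longrightarrow> g u \<le> c"
        using \<delta>(3) by (auto elim!: eventually_mono)
    qed
    obtain h0 where h0: "0 < h0" "\<And>h z. 0 < h \<Longrightarrow> h \<le> h0 \<Longrightarrow> S h (fn n) z - fn n z \<le> h * v z"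
    proof (rule fn_quotient_bound[OF n(1) C_continuous[OF v] C(3) r, of x])
      show "S h (fn n) z - fn n z \<le> h * v z" if "0 < h" "h \<le> t0" "z \<notin> cball x r" for h z
        using C(4)[OF n(2) that(1,2), of z] mult_left_mono[OF v_far[OF that(3)], of h] that(1) by simp
      show "Hn n z < v z" if "z \<in> cball x r" for z
        using Hn_le[OF that] c' v_ge[of z] by linarith
    qed (rule that; blast)
    show ?case
    proof (rule fn_growth[OF n(1) v h0(1) h0(2) t(1)])
      fix s assume s: "0 \<le> s" "s \<le> t"
      have sd: "s \<le> d1" "s \<le> d2" "dist y x \<le> d1" "dist y x \<le> d2" using s t y by (auto simp: d_def)
      have "S s (\<lambda>z. fn n z + v z) y \<le> S s (\<lambda>z. f z + E z + v z) y"
        by (rule S_mono[OF s(1) C_add[OF fn_C[OF n(1)] v] F1]) (use elim(2) in \<open>force simp: abs_le_iff algebra_simps\<close>)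
      moreover have "- S s (fn n) y \<le> S s (\<lambda>z. - fn n z) y"
        using S_lower[OF s(1) fn_C[OF n(1)], of y] by linarith
      moreover have "S s (\<lambda>z. - fn n z) y \<le> S s (\<lambda>z. - f z + E z) y"
        by (rule S_mono[OF s(1) C_uminus[OF fn_C[OF n(1)]] F2]) (use elim(2) in \<open>force simp: abs_le_iff algebra_simps\<close>)
      moreover have "4 * e = K - c'" by (simp add: e_def)
      ultimately show "S s (\<lambda>z. fn n z + v z) y - S s (fn n) y \<le> K"
        using d1(2)[OF s(1) sd(1,3)] d2(2)[OF s(1) sd(2,4)] by linarith
    qed auto
  qed
  show ?thesis
  proof (rule that[of d])
    show "0 < d" using d1 d2 by (simp add: d_def)
    fix t y assume t: "0 \<le> t" "t \<le> d" and y: "dist y x \<le> d"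
    \<comment> \<open>the indices are shifted because only \<open>fn n\<close> with \<open>n \<ge> 1\<close> is known to be in \<open>C_space \<kappa>\<close>\<close>
    have shift: "\<forall>\<^sub>F n in sequentially. P (Suc n)" if "\<forall>\<^sub>F n in sequentially. P n" for P
      using that by (simp add: eventually_sequentially_Suc)
    show "S t f y \<le> f y + t * K"
    proof (rule S_lower_semicontinuous[OF t(1), where F="\<lambda>n. fn (Suc n)" and C=B])
      show "\<forall>\<^sub>F n in sequentially. \<forall>y\<in>cball 0 R. \<bar>fn (Suc n) y - f y\<bar> \<le> e" if "0 < e" for R e
        by (rule shift[OF fn_uniform[OF that]])
      show "\<forall>\<^sub>F n in sequentially. S t (fn (Suc n)) y \<le> fn (Suc n) y + t * K"
        by (rule shift[OF growth[OF t y]])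
      have "(\<lambda>n. fn (Suc n) y) \<longlonglongrightarrow> f y"
      proof (rule tendstoI)
        fix e :: real assume "0 < e"
        then have "\<forall>\<^sub>F n in sequentially. \<forall>z\<in>cball 0 (norm y). \<bar>fn (Suc n) z - f z\<bar> \<le> e / 2"
          by (intro shift fn_uniform) simp
        then show "\<forall>\<^sub>F n in sequentially. dist (fn (Suc n) y) (f y) < e"
        proof eventually_elim
          case (elim n)
          then have "\<bar>fn (Suc n) y - f y\<bar> \<le> e / 2" by simp
          then show ?case using \<open>0 < e\<close> by (simp add: dist_real_def)
        qed
      qed
      then show "(\<lambda>n. fn (Suc n) y + t * K) \<longlonglongrightarrow> f y + t * K" by (intro tendsto_intros)
    qed (auto intro: fn_C f_C B)
  qed
qed

text \<open>The lower half of the Gamma-limit, in contrapositive form. Since every null sequence of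
times is admitted, it applies to arbitrary subsequences.\<close>

lemma avg_usc_le_of_increment:
  assumes h: "\<And>k. 0 < h k" "h \<longlonglongrightarrow> 0" and r: "0 < r"
    and le: "\<And>k y. y \<in> cball x r \<Longrightarrow> S (h k) f y - f y \<le> h k * c"
  shows "avg_usc g x \<le> ereal c"
proof -
  have Hn_le: "\<forall>\<^sub>F n in sequentially. Hn n y \<le> c + \<epsilon> / \<kappa> y" if y: "y \<in> ball x (r / 2)" and \<epsilon>: "0 < \<epsilon>" for y \<epsilon>
  proof -
    obtain N t0 where N: "1 \<le> N" "0 < t0" "\<And>n t y. N \<le> n \<Longrightarrow> 0 \<le> t \<Longrightarrow> t \<le> t0 \<Longrightarrow>
       S t (fn n) y - fn n y \<le> conv (\<lambda>z. S t f z - f z) (moll n) y + \<epsilon> * t / \<kappa> y"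
      by (rule fn_increment_le_conv[OF \<epsilon>]) (rule that; simp)
    have "0 < r / 2" using r by simp
    then obtain k where k: "1 / real (Suc k) < r / 2" using nat_approx_posE by blast
    show ?thesis
    proof (rule eventually_sequentiallyI[of "max N (Suc k)"])
      fix n assume "max N (Suc k) \<le> n"
      then have n: "1 \<le> n" "N \<le> n" "Suc k \<le> n" using N by auto
      have "1 / real n \<le> 1 / real (Suc k)" using n by (intro divide_left_mono) auto
      then have nr: "1 / real n \<le> r / 2" using k by simp
      obtain xs where xs: "xs \<longlonglongrightarrow> y" "(\<lambda>j. (S (h j) (fn n) (xs j) - fn n (xs j)) / h j) \<longlonglongrightarrow> Hn n y"
        by (rule fn_recovery[OF n(1) h])
      have "isCont (\<lambda>z. c + \<epsilon> / \<kappa> z) y"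
        using \<kappa>_cont \<kappa>_pos[of y] by (intro continuous_intros) (auto simp: continuous_on_eq_continuous_at)
      then have lim: "(\<lambda>j. c + \<epsilon> / \<kappa> (xs j)) \<longlonglongrightarrow> c + \<epsilon> / \<kappa> y" using xs(1) by (rule isCont_tendsto_compose)
      show "Hn n y \<le> c + \<epsilon> / \<kappa> y"
      proof (rule tendsto_le[OF _ lim xs(2)])
        have "\<forall>\<^sub>F j in sequentially. xs j \<in> ball x (r / 2)" using topological_tendstoD[OF xs(1) open_ball y] .
        moreover have "\<forall>\<^sub>F j in sequentially. h j < t0" by (rule order_tendstoD(2)[OF h(2) N(2)])
        ultimately show "\<forall>\<^sub>F j in sequentially. (S (h j) (fn n) (xs j) - fn n (xs j)) / h j \<le> c + \<epsilon> / \<kappa> (xs j)"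
        proof eventually_elim
          case (elim j)
          have hj: "0 \<le> h j" using h(1)[of j] by simp
          have "conv (\<lambda>z. S (h j) f z - f z) (moll n) (xs j) \<le> h j * c"
          proof (rule conv_moll_le[OF n(1) increment_loc[OF hj]])
            have "cball (xs j) (1 / real n) \<subseteq> cball x r"
              using elim(1) nr by (intro cball_subset_cball_iff[THEN iffD2]) (auto simp: dist_commute)
            then show "AE z in lebesgue. z \<in> cball (xs j) (1 / real n) \<longrightarrow> S (h j) f z - f z \<le> h j * c"
              using le by (auto intro!: AE_I2)
          qed
          then have "S (h j) (fn n) (xs j) - fn n (xs j) \<le> h j * c + \<epsilon> * h j / \<kappa> (xs j)"
            using N(3)[OF n(2) hj, of "xs j"] elim(2) by simp
          also have "\<dots> = h j * (c + \<epsilon> / \<kappa> (xs j))" by (simp add: algebra_simps)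
          finally show ?case using h(1)[of j] by (simp add: pos_divide_le_eq mult.commute)
        qed
      qed simp
    qed
  qed
  show ?thesis
  proof (rule avg_usc_le[OF g_loc, of "r / 4"])
    show "AE z in lebesgue. z \<in> cball x (r / 4) \<longrightarrow> g z \<le> c"
      using AE_g_le
    proof eventually_elim
      case (elim z)
      show ?case
      proof
        assume "z \<in> cball x (r / 4)"
        then have z: "z \<in> ball x (r / 2)" using r by simp
        show "g z \<le> c"
        proof (rule field_le_epsilon)
          fix e :: real assume "0 < e"
          then have "\<forall>\<^sub>F n in sequentially. Hn n z \<le> c + (e * \<kappa> z) / \<kappa> z"
            using \<kappa>_pos[of z] by (intro Hn_le[OF z]) simp
          then show "g z \<le> c + e" using elim \<kappa>_pos[of z] by simp
        qed
      qed
    qed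
  qed (use r in simp)
qed

text \<open>The global bound on the increments of \<open>f\<close> is inherited by \<open>avg_usc g\<close>; the continuity of
\<open>C / \<kappa>\<close> makes the bound locally constant up to \<open>e\<close>.\<close>

lemma avg_usc_bound:
  obtains C where "0 \<le> C" "\<And>x. avg_usc g x \<le> ereal (C / \<kappa> x)"
proof -
  obtain C t0 where C: "0 \<le> C" "0 < t0" "\<And>h x. 0 < h \<Longrightarrow> h \<le> t0 \<Longrightarrow> S h f x - f x \<le> h * C / \<kappa> x"
    using f_increment by metis
  show ?thesis
  proof (rule that[OF C(1)])
    fix x
    show "avg_usc g x \<le> ereal (C / \<kappa> x)"
    proof (rule ereal_le_epsilon2)
      fix e :: real assume e: "0 < e"
      have "isCont (\<lambda>z. C / \<kappa> z) x"
        using \<kappa>_cont \<kappa>_pos[of x] by (intro continuous_intros) (auto simp: continuous_on_eq_continuous_at)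
      then obtain d where d: "0 < d" "\<And>z. dist z x < d \<Longrightarrow> dist (C / \<kappa> z) (C / \<kappa> x) < e"
        using e unfolding continuous_at_eps_delta by metis
      define h where "h = (\<lambda>k. min t0 (1 / real (Suc k)))"
      have "avg_usc g x \<le> ereal (C / \<kappa> x + e)"
      proof (rule avg_usc_le_of_increment[of h "d / 2"])
        show hpos: "0 < h k" for k using C(2) by (simp add: h_def)
        have lim1: "(\<lambda>k. 1 / real (Suc k)) \<longlonglongrightarrow> 0"
          using LIMSEQ_inverse_real_of_nat by (simp add: inverse_eq_divide)
        show "h \<longlonglongrightarrow> 0"
          by (rule tendsto_sandwich[OF _ _ tendsto_const lim1]) (use hpos in \<open>auto simp: less_imp_le\<close>, simp add: h_def)
        show "0 < d / 2" using d by simp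
        fix k y assume "y \<in> cball x (d / 2)"
        then have "dist y x < d" using d(1) by (simp add: dist_commute)
        then have "C / \<kappa> y \<le> C / \<kappa> x + e" using d(2)[of y] by (simp add: dist_real_def)
        then have "h k * (C / \<kappa> y) \<le> h k * (C / \<kappa> x + e)" using hpos[of k] by (intro mult_left_mono) auto
        moreover have "S (h k) f y - f y \<le> h k * C / \<kappa> y" by (rule C(3)[OF hpos]) (simp add: h_def)
        ultimately show "S (h k) f y - f y \<le> h k * (C / \<kappa> x + e)" by simp
      qed
      then show "avg_usc g x \<le> ereal (C / \<kappa> x) + ereal e" by simp
    qed
  qed
qed

lemma increment_limsup:
  assumes h: "\<And>k. 0 < h k" "h \<longlonglongrightarrow> 0" and xs: "xs \<longlonglongrightarrow> x"
  shows "limsup (\<lambda>k. diff_quot S f (h k) (xs k)) \<le> avg_usc g x"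
proof (rule ccontr)
  assume "\<not> ?thesis"
  then obtain K where K: "avg_usc g x < ereal K" "ereal K < limsup (\<lambda>k. diff_quot S f (h k) (xs k))"
    using ereal_dense2 by (metis not_le)
  obtain d where d: "0 < d" "\<And>t y. 0 \<le> t \<Longrightarrow> t \<le> d \<Longrightarrow> dist y x \<le> d \<Longrightarrow> S t f y \<le> f y + t * K"
    using increment_upper_bound[OF K(1)] by blast
  have "\<forall>\<^sub>F k in sequentially. h k < d" by (rule order_tendstoD(2)[OF h(2) d(1)])
  moreover have "\<forall>\<^sub>F k in sequentially. dist (xs k) x < d" by (rule tendstoD[OF xs d(1)])
  ultimately have "\<forall>\<^sub>F k in sequentially. diff_quot S f (h k) (xs k) \<le> ereal K"
  proof eventually_elim
    case (elim k)
    then show ?case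
      using d(2)[of "h k" "xs k"] h(1)[of k] by (simp add: diff_quot_def pos_divide_le_eq mult.commute)
  qed
  then have "limsup (\<lambda>k. diff_quot S f (h k) (xs k)) \<le> ereal K" by (rule Limsup_bounded)
  then show False using K(2) by simp
qed

text \<open>For every \<open>e\<close>, points within distance \<open>e\<close> of \<open>x\<close> at which the quotient exceeds
\<open>avg_usc g x - e\<close> eventually exist: otherwise \<open>avg_usc_le_of_increment\<close> applies to a subsequence. The
diagonal choice makes them converge, and the bound from above is automatic.\<close>

lemma increment_recovery:
  assumes h: "\<And>k. 0 < h k" "h \<longlonglongrightarrow> 0"
  shows "\<exists>xs. xs \<longlonglongrightarrow> x \<and> (\<lambda>k. diff_quot S f (h k) (xs k)) \<longlonglongrightarrow> avg_usc g x"
proof -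
  have "\<exists>xs. xs \<longlonglongrightarrow> x \<and> avg_usc g x \<le> liminf (\<lambda>k. diff_quot S f (h k) (xs k))"
  proof (cases "avg_usc g x")
    case (real L)
    define Q where "Q = (\<lambda>k y e. dist y x \<le> e \<and> L - e < (S (h k) f y - f y) / h k)"
    have ex: "\<forall>\<^sub>F k in sequentially. \<exists>y. Q k y e" if "0 < e" for e
    proof (rule ccontr)
      assume "\<not> ?thesis"
      from not_eventually_sequentiallyD[OF this]
      obtain \<sigma> :: "nat \<Rightarrow> nat" where \<sigma>: "strict_mono \<sigma>" "\<And>k. \<not> (\<exists>y. Q (\<sigma> k) y e)" by blast
      have "avg_usc g x \<le> ereal (L - e)"
      proof (rule avg_usc_le_of_increment[of "h \<circ> \<sigma>" e])
        show "(h \<circ> \<sigma>) \<longlonglongrightarrow> 0" using h(2) \<sigma>(1) by (rule LIMSEQ_subseq_LIMSEQ)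
        show "S ((h \<circ> \<sigma>) k) f y - f y \<le> (h \<circ> \<sigma>) k * (L - e)" if "y \<in> cball x e" for k y
        proof -
          have "(S (h (\<sigma> k)) f y - f y) / h (\<sigma> k) \<le> L - e"
            using \<sigma>(2)[of k] that by (auto simp: Q_def dist_commute not_less)
          then show ?thesis using h(1)[of "\<sigma> k"] by (simp add: pos_divide_le_eq mult.commute)
        qed
      qed (use h that in auto)
      then show False using real that by simp
    qed
    have mono: "Q k y e'" if "Q k y e" "e \<le> e'" for k y e e' using that by (auto simp: Q_def)
    obtain xs where xs: "\<And>e. 0 < e \<Longrightarrow> \<forall>\<^sub>F k in sequentially. Q k (xs k) e"
      by (rule eventually_diagonal_choice[of Q, OF ex mono]) (assumption | rule that)+
    have "xs \<longlonglongrightarrow> x"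
    proof (rule tendstoI)
      fix e :: real assume "0 < e"
      then have "\<forall>\<^sub>F k in sequentially. Q k (xs k) (e / 2)" by (intro xs) simp
      then show "\<forall>\<^sub>F k in sequentially. dist (xs k) x < e"
        by eventually_elim (use \<open>0 < e\<close> in \<open>simp add: Q_def\<close>)
    qed
    moreover have "avg_usc g x \<le> liminf (\<lambda>k. diff_quot S f (h k) (xs k))"
    proof (rule ereal_le_epsilon2)
      fix e :: real assume "0 < e"
      have "ereal (L - e) \<le> liminf (\<lambda>k. diff_quot S f (h k) (xs k))"
        by (rule Liminf_bounded) (use xs[OF \<open>0 < e\<close>] in \<open>auto elim!: eventually_mono simp: Q_def diff_quot_def\<close>)
      then have "ereal (L - e) + ereal e \<le> liminf (\<lambda>k. diff_quot S f (h k) (xs k)) + ereal e"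
        by (rule add_right_mono)
      then show "avg_usc g x \<le> liminf (\<lambda>k. diff_quot S f (h k) (xs k)) + ereal e" using real by simp
    qed
    ultimately show ?thesis by blast
  next
    case PInf
    moreover obtain C where "avg_usc g x \<le> ereal (C / \<kappa> x)" using avg_usc_bound by blast
    ultimately show ?thesis by simp
  next
    case MInf
    then show ?thesis by (intro exI[of _ "\<lambda>_. x"]) simp
  qed
  then obtain xs where xs: "xs \<longlonglongrightarrow> x" "avg_usc g x \<le> liminf (\<lambda>k. diff_quot S f (h k) (xs k))" by blast
  have "limsup (\<lambda>k. diff_quot S f (h k) (xs k)) \<le> avg_usc g x" by (rule increment_limsup[OF h xs(1)])
  moreover have "liminf (\<lambda>k. diff_quot S f (h k) (xs k)) \<le> limsup (\<lambda>k. diff_quot S f (h k) (xs k))"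
    by (rule Liminf_le_Limsup) simp
  ultimately have "(\<lambda>k. diff_quot S f (h k) (xs k)) \<longlonglongrightarrow> avg_usc g x"
    using xs(2) by (subst tendsto_iff_Liminf_eq_Limsup) (auto intro: antisym order_trans)
  then show ?thesis using xs(1) by blast
qed

lemma wnorm_positive_part_le:
  assumes "0 \<le> C" "\<And>x. u x \<le> ereal (C / \<kappa> x)"
  shows "wnorm \<kappa> (\<lambda>x. max (u x) 0) \<le> ereal C"
  unfolding wnorm_def
proof (rule SUP_least)
  fix x
  have "max (u x) 0 \<le> ereal (C / \<kappa> x)" using assms \<kappa>_pos[of x] by (simp add: less_imp_le)
  then have "max (u x) 0 * ereal (\<kappa> x) \<le> ereal (C / \<kappa> x) * ereal (\<kappa> x)"
    using \<kappa>_pos[of x] by (intro ereal_mult_right_mono) (auto simp: less_imp_le)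
  then show "\<bar>max (u x) 0\<bar> * ereal (\<kappa> x) \<le> ereal C" using \<kappa>_pos[of x] by simp
qed

lemma C_space_in_U_space:
  assumes "u \<in> C_space \<kappa>"
  shows "(\<lambda>x. ereal (u x)) \<in> U_space \<kappa>"
proof -
  obtain C where C: "0 \<le> C" "\<And>x. \<bar>u x\<bar> \<le> C / \<kappa> x" using C_bound[OF assms] by metis
  have "wnorm \<kappa> (\<lambda>x. max (ereal (u x)) 0) \<le> ereal C"
    using C by (intro wnorm_positive_part_le) (auto simp: abs_le_iff)
  moreover have "usc (\<lambda>x. ereal (u x))"
    unfolding usc_def using C_continuous[OF assms]
    by (intro allI open_Collect_less continuous_intros)
  ultimately show ?thesis unfolding U_space_def by (auto intro: le_less_trans)
qed

theorem f_generator: "Gamma_right_lim \<kappa> (diff_quot S f) (avg_usc g)"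
  unfolding Gamma_right_lim_def
proof (intro allI impI)
  fix h :: "nat \<Rightarrow> real" assume h: "(\<forall>n. 0 < h n) \<and> h \<longlonglongrightarrow> 0"
  have quot_C: "(\<lambda>x. (S t f x - f x) / t) \<in> C_space \<kappa>" if "0 < t" for t
    using C_cmult[OF C_add[OF S_C[OF _ f_C, of t] C_uminus[OF f_C]], of "1 / t"] that by simp
  show "Gamma_seq_lim \<kappa> (\<lambda>n. diff_quot S f (h n)) (avg_usc g)"
    unfolding Gamma_seq_lim_def
  proof (intro conjI allI impI)
    show "diff_quot S f (h n) \<in> U_space \<kappa>" for n
      using C_space_in_U_space[OF quot_C, of "h n"] h unfolding diff_quot_def[abs_def] by simp
    show "(SUP n. wnorm \<kappa> (\<lambda>x. max (diff_quot S f (h n) x) 0)) < \<infinity>"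
    proof -
      obtain C t0 where C: "0 \<le> C" "0 < t0" "\<And>h x. 0 < h \<Longrightarrow> h \<le> t0 \<Longrightarrow> S h f x - f x \<le> h * C / \<kappa> x"
        using f_increment by metis
      have "\<forall>\<^sub>F n in sequentially. h n < t0" using h C(2) by (auto intro: order_tendstoD)
      then obtain N where N: "\<And>n. N \<le> n \<Longrightarrow> h n < t0" unfolding eventually_sequentially by blast
      have "\<exists>B\<ge>0. \<forall>x. (S (h n) f x - f x) / h n \<le> B / \<kappa> x" for n
        using C_bound[OF quot_C, of "h n"] h by (metis abs_le_D1)
      then obtain B where B: "\<And>n. 0 \<le> B n" "\<And>n x. (S (h n) f x - f x) / h n \<le> B n / \<kappa> x" by metis
      define D where "D = C + (\<Sum>n<N. B n)"
      have sum_nn: "0 \<le> (\<Sum>n<N. B n)" by (rule sum_nonneg) (rule B)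
      have D: "0 \<le> D" using C sum_nn by (simp add: D_def)
      have quot_le: "(S (h n) f x - f x) / h n \<le> D / \<kappa> x" for n x
      proof (cases "N \<le> n")
        case True
        have hn: "0 < h n" using h by blast
        have "S (h n) f x - f x \<le> h n * (C / \<kappa> x)" using C(3)[OF hn, of x] N[OF True] by simp
        then have "(S (h n) f x - f x) / h n \<le> C / \<kappa> x" using hn by (simp add: pos_divide_le_eq mult.commute)
        also have "\<dots> \<le> D / \<kappa> x" using sum_nn \<kappa>_pos[of x] by (intro divide_right_mono) (auto simp: D_def)
        finally show ?thesis .
      next
        case False
        then have "B n \<le> (\<Sum>n<N. B n)" by (intro member_le_sum B) auto
        then have "B n / \<kappa> x \<le> D / \<kappa> x" using C(1) \<kappa>_pos[of x] by (intro divide_right_mono) (auto simp: D_def)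
        then show ?thesis using B(2)[of n x] by linarith
      qed
      have "wnorm \<kappa> (\<lambda>x. max (diff_quot S f (h n) x) 0) \<le> ereal D" for n
        using quot_le[of n] by (intro wnorm_positive_part_le D) (simp add: diff_quot_def)
      then have "(SUP n. wnorm \<kappa> (\<lambda>x. max (diff_quot S f (h n) x) 0)) \<le> ereal D" by (intro SUP_least)
      then show ?thesis by (rule le_less_trans) simp
    qed
    show "avg_usc g \<in> U_space \<kappa>"
    proof -
      obtain C where C: "0 \<le> C" "\<And>x. avg_usc g x \<le> ereal (C / \<kappa> x)" using avg_usc_bound by metis
      have "wnorm \<kappa> (\<lambda>x. max (avg_usc g x) 0) \<le> ereal C" by (rule wnorm_positive_part_le[OF C])
      moreover have "avg_usc g x < \<infinity>" for x using C(2)[of x] by (rule le_less_trans) simp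
      ultimately show ?thesis unfolding U_space_def using usc_avg_usc by (auto intro: le_less_trans)
    qed
    show "limsup (\<lambda>n. diff_quot S f (h n) (xs n)) \<le> avg_usc g x" if "xs \<longlonglongrightarrow> x" for x xs
      by (rule increment_limsup[OF _ _ that]) (use h in auto)
    show "\<exists>xs. xs \<longlonglongrightarrow> x \<and> (\<lambda>n. diff_quot S f (h n) (xs n)) \<longlonglongrightarrow> avg_usc g x" for x
      by (rule increment_recovery) (use h in auto)
  qed
qed

end

theorem theorem4p10:
  fixes \<kappa> :: "real^'d::finite \<Rightarrow> real"
    and S :: "real \<Rightarrow> (real^'d \<Rightarrow> real) \<Rightarrow> real^'d \<Rightarrow> real"
    and \<eta> f g :: "real^'d \<Rightarrow> real"
    and I :: "(nat^'d) set"
    and H :: "(nat^'d \<Rightarrow> real) \<Rightarrow> real"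
    and Df :: "nat^'d \<Rightarrow> real^'d \<Rightarrow> real"
  assumes "\<forall>x. \<kappa> x > 0" and "bounded (range \<kappa>)" and "continuous_on UNIV \<kappa>"
    and "bdd_above {\<kappa> x / \<kappa> (x - y) | x y. norm y \<le> 1}"
    and "convex_monotone_semigroup \<kappa> S"
    and "\<forall>x. \<eta> x \<ge> 0" and "smooth \<eta>" and "supp \<eta> \<subseteq> cball 0 1" and "(LINT x|lebesgue. \<eta> x) = 1"
    and "finite I" and "convex_on_power I H"
    and "f \<in> L_plus \<kappa> S"
    and "\<forall>\<epsilon>>0. \<exists>\<delta>>0. \<exists>t0>0. \<forall>t\<in>{0..t0}. \<forall>x. norm x \<le> \<delta> \<longrightarrow>
           (\<forall>y. S t (translate x f) y \<le> translate x (S t f) y + \<epsilon> * t / \<kappa> y)"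
    and "\<forall>\<alpha>\<in>I. is_regular (dist_deriv \<alpha> (regular_dist f))"
    and "\<forall>\<alpha>\<in>I. represents (Df \<alpha>) (dist_deriv \<alpha> (regular_dist f))"
    and "\<forall>x. g x = H (\<lambda>\<alpha>\<in>I. Df \<alpha> x)"
    and "loc_integrable g"
    and "\<forall>n\<ge>1. conv f (rescale \<eta> n) \<in> Gamma_dom \<kappa> S \<and>
           Gamma_gen \<kappa> S (conv f (rescale \<eta> n)) =
             (\<lambda>x. ereal (H (\<lambda>\<alpha>\<in>I. mderiv \<alpha> (conv f (rescale \<eta> n)) x)))"
  shows "f \<in> Gamma_dom \<kappa> S \<and> (\<forall>x. Gamma_gen \<kappa> S f x = avg_usc g x)"
proof -
  interpret mollified_generator \<kappa> S \<eta> f g I H Df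
    by unfold_locales (use assms in \<open>simp_all only: simp_thms\<close>)
  have "Gamma_gen \<kappa> S f = avg_usc g"
    unfolding Gamma_gen_def using f_generator Gamma_right_lim_unique by (intro the_equality) blast+
  moreover have "f \<in> Gamma_dom \<kappa> S"
    unfolding Gamma_dom_def using f_L f_generator by blast
  ultimately show ?thesis by simp
qed

end
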